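(* Let $G$ be an abelian Lie group. A twisted principal $[G\rightrightarrows e]$-bundle defines a Lie groupoid $G$-extension, and vice versa. Precisely: (i) if $\pi:[E_1\rightrightarrows X_0]\to[X_1\rightrightarrows X_0]$ is an $\eta$-twisted principal $[G\rightrightarrows e]$-bundle (for some admissible $\eta$), then with $i(x,g)=1_x\,g$ the sequence $1\to[X_0\times G\rightrightarrows X_0]\xrightarrow{i}[E_1\rightrightarrows X_0]\xrightarrow{\pi_1}[X_1\rightrightarrows X_0]\to1$ is a Lie groupoid $G$-extension; (ii) if $1\to[M\times G\rightrightarrows M]\xrightarrow{i}[\Gamma_2\rightrightarrows M]\xrightarrow{\phi}[\Gamma_1\rightrightarrows M]\to1$ is a Lie groupoid $G$-extension, then $(\phi,\mathrm{id}_M):[\Gamma_2\rightrightarrows M]\to[\Gamma_1\rightrightarrows M]$, with the right action $(x\xrightarrow{\gamma}y,g)\mapsto\gamma\circ i(x,g)$ of $G$ on $\Gamma_2$, is an $\eta$-twisted principal $[G\rightrightarrows e]$-bundle for $\eta(x\xrightarrow{\gamma}y,g)=i(y,g)\circ\gamma\circ i(x,g^{-1})$.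
   Context: A Lie groupoid $[X_1\rightrightarrows X_0]$ has submersive source/target $s,t$ and smooth structure maps; $\gamma_2\circ\gamma_1$ is defined when $s(\gamma_2)=t(\gamma_1)$. For an abelian Lie group $G$, $[G\rightrightarrows e]$ is the Lie 2-group with one object, morphism group $G$, and composition and multiplication both given by the product of $G$. Lie groupoid $G$-extension: $[M\times G\rightrightarrows M]$ is the bundle of groups (action groupoid of the trivial action) with $s(x,g)=t(x,g)=x$ and $(x,g)\circ(x,g')=(x,gg')$. A Lie groupoid $G$-extension is a short exact sequence of Lie groupoids $1\to[M\times G\rightrightarrows M]\xrightarrow{i}[\Gamma_2\rightrightarrows M]\xrightarrow{\phi}[\Gamma_1\rightrightarrows M]\to1$ over the identity of $M$, with $\phi$ a surjective submersion and $i$ an embedding. Twisted actions: for a Lie groupoid $\mathbb{E}=[E_1\rightrightarrows E_0]$ and a Lie 2-group $\mathbb{G}=[G_1\rightrightarrows G_0]$, a smooth map $\eta:E_1\times G_1\to E_1$ is admissible if $\eta(\gamma,k)$ has the same source and target as $\gamma$, $\eta(\gamma_2\circ\gamma_1,k)=\eta(\gamma_2,k)\circ\eta(\gamma_1,k)$, $\eta(1_x,k)=1_x$, $\eta(\gamma,k_2\circ k_1)=\eta(\eta(\gamma,k_2),k_1)$, $\eta(\gamma,1_g)=\gamma$. The $\eta$-twisted category $\mathbb{E}\rtimes_\eta\mathbb{G}$ has objects $E_0\times G_0$, morphisms $E_1\times G_1$, componentwise source and target, and composition $(\gamma_2,k_2)\circ_\eta(\gamma_1,k_1)=(\gamma_2\circ\eta(\gamma_1,k_2),k_2\circ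 k_1)$. An $\eta$-twisted action of $\mathbb{G}$ on $\mathbb{E}$ is a smooth functor $\rho:\mathbb{E}\rtimes_\eta\mathbb{G}\to\mathbb{E}$ that is a (right) Lie group action on objects and on morphisms. An $\eta$-twisted principal $\mathbb{G}$-bundle over $\mathbb{X}=[X_1\rightrightarrows X_0]$ is a morphism of Lie groupoids $\pi:\mathbb{E}\to\mathbb{X}$ with an $\eta$-twisted action of $\mathbb{G}$ on $\mathbb{E}$ such that $\pi_i:E_i\to X_i$ is a principal $G_i$-bundle, $i=0,1$. For $\mathbb{G}=[G\rightrightarrows e]$ this forces $\pi_0$ to be a diffeomorphism, by which $E_0$ is identified with $X_0$. *)

theory Defs
  imports "HOL-Analysis.Analysis" "HOL-Algebra.Group"
begin

section \<open>Smooth manifolds\<close>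

text \<open>
  Manifolds are modelled on a linear subspace \<open>V\<close> of a Euclidean space rather than on the whole
  type: every Euclidean type has positive dimension, while the point and discrete Lie groups are
  manifolds modelled on \<open>{0}\<close>. Below, \<open>S\<close> is always a relatively open subset of \<open>V\<close>, so the values
  of \<open>f' x\<close> on \<open>V\<close> are determined by \<open>f\<close>; only these are used.
\<close>

primrec Ck_on :: "nat \<Rightarrow> 'a::euclidean_space set \<Rightarrow> 'a set \<Rightarrow> ('a \<Rightarrow> 'b::euclidean_space) \<Rightarrow> bool" where
  "Ck_on 0 V S f \<longleftrightarrow> continuous_on S f"
| "Ck_on (Suc k) V S f \<longleftrightarrow>
     (\<exists>f'. (\<forall>x\<in>S. (f has_derivative f' x) (at x within S)) \<and> (\<forall>v\<in>V. Ck_on k V S (\<lambda>x. f' x v)))"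

definition Cinf_on :: "'a::euclidean_space set \<Rightarrow> 'a set \<Rightarrow> ('a \<Rightarrow> 'b::euclidean_space) \<Rightarrow> bool" where
  "Cinf_on V S f \<longleftrightarrow> (\<forall>k. Ck_on k V S f)"

text \<open>A chart is a pair of its domain and a map whose values off the domain are irrelevant.\<close>

record ('a, 'e) mfd =
  mtop :: "'a topology"
  model :: "'e set"
  charts :: "('a set \<times> ('a \<Rightarrow> 'e)) set"

abbreviation pts :: "('a, 'e) mfd \<Rightarrow> 'a set" where
  "pts M \<equiv> topspace (mtop M)"

definition second_countable_top :: "'a topology \<Rightarrow> bool" where
  "second_countable_top X \<longleftrightarrow>
     (\<exists>\<B>. countable \<B> \<and> (\<forall>B\<in>\<B>. openin X B) \<and> (\<forall>U. openin X U \<longrightarrow> (\<exists>\<U>\<subseteq>\<B>. U = \<Union>\<U>)))"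

definition is_chart :: "('a, 'e::euclidean_space) mfd \<Rightarrow> 'a set \<Rightarrow> ('a \<Rightarrow> 'e) \<Rightarrow> bool" where
  "is_chart M U \<phi> \<longleftrightarrow>
     openin (mtop M) U \<and> openin (top_of_set (model M)) (\<phi> ` U) \<and>
     homeomorphic_map (subtopology (mtop M) U) (top_of_set (\<phi> ` U)) \<phi>"

definition smooth_manifold :: "('a, 'e::euclidean_space) mfd \<Rightarrow> bool" where
  "smooth_manifold M \<longleftrightarrow>
     Hausdorff_space (mtop M) \<and> second_countable_top (mtop M) \<and> subspace (model M) \<and>
     (\<forall>(U, \<phi>)\<in>charts M. is_chart M U \<phi>) \<and>
     (\<Union>(U, \<phi>)\<in>charts M. U) = pts M \<and>
     (\<forall>(U, \<phi>)\<in>charts M. \<forall>(V, \<psi>)\<in>charts M.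
        Cinf_on (model M) (\<phi> ` (U \<inter> V)) (\<psi> \<circ> inv_into U \<phi>))"

definition smooth_map ::
  "('a, 'e::euclidean_space) mfd \<Rightarrow> ('b, 'f::euclidean_space) mfd \<Rightarrow> ('a \<Rightarrow> 'b) \<Rightarrow> bool" where
  "smooth_map M N f \<longleftrightarrow>
     continuous_map (mtop M) (mtop N) f \<and>
     (\<forall>(U, \<phi>)\<in>charts M. \<forall>(V, \<psi>)\<in>charts N.
        Cinf_on (model M) (\<phi> ` (U \<inter> f -` V)) (\<psi> \<circ> f \<circ> inv_into U \<phi>))"

definition diffeomorphism ::
  "('a, 'e::euclidean_space) mfd \<Rightarrow> ('b, 'f::euclidean_space) mfd \<Rightarrow> ('a \<Rightarrow> 'b) \<Rightarrow> bool" where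
  "diffeomorphism M N f \<longleftrightarrow>
     smooth_map M N f \<and>
     (\<exists>g. smooth_map N M g \<and> (\<forall>x\<in>pts M. g (f x) = x) \<and> (\<forall>y\<in>pts N. f (g y) = y))"

text \<open>\<open>D\<close> is the differential of \<open>f\<close> at \<open>p\<close> read in the charts \<open>(U, \<phi>)\<close> and \<open>(V, \<psi>)\<close>. It is
  unique only as a map on \<open>model M\<close>.\<close>

definition chart_differential ::
  "('a \<Rightarrow> 'b) \<Rightarrow> 'a \<Rightarrow> 'a set \<Rightarrow> ('a \<Rightarrow> 'e::euclidean_space) \<Rightarrow> 'b set \<Rightarrow> ('b \<Rightarrow> 'f::euclidean_space)
     \<Rightarrow> ('e \<Rightarrow> 'f) \<Rightarrow> bool" where
  "chart_differential f p U \<phi> V \<psi> D \<longleftrightarrow>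
     ((\<psi> \<circ> f \<circ> inv_into U \<phi>) has_derivative D) (at (\<phi> p) within \<phi> ` (U \<inter> f -` V))"

definition submersion ::
  "('a, 'e::euclidean_space) mfd \<Rightarrow> ('b, 'f::euclidean_space) mfd \<Rightarrow> ('a \<Rightarrow> 'b) \<Rightarrow> bool" where
  "submersion M N f \<longleftrightarrow>
     smooth_map M N f \<and>
     (\<forall>(U, \<phi>)\<in>charts M. \<forall>(V, \<psi>)\<in>charts N. \<forall>p\<in>U. f p \<in> V \<longrightarrow>
        (\<exists>D. chart_differential f p U \<phi> V \<psi> D \<and> D ` model M = model N))"

definition immersion ::
  "('a, 'e::euclidean_space) mfd \<Rightarrow> ('b, 'f::euclidean_space) mfd \<Rightarrow> ('a \<Rightarrow> 'b) \<Rightarrow> bool" where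
  "immersion M N f \<longleftrightarrow>
     smooth_map M N f \<and>
     (\<forall>(U, \<phi>)\<in>charts M. \<forall>(V, \<psi>)\<in>charts N. \<forall>p\<in>U. f p \<in> V \<longrightarrow>
        (\<exists>D. chart_differential f p U \<phi> V \<psi> D \<and> inj_on D (model M)))"

definition smooth_embedding ::
  "('a, 'e::euclidean_space) mfd \<Rightarrow> ('b, 'f::euclidean_space) mfd \<Rightarrow> ('a \<Rightarrow> 'b) \<Rightarrow> bool" where
  "smooth_embedding M N f \<longleftrightarrow> immersion M N f \<and> embedding_map (mtop M) (mtop N) f"

definition prod_mfd ::
  "('a, 'e) mfd \<Rightarrow> ('b, 'f) mfd \<Rightarrow> ('a \<times> 'b, 'e \<times> 'f) mfd" where
  "prod_mfd M N =
     \<lparr>mtop = prod_topology (mtop M) (mtop N),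
      model = model M \<times> model N,
      charts = {(U \<times> V, map_prod \<phi> \<psi>) |U \<phi> V \<psi>. (U, \<phi>) \<in> charts M \<and> (V, \<psi>) \<in> charts N}\<rparr>"

definition open_submfd :: "('a, 'e) mfd \<Rightarrow> 'a set \<Rightarrow> ('a, 'e) mfd" where
  "open_submfd M W =
     \<lparr>mtop = subtopology (mtop M) W,
      model = model M,
      charts = {(U \<inter> W, \<phi>) |U \<phi>. (U, \<phi>) \<in> charts M}\<rparr>"

definition point_mfd :: "(unit, real) mfd" where
  "point_mfd = \<lparr>mtop = discrete_topology UNIV, model = {0}, charts = {(UNIV, \<lambda>_. 0)}\<rparr>"

text \<open>Smoothness of a map defined on a subset \<open>A\<close> of a manifold: it extends smoothly to a
  neighbourhood of each point of \<open>A\<close>. On an embedded submanifold, such as the fibre product of two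
  submersions, this is smoothness for the submanifold structure.\<close>

definition smooth_on_subset ::
  "('a, 'e::euclidean_space) mfd \<Rightarrow> 'a set \<Rightarrow> ('b, 'f::euclidean_space) mfd \<Rightarrow> ('a \<Rightarrow> 'b) \<Rightarrow> bool" where
  "smooth_on_subset M A N f \<longleftrightarrow>
     f \<in> A \<rightarrow> pts N \<and>
     (\<forall>p\<in>A. \<exists>W F. openin (mtop M) W \<and> p \<in> W \<and> smooth_map (open_submfd M W) N F \<and>
        (\<forall>q\<in>A \<inter> W. F q = f q))"

section \<open>Lie groups and principal bundles\<close>

definition lie_group :: "('g, 'z) monoid_scheme \<Rightarrow> ('g, 'e::euclidean_space) mfd \<Rightarrow> bool" where
  "lie_group G MG \<longleftrightarrow>
     group G \<and> smooth_manifold MG \<and> pts MG = carrier G \<and>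
     smooth_map (prod_mfd MG MG) MG (\<lambda>(g, h). g \<otimes>\<^bsub>G\<^esub> h) \<and>
     smooth_map MG MG (\<lambda>g. inv\<^bsub>G\<^esub> g)"

definition right_lie_action ::
  "('g, 'z) monoid_scheme \<Rightarrow> ('g, 'eg::euclidean_space) mfd \<Rightarrow> ('p, 'ep::euclidean_space) mfd
     \<Rightarrow> ('p \<Rightarrow> 'g \<Rightarrow> 'p) \<Rightarrow> bool" where
  "right_lie_action G MG P \<rho> \<longleftrightarrow>
     lie_group G MG \<and> smooth_map (prod_mfd P MG) P (\<lambda>(p, g). \<rho> p g) \<and>
     (\<forall>p\<in>pts P. \<rho> p \<one>\<^bsub>G\<^esub> = p) \<and>
     (\<forall>p\<in>pts P. \<forall>g\<in>carrier G. \<forall>h\<in>carrier G. \<rho> (\<rho> p g) h = \<rho> p (g \<otimes>\<^bsub>G\<^esub> h))"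

definition principal_bundle ::
  "('g, 'z) monoid_scheme \<Rightarrow> ('g, 'eg::euclidean_space) mfd \<Rightarrow> ('p, 'ep::euclidean_space) mfd
     \<Rightarrow> ('b, 'eb::euclidean_space) mfd \<Rightarrow> ('p \<Rightarrow> 'b) \<Rightarrow> ('p \<Rightarrow> 'g \<Rightarrow> 'p) \<Rightarrow> bool" where
  "principal_bundle G MG P B \<pi> \<rho> \<longleftrightarrow>
     smooth_manifold P \<and> smooth_manifold B \<and> smooth_map P B \<pi> \<and> right_lie_action G MG P \<rho> \<and>
     (\<forall>b\<in>pts B. \<exists>U \<Phi>. openin (mtop B) U \<and> b \<in> U \<and>
        diffeomorphism (prod_mfd (open_submfd B U) MG)
          (open_submfd P {p \<in> pts P. \<pi> p \<in> U}) \<Phi> \<and>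
        (\<forall>u\<in>U. \<forall>g\<in>carrier G. \<pi> (\<Phi> (u, g)) = u) \<and>
        (\<forall>u\<in>U. \<forall>g\<in>carrier G. \<forall>h\<in>carrier G. \<Phi> (u, g \<otimes>\<^bsub>G\<^esub> h) = \<rho> (\<Phi> (u, g)) h))"

section \<open>Lie groupoids\<close>

text \<open>\<open>cmp C \<gamma>2 \<gamma>1\<close> is \<open>\<gamma>2 \<circ> \<gamma>1\<close>, meaningful when \<open>src C \<gamma>2 = tgt C \<gamma>1\<close>.\<close>

record ('m, 'em, 'o, 'eo) smcat =
  Mor :: "('m, 'em) mfd"
  Obj :: "('o, 'eo) mfd"
  src :: "'m \<Rightarrow> 'o"
  tgt :: "'m \<Rightarrow> 'o"
  cmp :: "'m \<Rightarrow> 'm \<Rightarrow> 'm"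
  idm :: "'o \<Rightarrow> 'm"

definition composable :: "('m, 'em, 'o, 'eo, 'z) smcat_scheme \<Rightarrow> ('m \<times> 'm) set" where
  "composable C = {(\<gamma>2, \<gamma>1). \<gamma>2 \<in> pts (Mor C) \<and> \<gamma>1 \<in> pts (Mor C) \<and> src C \<gamma>2 = tgt C \<gamma>1}"

definition is_category :: "('m, 'em, 'o, 'eo, 'z) smcat_scheme \<Rightarrow> bool" where
  "is_category C \<longleftrightarrow>
     src C \<in> pts (Mor C) \<rightarrow> pts (Obj C) \<and> tgt C \<in> pts (Mor C) \<rightarrow> pts (Obj C) \<and>
     idm C \<in> pts (Obj C) \<rightarrow> pts (Mor C) \<and>
     (\<forall>x\<in>pts (Obj C). src C (idm C x) = x \<and> tgt C (idm C x) = x) \<and>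
     (\<forall>(\<gamma>2, \<gamma>1)\<in>composable C. cmp C \<gamma>2 \<gamma>1 \<in> pts (Mor C) \<and>
        src C (cmp C \<gamma>2 \<gamma>1) = src C \<gamma>1 \<and> tgt C (cmp C \<gamma>2 \<gamma>1) = tgt C \<gamma>2) \<and>
     (\<forall>\<gamma>\<in>pts (Mor C). cmp C \<gamma> (idm C (src C \<gamma>)) = \<gamma> \<and> cmp C (idm C (tgt C \<gamma>)) \<gamma> = \<gamma>) \<and>
     (\<forall>\<gamma>3 \<gamma>2 \<gamma>1. (\<gamma>3, \<gamma>2) \<in> composable C \<longrightarrow> (\<gamma>2, \<gamma>1) \<in> composable C \<longrightarrow>
        cmp C (cmp C \<gamma>3 \<gamma>2) \<gamma>1 = cmp C \<gamma>3 (cmp C \<gamma>2 \<gamma>1))"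

definition is_inverse :: "('m, 'em, 'o, 'eo, 'z) smcat_scheme \<Rightarrow> 'm \<Rightarrow> 'm \<Rightarrow> bool" where
  "is_inverse C \<gamma> \<delta> \<longleftrightarrow>
     \<delta> \<in> pts (Mor C) \<and> src C \<delta> = tgt C \<gamma> \<and> tgt C \<delta> = src C \<gamma> \<and>
     cmp C \<delta> \<gamma> = idm C (src C \<gamma>) \<and> cmp C \<gamma> \<delta> = idm C (tgt C \<gamma>)"

definition lie_groupoid ::
  "('m, 'em::euclidean_space, 'o, 'eo::euclidean_space, 'z) smcat_scheme \<Rightarrow> bool" where
  "lie_groupoid C \<longleftrightarrow>
     is_category C \<and> (\<forall>\<gamma>\<in>pts (Mor C). \<exists>\<delta>. is_inverse C \<gamma> \<delta>) \<and>
     smooth_manifold (Mor C) \<and> smooth_manifold (Obj C) \<and>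
     submersion (Mor C) (Obj C) (src C) \<and> submersion (Mor C) (Obj C) (tgt C) \<and>
     smooth_map (Obj C) (Mor C) (idm C) \<and>
     smooth_map (Mor C) (Mor C) (\<lambda>\<gamma>. THE \<delta>. is_inverse C \<gamma> \<delta>) \<and>
     smooth_on_subset (prod_mfd (Mor C) (Mor C)) (composable C) (Mor C) (\<lambda>(\<gamma>2, \<gamma>1). cmp C \<gamma>2 \<gamma>1)"

definition smooth_functor ::
  "('m, 'em::euclidean_space, 'o, 'eo::euclidean_space, 'z) smcat_scheme
     \<Rightarrow> ('n, 'en::euclidean_space, 'p, 'ep::euclidean_space, 'y) smcat_scheme
     \<Rightarrow> ('m \<Rightarrow> 'n) \<Rightarrow> ('o \<Rightarrow> 'p) \<Rightarrow> bool" where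
  "smooth_functor C D F1 F0 \<longleftrightarrow>
     smooth_map (Mor C) (Mor D) F1 \<and> smooth_map (Obj C) (Obj D) F0 \<and>
     (\<forall>\<gamma>\<in>pts (Mor C). src D (F1 \<gamma>) = F0 (src C \<gamma>) \<and> tgt D (F1 \<gamma>) = F0 (tgt C \<gamma>)) \<and>
     (\<forall>x\<in>pts (Obj C). F1 (idm C x) = idm D (F0 x)) \<and>
     (\<forall>(\<gamma>2, \<gamma>1)\<in>composable C. F1 (cmp C \<gamma>2 \<gamma>1) = cmp D (F1 \<gamma>2) (F1 \<gamma>1))"

section \<open>Lie groupoid extensions\<close>

definition group_bundle ::
  "('x, 'ex) mfd \<Rightarrow> ('g, 'z) monoid_scheme \<Rightarrow> ('g, 'eg) mfd
     \<Rightarrow> ('x \<times> 'g, 'ex \<times> 'eg, 'x, 'ex) smcat" where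
  "group_bundle M G MG =
     \<lparr>Mor = prod_mfd M MG, Obj = M, src = fst, tgt = fst,
      cmp = (\<lambda>(x, g) (x', g'). (x, g \<otimes>\<^bsub>G\<^esub> g')), idm = (\<lambda>x. (x, \<one>\<^bsub>G\<^esub>))\<rparr>"

text \<open>The conditions after surjectivity of \<open>\<phi>\<close> express exactness at the first and the middle
  term; the kernel of \<open>\<phi>\<close> consists of the morphisms sent to unit morphisms.\<close>

definition lie_groupoid_extension ::
  "('g, 'z) monoid_scheme \<Rightarrow> ('g, 'eg::euclidean_space) mfd \<Rightarrow> ('x, 'ex::euclidean_space) mfd
     \<Rightarrow> ('m2, 'e2::euclidean_space, 'x, 'ex) smcat \<Rightarrow> ('m1, 'e1::euclidean_space, 'x, 'ex) smcat
     \<Rightarrow> ('x \<times> 'g \<Rightarrow> 'm2) \<Rightarrow> ('m2 \<Rightarrow> 'm1) \<Rightarrow> bool" where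
  "lie_groupoid_extension G MG M \<Gamma>2 \<Gamma>1 i \<phi> \<longleftrightarrow>
     lie_group G MG \<and> Obj \<Gamma>2 = M \<and> Obj \<Gamma>1 = M \<and>
     lie_groupoid (group_bundle M G MG) \<and> lie_groupoid \<Gamma>2 \<and> lie_groupoid \<Gamma>1 \<and>
     smooth_functor (group_bundle M G MG) \<Gamma>2 i (\<lambda>x. x) \<and>
     smooth_functor \<Gamma>2 \<Gamma>1 \<phi> (\<lambda>x. x) \<and>
     smooth_embedding (prod_mfd M MG) (Mor \<Gamma>2) i \<and>
     submersion (Mor \<Gamma>2) (Mor \<Gamma>1) \<phi> \<and> \<phi> ` pts (Mor \<Gamma>2) = pts (Mor \<Gamma>1) \<and>
     inj_on i (pts M \<times> carrier G) \<and>
     i ` (pts M \<times> carrier G) = {\<gamma> \<in> pts (Mor \<Gamma>2). \<exists>x\<in>pts M. \<phi> \<gamma> = idm \<Gamma>1 x}"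

section \<open>Lie 2-groups and twisted principal bundles\<close>

record ('m, 'em, 'o, 'eo) two_group = "('m, 'em, 'o, 'eo) smcat" +
  gmor :: "'m monoid"
  gobj :: "'o monoid"

text \<open>A group object in Lie groupoids: multiplication is a smooth functor.\<close>

definition lie_2_group ::
  "('m, 'em::euclidean_space, 'o, 'eo::euclidean_space) two_group \<Rightarrow> bool" where
  "lie_2_group \<G> \<longleftrightarrow>
     lie_groupoid \<G> \<and> lie_group (gmor \<G>) (Mor \<G>) \<and> lie_group (gobj \<G>) (Obj \<G>) \<and>
     (\<forall>k\<in>pts (Mor \<G>). \<forall>h\<in>pts (Mor \<G>).
        src \<G> (k \<otimes>\<^bsub>gmor \<G>\<^esub> h) = src \<G> k \<otimes>\<^bsub>gobj \<G>\<^esub> src \<G> h \<and>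
        tgt \<G> (k \<otimes>\<^bsub>gmor \<G>\<^esub> h) = tgt \<G> k \<otimes>\<^bsub>gobj \<G>\<^esub> tgt \<G> h) \<and>
     (\<forall>a\<in>pts (Obj \<G>). \<forall>b\<in>pts (Obj \<G>).
        idm \<G> (a \<otimes>\<^bsub>gobj \<G>\<^esub> b) = idm \<G> a \<otimes>\<^bsub>gmor \<G>\<^esub> idm \<G> b) \<and>
     (\<forall>(k2, k1)\<in>composable \<G>. \<forall>(h2, h1)\<in>composable \<G>.
        cmp \<G> (k2 \<otimes>\<^bsub>gmor \<G>\<^esub> h2) (k1 \<otimes>\<^bsub>gmor \<G>\<^esub> h1) = cmp \<G> k2 k1 \<otimes>\<^bsub>gmor \<G>\<^esub> cmp \<G> h2 h1)"

text \<open>The 2-group \<open>[G \<rightrightarrows> e]\<close>.\<close>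

definition one_object_2_group ::
  "'g monoid \<Rightarrow> ('g, 'eg) mfd \<Rightarrow> ('g, 'eg, unit, real) two_group" where
  "one_object_2_group G MG =
     \<lparr>Mor = MG, Obj = point_mfd, src = (\<lambda>_. ()), tgt = (\<lambda>_. ()),
      cmp = (\<lambda>k2 k1. k2 \<otimes>\<^bsub>G\<^esub> k1), idm = (\<lambda>_. \<one>\<^bsub>G\<^esub>),
      gmor = G,
      gobj = \<lparr>carrier = UNIV, monoid.mult = (\<lambda>_ _. ()), one = ()\<rparr>\<rparr>"

definition admissible ::
  "('m, 'em::euclidean_space, 'o, 'eo::euclidean_space) smcat
     \<Rightarrow> ('k, 'ek::euclidean_space, 'a, 'ea::euclidean_space) two_group
     \<Rightarrow> ('m \<Rightarrow> 'k \<Rightarrow> 'm) \<Rightarrow> bool" where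
  "admissible E \<G> \<eta> \<longleftrightarrow>
     smooth_map (prod_mfd (Mor E) (Mor \<G>)) (Mor E) (\<lambda>(\<gamma>, k). \<eta> \<gamma> k) \<and>
     (\<forall>\<gamma>\<in>pts (Mor E). \<forall>k\<in>pts (Mor \<G>).
        src E (\<eta> \<gamma> k) = src E \<gamma> \<and> tgt E (\<eta> \<gamma> k) = tgt E \<gamma>) \<and>
     (\<forall>(\<gamma>2, \<gamma>1)\<in>composable E. \<forall>k\<in>pts (Mor \<G>).
        \<eta> (cmp E \<gamma>2 \<gamma>1) k = cmp E (\<eta> \<gamma>2 k) (\<eta> \<gamma>1 k)) \<and>
     (\<forall>x\<in>pts (Obj E). \<forall>k\<in>pts (Mor \<G>). \<eta> (idm E x) k = idm E x) \<and>
     (\<forall>\<gamma>\<in>pts (Mor E). \<forall>(k2, k1)\<in>composable \<G>. \<eta> \<gamma> (cmp \<G> k2 k1) = \<eta> (\<eta> \<gamma> k2) k1) \<and>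
     (\<forall>\<gamma>\<in>pts (Mor E). \<forall>a\<in>pts (Obj \<G>). \<eta> \<gamma> (idm \<G> a) = \<gamma>)"

definition twisted_category ::
  "('m, 'em, 'o, 'eo) smcat \<Rightarrow> ('k, 'ek, 'a, 'ea) two_group \<Rightarrow> ('m \<Rightarrow> 'k \<Rightarrow> 'm)
     \<Rightarrow> ('m \<times> 'k, 'em \<times> 'ek, 'o \<times> 'a, 'eo \<times> 'ea) smcat" where
  "twisted_category E \<G> \<eta> =
     \<lparr>Mor = prod_mfd (Mor E) (Mor \<G>), Obj = prod_mfd (Obj E) (Obj \<G>),
      src = map_prod (src E) (src \<G>), tgt = map_prod (tgt E) (tgt \<G>),
      cmp = (\<lambda>(\<gamma>2, k2) (\<gamma>1, k1). (cmp E \<gamma>2 (\<eta> \<gamma>1 k2), cmp \<G> k2 k1)),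
      idm = map_prod (idm E) (idm \<G>)\<rparr>"

definition twisted_action ::
  "('k, 'ek::euclidean_space, 'a, 'ea::euclidean_space) two_group
     \<Rightarrow> ('m, 'em::euclidean_space, 'o, 'eo::euclidean_space) smcat
     \<Rightarrow> ('m \<Rightarrow> 'k \<Rightarrow> 'm) \<Rightarrow> ('m \<Rightarrow> 'k \<Rightarrow> 'm) \<Rightarrow> ('o \<Rightarrow> 'a \<Rightarrow> 'o) \<Rightarrow> bool" where
  "twisted_action \<G> E \<eta> \<rho>1 \<rho>0 \<longleftrightarrow>
     admissible E \<G> \<eta> \<and>
     smooth_functor (twisted_category E \<G> \<eta>) E (\<lambda>(\<gamma>, k). \<rho>1 \<gamma> k) (\<lambda>(x, a). \<rho>0 x a) \<and>
     right_lie_action (gmor \<G>) (Mor \<G>) (Mor E) \<rho>1 \<and>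
     right_lie_action (gobj \<G>) (Obj \<G>) (Obj E) \<rho>0"

definition twisted_principal_bundle ::
  "('k, 'ek::euclidean_space, 'a, 'ea::euclidean_space) two_group
     \<Rightarrow> ('n, 'en::euclidean_space, 'p, 'ep::euclidean_space) smcat
     \<Rightarrow> ('m, 'em::euclidean_space, 'o, 'eo::euclidean_space) smcat
     \<Rightarrow> ('m \<Rightarrow> 'n) \<Rightarrow> ('o \<Rightarrow> 'p)
     \<Rightarrow> ('m \<Rightarrow> 'k \<Rightarrow> 'm) \<Rightarrow> ('m \<Rightarrow> 'k \<Rightarrow> 'm) \<Rightarrow> ('o \<Rightarrow> 'a \<Rightarrow> 'o) \<Rightarrow> bool" where
  "twisted_principal_bundle \<G> X E \<pi>1 \<pi>0 \<eta> \<rho>1 \<rho>0 \<longleftrightarrow>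
     lie_2_group \<G> \<and> lie_groupoid X \<and> lie_groupoid E \<and>
     smooth_functor E X \<pi>1 \<pi>0 \<and> twisted_action \<G> E \<eta> \<rho>1 \<rho>0 \<and>
     principal_bundle (gmor \<G>) (Mor \<G>) (Mor E) (Mor X) \<pi>1 \<rho>1 \<and>
     principal_bundle (gobj \<G>) (Obj \<G>) (Obj E) (Obj X) \<pi>0 \<rho>0"

text \<open>The groupoid \<open>[E\<^sub>1 \<rightrightarrows> B]\<close> obtained from \<open>[E\<^sub>1 \<rightrightarrows> E\<^sub>0]\<close> by identifying \<open>E\<^sub>0\<close> with \<open>B\<close> along a
  diffeomorphism \<open>f\<close>. For \<open>E\<^sub>0 = B\<close> and \<open>f\<close> the identity nothing changes.\<close>

definition identify_objects ::
  "('o \<Rightarrow> 'b) \<Rightarrow> ('b, 'eb) mfd \<Rightarrow> ('m, 'em, 'o, 'eo) smcat \<Rightarrow> ('m, 'em, 'b, 'eb) smcat" where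
  "identify_objects f B E =
     \<lparr>Mor = Mor E, Obj = B, src = f \<circ> src E, tgt = f \<circ> tgt E, cmp = cmp E,
      idm = idm E \<circ> inv_into (pts (Obj E)) f\<rparr>"

end

theory Submission
  imports Defs
begin

text \<open>
  From a twisted principal bundle to an extension. The map \<open>\<pi>0\<close> is a principal bundle for the
  trivial group, hence a bijective submersion and a diffeomorphism. Functoriality of the action on
  units makes \<open>i (x, g) = 1\<^sub>x g\<close> a functor, since \<open>\<eta>\<close> fixes units; its image is the kernel of \<open>\<pi>1\<close>,
  since \<open>G\<close> acts transitively on the fibre over \<open>1\<^sub>x\<close>. A local trivialization of \<open>\<pi>1\<close> provides smooth
  sections through every point, so \<open>\<pi>1\<close> is a submersion. Its group coordinate \<open>\<kappa>\<close> provides the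
  smooth left inverse \<open>\<gamma> \<mapsto> (s \<gamma>, \<kappa> (1\<^bsub>s \<gamma>\<^esub>)\<^sup>-\<^sup>1 \<kappa> \<gamma>)\<close> of \<open>i\<close> near each value of \<open>i\<close>, so \<open>i\<close> is an
  embedding (theorem \<open>twisted_principal_bundle_extension\<close>).

  From an extension to a twisted principal bundle. The algebraic laws follow from \<open>i\<close> being a
  homomorphism into each isotropy group and from commutativity of \<open>G\<close>. For local triviality, let \<open>\<sigma>\<close>
  be a local section of the submersion \<open>\<phi>\<close>. Then \<open>(u, g) \<mapsto> \<sigma> u \<circ> i (s (\<sigma> u), g)\<close> is a trivialization:
  for \<open>\<phi> e = u\<close> the arrow \<open>(\<sigma> u)\<^sup>-\<^sup>1 \<circ> e\<close> lies in the kernel, which is the image of \<open>i\<close>, and the group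
  element is recovered by inverting \<open>i\<close>. The inverse is smooth because \<open>i\<close> is an embedding (theorem
  \<open>lie_groupoid_extension_twisted_principal_bundle\<close>).

  The analytic content is thus that submersions have smooth local sections and that embeddings have
  smooth local retractions (\<open>submersion_local_section\<close>, \<open>smooth_embedding_inverse\<close>), together with the
  converses \<open>submersionI_local_sections\<close> and \<open>smooth_embeddingI_local_retractions\<close>. The first two
  rest on the inverse function theorem for \<open>C\<^sup>\<infinity>\<close> maps between relatively open subsets of linear
  subspaces, \<open>Cinf_on_inverse_function\<close>; the converses are the chain rule. After these four facts
  differentials no longer occur.
\<close>

section \<open>Differential calculus relative to a subspace\<close>

lemma Ck_on_SucE:
  assumes "Ck_on (Suc k) V S f"
  obtains f' where "\<And>x. x \<in> S \<Longrightarrow> (f has_derivative f' x) (at x within S)"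
    "\<And>v. v \<in> V \<Longrightarrow> Ck_on k V S (\<lambda>x. f' x v)"
  using assms unfolding Ck_on.simps by blast

text \<open>
  Unfolding the successor case exposes an existential quantifier over derivatives, for which
  automation has no witness to offer; an elimination and an introduction rule replace it.
\<close>

declare Ck_on.simps(2) [simp del]

lemma Ck_on_SucI:
  assumes "\<And>x. x \<in> S \<Longrightarrow> (f has_derivative f' x) (at x within S)"
    "\<And>v. v \<in> V \<Longrightarrow> Ck_on k V S (\<lambda>x. f' x v)"
  shows "Ck_on (Suc k) V S f"
  using assms unfolding Ck_on.simps by blast

lemma Ck_on_subset:
  assumes "V' \<subseteq> V" "S' \<subseteq> S"
  shows "Ck_on k V S f \<Longrightarrow> Ck_on k V' S' f"
proof (induction k arbitrary: f)
  case 0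
  then show ?case using assms by (auto intro: continuous_on_subset)
next
  case (Suc k)
  obtain f' where f': "\<And>x. x \<in> S \<Longrightarrow> (f has_derivative f' x) (at x within S)"
    "\<And>v. v \<in> V \<Longrightarrow> Ck_on k V S (\<lambda>x. f' x v)" by (rule Ck_on_SucE[OF Suc.prems(1)]) blast
  show ?case
  proof (rule Ck_on_SucI)
    show "(f has_derivative f' x) (at x within S')" if "x \<in> S'" for x
      using f'(1) assms(2) that has_derivative_subset by blast
    show "Ck_on k V' S' (\<lambda>x. f' x v)" if "v \<in> V'" for v
      using f'(2) assms(1) that Suc.IH by blast
  qed
qed

lemma Ck_on_cong:
  assumes "\<And>x. x \<in> S \<Longrightarrow> f x = g x" "Ck_on k V S f"
  shows "Ck_on k V S g"
proof (cases k)
  case 0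
  then show ?thesis using assms by (auto cong: continuous_on_cong)
next
  case (Suc k)
  obtain f' where f': "\<And>x. x \<in> S \<Longrightarrow> (f has_derivative f' x) (at x within S)"
    "\<And>v. v \<in> V \<Longrightarrow> Ck_on k V S (\<lambda>x. f' x v)"
    by (rule Ck_on_SucE[OF assms(2)[unfolded Suc]]) blast
  have "(g has_derivative f' x) (at x within S)" if "x \<in> S" for x
    using has_derivative_transform[OF that _ f'(1)[OF that], of g] assms(1) by simp
  then show ?thesis using f'(2) unfolding Suc by (rule Ck_on_SucI)
qed

lemma Ck_on_SucD: "Ck_on (Suc k) V S f \<Longrightarrow> Ck_on k V S f"
proof (induction k arbitrary: f)
  case 0
  then show ?case by (auto elim!: Ck_on_SucE intro: has_derivative_continuous_on)
next
  case (Suc k)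
  obtain f' where f': "\<And>x. x \<in> S \<Longrightarrow> (f has_derivative f' x) (at x within S)"
    "\<And>v. v \<in> V \<Longrightarrow> Ck_on (Suc k) V S (\<lambda>x. f' x v)" by (rule Ck_on_SucE[OF Suc.prems(1)]) blast
  show ?case using f'(1) Suc.IH[OF f'(2)] by (rule Ck_on_SucI)
qed

lemma Ck_on_const: "Ck_on k V S (\<lambda>x. c)"
  by (induction k arbitrary: c)
    (auto intro!: Ck_on_SucI[where f' = "\<lambda>_ _. 0"])

lemma Ck_on_linear: "linear f \<Longrightarrow> Ck_on k V S f"
  by (cases k) (auto intro!: Ck_on_SucI[where f' = "\<lambda>_. f"] Ck_on_const linear_continuous_on
      bounded_linear_imp_has_derivative simp: linear_conv_bounded_linear)

lemma Ck_on_add: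
  "Ck_on k V S f \<Longrightarrow> Ck_on k V S g \<Longrightarrow> Ck_on k V S (\<lambda>x. f x + g x)"
proof (induction k arbitrary: f g)
  case 0
  then show ?case by (auto intro: continuous_intros)
next
  case (Suc k)
  obtain f' where f': "\<And>x. x \<in> S \<Longrightarrow> (f has_derivative f' x) (at x within S)"
    "\<And>v. v \<in> V \<Longrightarrow> Ck_on k V S (\<lambda>x. f' x v)" by (rule Ck_on_SucE[OF Suc.prems(1)]) blast
  obtain g' where g': "\<And>x. x \<in> S \<Longrightarrow> (g has_derivative g' x) (at x within S)"
    "\<And>v. v \<in> V \<Longrightarrow> Ck_on k V S (\<lambda>x. g' x v)" by (rule Ck_on_SucE[OF Suc.prems(2)]) blast
  from f' g' Suc.IH show ?case
    by (intro Ck_on_SucI[where f' = "\<lambda>x v. f' x v + g' x v"] has_derivative_add) blast+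
qed

lemma Ck_on_sum:
  "(\<And>i. i \<in> I \<Longrightarrow> Ck_on k V S (f i)) \<Longrightarrow> Ck_on k V S (\<lambda>x. \<Sum>i\<in>I. f i x)"
  by (induction I rule: infinite_finite_induct) (auto intro: Ck_on_const Ck_on_add)

lemma Ck_on_bilinear:
  assumes "bounded_bilinear pr"
  shows "Ck_on k V S f \<Longrightarrow> Ck_on k V S g \<Longrightarrow> Ck_on k V S (\<lambda>x. pr (f x) (g x))"
proof (induction k arbitrary: f g)
  case 0
  then show ?case using assms by (auto intro: bounded_bilinear.continuous_on)
next
  case (Suc k)
  obtain f' where f': "\<And>x. x \<in> S \<Longrightarrow> (f has_derivative f' x) (at x within S)"
    "\<And>v. v \<in> V \<Longrightarrow> Ck_on k V S (\<lambda>x. f' x v)" by (rule Ck_on_SucE[OF Suc.prems(1)]) blast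
  obtain g' where g': "\<And>x. x \<in> S \<Longrightarrow> (g has_derivative g' x) (at x within S)"
    "\<And>v. v \<in> V \<Longrightarrow> Ck_on k V S (\<lambda>x. g' x v)" by (rule Ck_on_SucE[OF Suc.prems(2)]) blast
  from f' g' Suc.IH Suc.prems[THEN Ck_on_SucD] show ?case
    by (intro Ck_on_SucI[where f' = "\<lambda>x v. pr (f x) (g' x v) + pr (f' x v) (g x)"]
        bounded_bilinear.FDERIV[OF assms] Ck_on_add) blast+
qed

lemma Ck_on_linear_comp:
  assumes "linear L"
  shows "Ck_on k V S f \<Longrightarrow> Ck_on k V S (\<lambda>x. L (f x))"
proof (induction k arbitrary: f)
  case 0
  then show ?case using assms
    by (auto intro: linear_continuous_on_compose)
next
  case (Suc k)
  obtain f' where "\<And>x. x \<in> S \<Longrightarrow> (f has_derivative f' x) (at x within S)"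
    "\<And>v. v \<in> V \<Longrightarrow> Ck_on k V S (\<lambda>x. f' x v)" by (rule Ck_on_SucE[OF Suc.prems(1)]) blast
  with Suc.IH show ?case
    by (intro Ck_on_SucI[where f' = "\<lambda>x v. L (f' x v)"]
        bounded_linear.has_derivative[OF assms[unfolded linear_conv_bounded_linear]]) blast+
qed

lemma Ck_on_Pair:
  assumes "Ck_on k V S f" "Ck_on k V S g"
  shows "Ck_on k V S (\<lambda>x. (f x, g x))"
proof -
  have "Ck_on k V S (\<lambda>x. (f x, 0) + (0, g x))"
    by (intro Ck_on_add Ck_on_linear_comp[where L = "\<lambda>y. (y, 0)"]
        Ck_on_linear_comp[where L = "\<lambda>y. (0, y)"] assms linearI) auto
  then show ?thesis by simp
qed

text \<open>
  In the chain rule \<open>D (g \<circ> f) x v = D g (f x) (D f x v)\<close> the direction \<open>D f x v\<close> depends on \<open>x\<close>.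
  Expanding it in the standard basis leaves a sum of products of functions that are \<open>C\<^sup>k\<close> by
  induction. All directions have to be admitted for this, hence \<open>UNIV\<close>.
\<close>

lemma Ck_on_compose:
  assumes "f ` S \<subseteq> T"
  shows "Ck_on k UNIV S f \<Longrightarrow> Ck_on k UNIV T g \<Longrightarrow> Ck_on k UNIV S (\<lambda>x. g (f x))"
proof (induction k arbitrary: g)
  case 0
  then show ?case using assms continuous_on_compose2 by auto
next
  case (Suc k)
  obtain f' where f': "\<And>x. x \<in> S \<Longrightarrow> (f has_derivative f' x) (at x within S)"
    "\<And>v. Ck_on k UNIV S (\<lambda>x. f' x v)" by (rule Ck_on_SucE[OF Suc.prems(1)]) blast
  obtain g' where g': "\<And>x. x \<in> T \<Longrightarrow> (g has_derivative g' x) (at x within T)"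
    "\<And>v. Ck_on k UNIV T (\<lambda>x. g' x v)" by (rule Ck_on_SucE[OF Suc.prems(2)]) blast
  have "((\<lambda>x. g (f x)) has_derivative (\<lambda>v. g' (f x) (f' x v))) (at x within S)" if "x \<in> S" for x
    using has_derivative_in_compose2[OF g'(1) assms that f'(1)[OF that]] .
  moreover have "Ck_on k UNIV S (\<lambda>x. g' (f x) (f' x v))" for v
  proof (rule Ck_on_cong)
    show "Ck_on k UNIV S (\<lambda>x. \<Sum>b\<in>Basis. (f' x v \<bullet> b) *\<^sub>R g' (f x) b)"
      using f'(2) g'(2) Suc.IH Ck_on_SucD[OF Suc.prems(1)]
      by (intro Ck_on_sum Ck_on_bilinear[OF bounded_bilinear_scaleR]
          Ck_on_bilinear[OF bounded_bilinear_inner] Ck_on_const) auto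
    fix x assume "x \<in> S"
    then have "linear (g' (f x))" using g' assms has_derivative_linear by blast
    then have "g' (f x) (\<Sum>b\<in>Basis. (f' x v \<bullet> b) *\<^sub>R b) =
        (\<Sum>b\<in>Basis. (f' x v \<bullet> b) *\<^sub>R g' (f x) b)"
      by (simp add: linear_sum linear_scale)
    then show "(\<Sum>b\<in>Basis. (f' x v \<bullet> b) *\<^sub>R g' (f x) b) = g' (f x) (f' x v)"
      by (simp add: euclidean_representation)
  qed
  ultimately show ?case by (intro Ck_on_SucI)
qed

text \<open>
  On an open set there is only one derivative, so that the existential quantifier disappears and
  \<open>C\<^sup>k\<close> becomes a local condition.
\<close>

lemma Ck_on_Suc_open:
  assumes "open S"
  shows "Ck_on (Suc k) UNIV S f \<longleftrightarrow>
    (\<forall>x\<in>S. f differentiable at x) \<and> (\<forall>v. Ck_on k UNIV S (\<lambda>x. frechet_derivative f (at x) v))"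
proof
  assume "Ck_on (Suc k) UNIV S f"
  then obtain f' where f'_within: "\<And>x. x \<in> S \<Longrightarrow> (f has_derivative f' x) (at x within S)"
    and f'2: "\<And>v. Ck_on k UNIV S (\<lambda>x. f' x v)" by (rule Ck_on_SucE) blast
  have f': "\<And>x. x \<in> S \<Longrightarrow> (f has_derivative f' x) (at x)"
    using f'_within assms by (metis at_within_open)
  then have eq: "f' x = frechet_derivative f (at x)" if "x \<in> S" for x
    using frechet_derivative_at that by blast
  have "Ck_on k UNIV S (\<lambda>x. frechet_derivative f (at x) v)" for v
    by (rule Ck_on_cong[OF _ f'2[of v]]) (simp add: eq)
  with f' show "(\<forall>x\<in>S. f differentiable at x) \<and>
      (\<forall>v. Ck_on k UNIV S (\<lambda>x. frechet_derivative f (at x) v))"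
    unfolding differentiable_def by blast
next
  assume R: "(\<forall>x\<in>S. f differentiable at x) \<and>
      (\<forall>v. Ck_on k UNIV S (\<lambda>x. frechet_derivative f (at x) v))"
  then have "(f has_derivative frechet_derivative f (at x)) (at x within S)" if "x \<in> S" for x
    using that assms by (metis at_within_open frechet_derivative_works)
  then show "Ck_on (Suc k) UNIV S f"
    by (rule Ck_on_SucI) (use R in auto)
qed

lemma Ck_on_local:
  assumes "open S" "\<And>x. x \<in> S \<Longrightarrow> \<exists>T. open T \<and> x \<in> T \<and> Ck_on k UNIV (S \<inter> T) f"
  shows "Ck_on k UNIV S f"
  using assms(2)
proof (induction k arbitrary: f)
  case 0
  have "isCont f x" if x: "x \<in> S" for x
  proof -
    obtain T where "open T" "x \<in> T" "Ck_on 0 UNIV (S \<inter> T) f" using 0[OF x] by blast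
    then show ?thesis using assms(1) x by (auto simp: continuous_on_eq_continuous_at open_Int)
  qed
  then show ?case by (auto simp: continuous_at_imp_continuous_on)
next
  case (Suc k)
  have *: "\<exists>T. open T \<and> x \<in> T \<and> (\<forall>x\<in>S \<inter> T. f differentiable at x) \<and>
     (\<forall>v. Ck_on k UNIV (S \<inter> T) (\<lambda>x. frechet_derivative f (at x) v))" if "x \<in> S" for x
    using Suc.prems[OF that] assms(1) Ck_on_Suc_open[OF open_Int] by metis
  then have "\<forall>x\<in>S. f differentiable at x" by blast
  moreover have "Ck_on k UNIV S (\<lambda>x. frechet_derivative f (at x) v)" for v
    using * by (intro Suc.IH) blast
  ultimately show ?case using assms(1) Ck_on_Suc_open by blast
qed

text \<open>
  A relatively open subset of \<open>V\<close> becomes an open set by composing with a projection \<open>P\<close> onto \<open>V\<close>.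
  This reduces the chain rule, locality and uniqueness of derivatives for functions on \<open>V\<close> to the
  case of the whole space.
\<close>

lemma Ck_on_lift:
  assumes "linear P" "range P \<subseteq> V"
  shows "Ck_on k V S f \<Longrightarrow> Ck_on k UNIV (P -` S) (\<lambda>x. f (P x))"
proof (induction k arbitrary: f)
  case 0
  then show ?case
    using continuous_on_compose2[of S f "P -` S" P] linear_continuous_on assms(1)
    by (auto simp: linear_conv_bounded_linear)
next
  case (Suc k)
  obtain f' where f': "\<And>x. x \<in> S \<Longrightarrow> (f has_derivative f' x) (at x within S)"
    "\<And>v. v \<in> V \<Longrightarrow> Ck_on k V S (\<lambda>x. f' x v)" by (rule Ck_on_SucE[OF Suc.prems(1)]) blast
  have "((\<lambda>x. f (P x)) has_derivative (\<lambda>v. f' (P x) (P v))) (at x within P -` S)"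
    if "P x \<in> S" for x
    by (rule has_derivative_in_compose2[OF f'(1)])
      (use that assms in \<open>auto simp: linear_conv_bounded_linear
         intro: bounded_linear_imp_has_derivative\<close>)
  moreover have "Ck_on k UNIV (P -` S) (\<lambda>x. f' (P x) (P v))" for v
    using Suc.IH[OF f'(2)] assms by auto
  ultimately show ?case by (intro Ck_on_SucI) auto
qed

lemma linear_projection:
  fixes V :: "'a::euclidean_space set"
  assumes "subspace V"
  obtains P where "linear P" "range P \<subseteq> V" "\<forall>v\<in>V. P v = v"
  using linear_exists_left_inverse_on[OF linear_id assms] by auto

lemma open_projection_vimage:
  fixes P :: "'a::euclidean_space \<Rightarrow> 'b::real_normed_vector"
  assumes "linear P" "range P \<subseteq> V" "openin (top_of_set V) S"
  shows "open (P -` S)"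
proof -
  obtain T where "open T" "S = V \<inter> T" using assms(3) openin_open by blast
  then have "P -` S = P -` T" using assms(2) by auto
  then show ?thesis
    using \<open>open T\<close> continuous_open_vimage[of T P]
      linear_continuous_at[OF assms(1)[unfolded linear_conv_bounded_linear]] by simp
qed

lemma Cinf_on_lift_iff:
  fixes f :: "'a::euclidean_space \<Rightarrow> 'b::euclidean_space"
  assumes "linear P" "range P \<subseteq> V" "\<forall>v\<in>V. P v = v" "S \<subseteq> V"
  shows "Cinf_on V S f \<longleftrightarrow> Cinf_on UNIV (P -` S) (\<lambda>x. f (P x))"
proof -
  have "Ck_on k V S f" if "Ck_on k UNIV (P -` S) (\<lambda>x. f (P x))" for k
  proof (rule Ck_on_cong[OF _ Ck_on_subset[OF _ _ that]])
    show "S \<subseteq> P -` S" "\<And>x. x \<in> S \<Longrightarrow> f (P x) = f x" using assms by auto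
  qed auto
  then show ?thesis using Ck_on_lift[OF assms(1,2)] unfolding Cinf_on_def by blast
qed

lemma Cinf_on_subset: "Cinf_on V S f \<Longrightarrow> V' \<subseteq> V \<Longrightarrow> S' \<subseteq> S \<Longrightarrow> Cinf_on V' S' f"
  using Ck_on_subset unfolding Cinf_on_def by metis

lemma Cinf_on_cong: "Cinf_on V S f \<Longrightarrow> (\<And>x. x \<in> S \<Longrightarrow> f x = g x) \<Longrightarrow> Cinf_on V S g"
  using Ck_on_cong[of S f g] unfolding Cinf_on_def by simp

lemma Cinf_on_const: "Cinf_on V S (\<lambda>x. c)"
  by (simp add: Cinf_on_def Ck_on_const)

lemma Cinf_on_linear: "linear f \<Longrightarrow> Cinf_on V S f"
  by (simp add: Cinf_on_def Ck_on_linear)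

lemma Cinf_on_Pair:
  "Cinf_on V S f \<Longrightarrow> Cinf_on V S g \<Longrightarrow> Cinf_on V S (\<lambda>x. (f x, g x))"
  by (simp add: Cinf_on_def Ck_on_Pair)

lemma Cinf_on_add:
  "Cinf_on V S f \<Longrightarrow> Cinf_on V S g \<Longrightarrow> Cinf_on V S (\<lambda>x. f x + g x)"
  by (simp add: Cinf_on_def Ck_on_add)

lemma Cinf_on_linear_comp:
  "linear L \<Longrightarrow> Cinf_on V S f \<Longrightarrow> Cinf_on V S (\<lambda>x. L (f x))"
  by (simp add: Cinf_on_def Ck_on_linear_comp)

lemma Cinf_on_compose:
  fixes f :: "'a::euclidean_space \<Rightarrow> 'b::euclidean_space"
    and g :: "'b \<Rightarrow> 'c::euclidean_space"
  assumes "subspace V" "subspace W" "S \<subseteq> V" "T \<subseteq> W" "f ` S \<subseteq> T"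
    and "Cinf_on V S f" "Cinf_on W T g"
  shows "Cinf_on V S (\<lambda>x. g (f x))"
proof -
  obtain P where P: "linear P" "range P \<subseteq> V" "\<forall>v\<in>V. P v = v" by (rule linear_projection[OF assms(1)]) blast
  obtain Q where Q: "linear Q" "range Q \<subseteq> W" "\<forall>v\<in>W. Q v = v" by (rule linear_projection[OF assms(2)]) blast
  have QS: "\<And>x. x \<in> T \<Longrightarrow> Q x = x" using Q assms by auto
  have "(\<lambda>x. f (P x)) ` (P -` S) \<subseteq> Q -` T" using assms(5) QS by auto
  from Ck_on_compose[OF this, of _ "\<lambda>y. g (Q y)"]
  have "Cinf_on UNIV (P -` S) (\<lambda>x. g (Q (f (P x))))"
    using assms(6)[THEN Cinf_on_lift_iff[OF P assms(3), THEN iffD1]]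
      assms(7)[THEN Cinf_on_lift_iff[OF Q assms(4), THEN iffD1]]
    unfolding Cinf_on_def by blast
  then have "Cinf_on UNIV (P -` S) (\<lambda>x. g (f (P x)))"
    by (rule Cinf_on_cong) (use assms(5) QS in auto)
  then show ?thesis using Cinf_on_lift_iff[OF P assms(3), of "\<lambda>x. g (f x)"] by simp
qed

lemma Cinf_on_local:
  fixes f :: "'a::euclidean_space \<Rightarrow> 'b::euclidean_space"
  assumes V: "subspace V" and S: "openin (top_of_set V) S"
    and loc: "\<And>x. x \<in> S \<Longrightarrow> \<exists>T. openin (top_of_set V) T \<and> x \<in> T \<and> Cinf_on V (S \<inter> T) f"
  shows "Cinf_on V S f"
proof -
  obtain P where P: "linear P" "range P \<subseteq> V" "\<forall>v\<in>V. P v = v" by (rule linear_projection[OF V]) blast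
  have SV: "S \<subseteq> V" using S openin_imp_subset by blast
  have "Ck_on k UNIV (P -` S) (\<lambda>x. f (P x))" for k
  proof (rule Ck_on_local)
    show "open (P -` S)" using open_projection_vimage P S by blast
    fix x assume "x \<in> P -` S"
    then obtain T where "openin (top_of_set V) T" "P x \<in> T" "Cinf_on V (S \<inter> T) f" using loc by auto
    then show "\<exists>T. open T \<and> x \<in> T \<and> Ck_on k UNIV (P -` S \<inter> T) (\<lambda>x. f (P x))"
      using Ck_on_lift[OF P(1,2), of k "S \<inter> T" f] open_projection_vimage[OF P(1,2), of T]
      by (intro exI[of _ "P -` T"]) (auto simp: Cinf_on_def vimage_Int)
  qed
  then show ?thesis using Cinf_on_lift_iff[OF P SV] unfolding Cinf_on_def by blast
qed

lemma Cinf_on_has_derivative: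
  assumes "Cinf_on V S f" "x \<in> S"
  obtains D where "(f has_derivative D) (at x within S)"
  using Ck_on_SucE[OF assms(1)[unfolded Cinf_on_def, rule_format, of "Suc 0"]] assms(2) by metis

lemma has_derivative_compose_projection:
  assumes "bounded_linear P" "P x = x" "(f has_derivative D) (at x within S)"
  shows "((\<lambda>z. f (P z)) has_derivative (\<lambda>v. D (P v))) (at x within P -` S)"
proof (rule has_derivative_in_compose[where f = P and g = f and g' = D])
  show "(P has_derivative P) (at x within P -` S)"
    by (rule bounded_linear_imp_has_derivative[OF assms(1)])
  show "(f has_derivative D) (at (P x) within P ` P -` S)"
    using has_derivative_subset[OF assms(3)] assms(2) by auto
qed

lemma has_derivative_unique_on_subspace:
  fixes f :: "'a::euclidean_space \<Rightarrow> 'b::real_normed_vector"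
  assumes "subspace V" "openin (top_of_set V) S" "x \<in> S"
    and "(f has_derivative D1) (at x within S)" "(f has_derivative D2) (at x within S)" "v \<in> V"
  shows "D1 v = D2 v"
proof -
  obtain P where P: "linear P" "range P \<subseteq> V" "\<forall>v\<in>V. P v = v" by (rule linear_projection[OF assms(1)]) blast
  have Px: "P x = x" using assms P openin_imp_subset by blast
  have op: "open (P -` S)" using open_projection_vimage P assms by blast
  have "((\<lambda>x. f (P x)) has_derivative (\<lambda>v. D (P v))) (at x)"
    if "(f has_derivative D) (at x within S)" for D
  proof -
    have "((\<lambda>x. f (P x)) has_derivative (\<lambda>v. D (P v))) (at x within P -` S)"
      by (rule has_derivative_compose_projection[OF P(1)[unfolded linear_conv_bounded_linear] Px that])
    then show ?thesis using at_within_open[OF _ op, of x] assms(3) Px by simp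
  qed
  then have "(\<lambda>v. D1 (P v)) = (\<lambda>v. D2 (P v))"
    using assms(4,5) has_derivative_unique by blast
  then have "D1 (P v) = D2 (P v)" by meson
  then show ?thesis using P(3) assms(6) by simp
qed

text \<open>
  A derivative within \<open>S \<subseteq> V\<close> is determined only on \<open>V\<close>. Composing it with a projection onto \<open>W\<close>
  selects one that takes all its values in \<open>W\<close>.
\<close>

lemma has_derivative_into_subspace:
  fixes f :: "'a::euclidean_space \<Rightarrow> 'b::euclidean_space"
  assumes "subspace W" "f ` S \<subseteq> W" "x \<in> S" "(f has_derivative D) (at x within S)"
  obtains D' where "(f has_derivative D') (at x within S)" "range D' \<subseteq> W"
proof -
  obtain P where P: "linear P" "range P \<subseteq> W" "\<forall>v\<in>W. P v = v" by (rule linear_projection[OF assms(1)]) blast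
  have "((\<lambda>x. P (f x)) has_derivative (\<lambda>v. P (D v))) (at x within S)"
    using assms(4) P(1) by (simp add: bounded_linear.has_derivative linear_conv_bounded_linear)
  then have "(f has_derivative (\<lambda>v. P (D v))) (at x within S)"
    by (rule has_derivative_transform[OF assms(3), rotated]) (use P assms in auto)
  then show ?thesis using that[of "\<lambda>v. P (D v)"] P by auto
qed

section \<open>The smooth inverse function theorem\<close>

lemma linear_basis_expansion:
  fixes A :: "'a::euclidean_space \<Rightarrow> 'b::real_normed_vector"
  assumes "linear A"
  shows "A v = (\<Sum>b\<in>Basis. (v \<bullet> b) *\<^sub>R A b)"
proof -
  have "A (\<Sum>b\<in>Basis. (v \<bullet> b) *\<^sub>R b) = (\<Sum>b\<in>Basis. (v \<bullet> b) *\<^sub>R A b)"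
    using assms by (simp add: linear_sum linear_scale)
  then show ?thesis by (simp add: euclidean_representation)
qed

text \<open>
  This is \<open>d (A\<^sup>-\<^sup>1) = - A\<^sup>-\<^sup>1 \<cdot> dA \<cdot> A\<^sup>-\<^sup>1\<close>. The map \<open>(x, w) \<mapsto> (x, B x w)\<close> inverts
  \<open>(x, v) \<mapsto> (x, A x v)\<close>, and the theorem on derivatives of inverse maps applies to this pair without
  any estimate on how \<open>B\<close> varies.
\<close>

lemma has_derivative_inverse_family:
  fixes A B :: "'a::euclidean_space \<Rightarrow> 'b::euclidean_space \<Rightarrow> 'b"
  assumes S: "open S" "x \<in> S"
    and linA: "\<And>x. x \<in> S \<Longrightarrow> linear (A x)" and linB: "\<And>x. x \<in> S \<Longrightarrow> linear (B x)"
    and AB: "\<And>x v. x \<in> S \<Longrightarrow> A x (B x v) = v" and BA: "\<And>x v. x \<in> S \<Longrightarrow> B x (A x v) = v"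
    and A': "\<And>b x. x \<in> S \<Longrightarrow> ((\<lambda>x. A x b) has_derivative A' b x) (at x)"
  shows "((\<lambda>x. B x w) has_derivative
      (\<lambda>h. - B x (\<Sum>b\<in>Basis. (B x w \<bullet> b) *\<^sub>R A' b x h))) (at x)"
proof -
  \<comment> \<open>The sum in \<open>K\<close> is \<open>A x v\<close>, written so that its differentiability in \<open>x\<close> and \<open>v\<close> jointly is visible.\<close>
  define K where "K = (\<lambda>(x, v). (x, \<Sum>b\<in>Basis. (v \<bullet> b) *\<^sub>R A x b))"
  define L where "L = (\<lambda>(x, v). (x, B x v))"
  define v where "v = B x w"
  define s where "s h = (\<Sum>b\<in>Basis. (v \<bullet> b) *\<^sub>R A' b x h)" for h
  define K' where "K' = (\<lambda>(h, u). (h, A x u + s h))"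
  define L' where "L' = (\<lambda>(h, u). (h, B x (u - s h)))"
  have K: "K (y, u) = (y, A y u)" if "y \<in> S" for y u
    using linear_basis_expansion[OF linA[OF that], of u] by (simp add: K_def)
  have derK: "(K has_derivative (\<lambda>h. (fst h, \<Sum>b\<in>Basis. (snd z \<bullet> b) *\<^sub>R A' b (fst z) (fst h) +
      (snd h \<bullet> b) *\<^sub>R A (fst z) b))) (at z)" if "fst z \<in> S" for z
  proof -
    have "((\<lambda>z. A (fst z) b) has_derivative (\<lambda>h. A' b (fst z) (fst h))) (at z)" for b
      by (rule has_derivative_compose[OF has_derivative_fst[OF has_derivative_ident] A'[OF that]])
    then show ?thesis
      unfolding K_def case_prod_beta
      by (intro has_derivative_Pair has_derivative_sum has_derivative_scaleR has_derivative_fst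
          has_derivative_ident has_derivative_inner_left has_derivative_snd)
  qed
  have "(L has_derivative L') (at (K (x, v)))"
  proof (rule has_derivative_inverse_strong[where S = "S \<times> UNIV" and f' = K' and f = K and x = "(x, v)"])
    show "open (S \<times> (UNIV :: 'b set))" "(x, v) \<in> S \<times> UNIV" using S by (auto simp: open_Times)
    show "continuous_on (S \<times> UNIV) K"
      using has_derivative_continuous[OF derK]
      by (intro continuous_at_imp_continuous_on) auto
    show "L (K z) = z" if "z \<in> S \<times> UNIV" for z
      using that K BA by (auto simp: L_def)
    have "(\<lambda>h. (fst h, \<Sum>b\<in>Basis. (v \<bullet> b) *\<^sub>R A' b x (fst h) + (snd h \<bullet> b) *\<^sub>R A x b)) = K'"
      using linear_basis_expansion[OF linA[OF S(2)], symmetric]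
      by (auto simp: K'_def s_def fun_eq_iff sum.distrib add.commute)
    then show "(K has_derivative K') (at (x, v))" using derK[of "(x, v)"] S(2) by simp
    show "K' \<circ> L' = id"
      using AB[OF S(2)] by (auto simp: K'_def L'_def fun_eq_iff)
  qed
  then have L: "(L has_derivative L') (at (x, w))"
    using K[OF S(2)] AB[OF S(2)] by (simp add: v_def)
  have "((\<lambda>y. snd (L (y, w))) has_derivative (\<lambda>h. snd (L' (h, 0)))) (at x)"
    by (rule has_derivative_snd, rule has_derivative_compose[where f = "\<lambda>y. (y, w)" and g = L])
      (use L in \<open>auto intro!: has_derivative_Pair\<close>)
  then show ?thesis
    using linear_neg[OF linB[OF S(2)]] by (simp add: L_def L'_def s_def v_def)
qed

text \<open>
  The formula for the derivative of the inverse family involves only that family itself and the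
  derivative of \<open>A\<close>. Hence \<open>B\<close> inherits every order of differentiability from \<open>A\<close>, one at a time.
\<close>

lemma Ck_on_inverse_family:
  fixes A B :: "'a::euclidean_space \<Rightarrow> 'b::euclidean_space \<Rightarrow> 'b"
  assumes S: "open S"
    and linA: "\<And>x. x \<in> S \<Longrightarrow> linear (A x)" and linB: "\<And>x. x \<in> S \<Longrightarrow> linear (B x)"
    and AB: "\<And>x v. x \<in> S \<Longrightarrow> A x (B x v) = v" and BA: "\<And>x v. x \<in> S \<Longrightarrow> B x (A x v) = v"
    and B0: "\<And>v. continuous_on S (\<lambda>x. B x v)"
  shows "(\<And>v. Ck_on k UNIV S (\<lambda>x. A x v)) \<Longrightarrow> Ck_on k UNIV S (\<lambda>x. B x w)"
proof (induction k arbitrary: w)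
  case 0
  then show ?case using B0 by simp
next
  case (Suc k)
  define A' where "A' b x = frechet_derivative (\<lambda>x. A x b) (at x)" for b x
  have A': "\<And>b x. x \<in> S \<Longrightarrow> ((\<lambda>x. A x b) has_derivative A' b x) (at x)"
    and Ck_A': "\<And>b v. Ck_on k UNIV S (\<lambda>x. A' b x v)"
    using Suc.prems S unfolding Ck_on_Suc_open[OF S] A'_def frechet_derivative_works by auto
  have IH: "\<And>w. Ck_on k UNIV S (\<lambda>x. B x w)"
    using Suc.IH Ck_on_SucD[OF Suc.prems] by blast
  have "Ck_on k UNIV S (\<lambda>x. - B x (\<Sum>b\<in>Basis. (B x w \<bullet> b) *\<^sub>R A' b x h))" for h
  proof (rule Ck_on_cong)
    let ?u = "\<lambda>x. \<Sum>b\<in>Basis. (B x w \<bullet> b) *\<^sub>R A' b x h"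
    show "Ck_on k UNIV S (\<lambda>x. - (\<Sum>c\<in>Basis. (?u x \<bullet> c) *\<^sub>R B x c))"
      by (intro Ck_on_linear_comp[where L = uminus] Ck_on_sum Ck_on_const IH Ck_A'
          Ck_on_bilinear[OF bounded_bilinear_scaleR] Ck_on_bilinear[OF bounded_bilinear_inner])
        (auto intro: linearI)
    fix x assume "x \<in> S"
    then show "- (\<Sum>c\<in>Basis. (?u x \<bullet> c) *\<^sub>R B x c) = - B x (?u x)"
      using linear_basis_expansion[OF linB, of x "?u x"] by simp
  qed
  moreover have "((\<lambda>x. B x w) has_derivative
      (\<lambda>h. - B x (\<Sum>b\<in>Basis. (B x w \<bullet> b) *\<^sub>R A' b x h))) (at x within S)" if "x \<in> S" for x
    by (rule has_derivative_at_withinI, rule has_derivative_inverse_family[where A = A, OF S that])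
      (fact linA linB AB BA A')+
  ultimately show ?case by (intro Ck_on_SucI)
qed

text \<open>
  The \<open>C\<^sup>1\<close> inverse function theorem gives a differentiable inverse \<open>g\<close> with
  \<open>D g y = (D f (g y))\<^sup>-\<^sup>1\<close>. If \<open>g\<close> is \<open>C\<^sup>k\<close>, then so are \<open>y \<mapsto> D f (g y)\<close> and its inverse family, and
  therefore \<open>g\<close> is \<open>C\<^sup>k\<^sup>+\<^sup>1\<close>.
\<close>

theorem Cinf_on_inverse_function_UNIV:
  fixes f :: "'a::euclidean_space \<Rightarrow> 'a"
  assumes U: "open U" and x0: "x0 \<in> U" and f: "Cinf_on UNIV U f"
    and der: "(f has_derivative id) (at x0)"
  obtains T g where "open T" "x0 \<in> T" "T \<subseteq> U" "open (f ` T)" "Cinf_on UNIV (f ` T) g"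
    "\<And>x. x \<in> T \<Longrightarrow> g (f x) = x"
proof -
  define f' where "f' x = Blinfun (frechet_derivative f (at x))" for x
  have CkS: "Ck_on (Suc k) UNIV U f" for k using f unfolding Cinf_on_def by blast
  then have works: "(f has_derivative frechet_derivative f (at x)) (at x)" if "x \<in> U" for x
    using that unfolding Ck_on_Suc_open[OF U] frechet_derivative_works by blast
  have f': "blinfun_apply (f' x) = frechet_derivative f (at x)" if "x \<in> U" for x
    using works[OF that] unfolding f'_def
    by (simp add: bounded_linear_Blinfun_apply has_derivative_bounded_linear)
  have Ckf': "Ck_on k UNIV U (\<lambda>x. blinfun_apply (f' x) v)" for k v
    by (rule Ck_on_cong[where f = "\<lambda>x. frechet_derivative f (at x) v"])
      (use CkS f' in \<open>auto simp: Ck_on_Suc_open[OF U] \<close>)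
  obtain U' V g g' where g: "open U'" "U' \<subseteq> U" "x0 \<in> U'" "open V" "f x0 \<in> V"
    "homeomorphism U' V f g" "\<And>y. y \<in> V \<Longrightarrow> (g has_derivative g' y) (at y)"
    "\<And>y. y \<in> V \<Longrightarrow> g' y = inv_into UNIV (blinfun_apply (f' (g y)))"
    "\<And>y. y \<in> V \<Longrightarrow> bij (blinfun_apply (f' (g y)))"
  proof (rule inverse_function_theorem[OF U, of f f' x0 id_blinfun])
    show "(f has_derivative blinfun_apply (f' x)) (at x)" if "x \<in> U" for x
      using works f' that by simp
    show "continuous_on U f'"
      using Ckf'[of 0] by (intro continuous_on_blinfun_componentwise) auto
    have "frechet_derivative f (at x0) = id"
      using der frechet_derivative_at by metis
    then show "id_blinfun o\<^sub>L f' x0 = id_blinfun"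
      using f'[OF x0] by (intro blinfun_eqI) simp
  qed (use x0 in blast)+
  have img: "f ` U' = V" and gV: "\<And>y. y \<in> V \<Longrightarrow> g y \<in> U'" and gf: "\<And>x. x \<in> U' \<Longrightarrow> g (f x) = x"
    using g(6) unfolding homeomorphism_def by auto
  have lin: "linear (g' y)" if "y \<in> V" for y
    using g(7)[OF that] has_derivative_linear by blast
  have AB: "blinfun_apply (f' (g y)) (g' y v) = v" "g' y (blinfun_apply (f' (g y)) v) = v"
    if "y \<in> V" for y v
    using g(8,9)[OF that] by (simp_all add: bij_is_surj bij_is_inj surj_f_inv_f)
  have blinfun_linear: "linear (blinfun_apply (f' (g y)))" for y
    by (simp add: bounded_linear.linear blinfun.bounded_linear_right)
  have contB: "continuous_on V (\<lambda>y. g' y v)" for v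
  proof (intro continuous_at_imp_continuous_on ballI)
    fix y assume y: "y \<in> V"
    let ?D = "\<lambda>b x. frechet_derivative (\<lambda>x. blinfun_apply (f' x) b) (at x)"
    have D: "((\<lambda>x. blinfun_apply (f' x) b) has_derivative ?D b x) (at x)" if "x \<in> U" for b x
      using Ckf'[of "Suc 0"] that unfolding Ck_on_Suc_open[OF U] frechet_derivative_works by blast
    have A': "((\<lambda>y. blinfun_apply (f' (g y)) b) has_derivative (\<lambda>h. ?D b (g z) (g' z h))) (at z)"
      if "z \<in> V" for b z
      using has_derivative_compose[OF g(7)[OF that] D] gV[OF that] g(2) by blast
    show "isCont (\<lambda>y. g' y v) y"
      by (rule has_derivative_continuous,
          rule has_derivative_inverse_family[where A = "\<lambda>y. blinfun_apply (f' (g y))", OF g(4) y])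
        (rule blinfun_linear | erule lin AB A')+
  qed
  have Ckg: "Ck_on k UNIV V g" for k
  proof (induction k)
    case 0
    then show ?case using g(7) by (auto intro!: continuous_at_imp_continuous_on has_derivative_continuous)
  next
    case (Suc k)
    have "g ` V \<subseteq> U" using gV g(2) by blast
    then have A: "Ck_on k UNIV V (\<lambda>y. blinfun_apply (f' (g y)) v)" for v
      using Ck_on_compose[OF _ Suc.IH Ckf'] by blast
    have "Ck_on k UNIV V (\<lambda>y. g' y v)" for v
      by (rule Ck_on_inverse_family[where A = "\<lambda>y. blinfun_apply (f' (g y))", OF g(4)])
        (rule blinfun_linear contB A | erule lin AB)+
    then show ?case
      using g(7) by (intro Ck_on_SucI[where f' = g']) (auto intro: has_derivative_at_withinI)
  qed
  show ?thesis
    using that[of U' g] g img gf Ckg by (simp add: Cinf_on_def)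
qed

text \<open>
  The version for a subspace: \<open>f\<close> is extended to the whole space by the identity in the directions
  killed by a projection onto \<open>V\<close>.
\<close>

theorem Cinf_on_inverse_function:
  fixes f :: "'a::euclidean_space \<Rightarrow> 'a"
  assumes V: "subspace V" and U: "openin (top_of_set V) U" and x0: "x0 \<in> U"
    and f: "Cinf_on V U f" "f ` U \<subseteq> V"
    and der: "(f has_derivative D) (at x0 within U)" and D: "\<And>v. v \<in> V \<Longrightarrow> D v = v"
  obtains T g where "openin (top_of_set V) T" "x0 \<in> T" "T \<subseteq> U" "openin (top_of_set V) (f ` T)"
    "Cinf_on V (f ` T) g" "\<And>x. x \<in> T \<Longrightarrow> g (f x) = x"
proof -
  obtain P where P: "linear P" "range P \<subseteq> V" "\<forall>v\<in>V. P v = v"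
    by (rule linear_projection[OF V]) blast
  define F where "F z = f (P z) + (z - P z)" for z
  have UV: "U \<subseteq> V" using U openin_imp_subset by blast
  have Px0: "P x0 = x0" using P UV x0 by blast
  have bl: "bounded_linear P" using P(1) linear_conv_bounded_linear by blast
  have opU: "open (P -` U)" using open_projection_vimage P U by blast
  have "((\<lambda>z. f (P z)) has_derivative (\<lambda>v. D (P v))) (at x0 within P -` U)"
    by (rule has_derivative_compose_projection[OF bl Px0 der])
  then have "((\<lambda>z. f (P z)) has_derivative (\<lambda>v. D (P v))) (at x0)"
    using at_within_open[OF _ opU, of x0] x0 Px0 by simp
  then have "(F has_derivative (\<lambda>v. D (P v) + (v - P v))) (at x0)"
    unfolding F_def
    by (intro has_derivative_add has_derivative_diff has_derivative_ident
        bounded_linear_imp_has_derivative bl)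
  moreover have "(\<lambda>v. D (P v) + (v - P v)) = id" using D P(2) by fastforce
  ultimately have derF: "(F has_derivative id) (at x0)" by simp
  have "linear (\<lambda>z. z - P z)"
    using P(1) by (simp add: linear_compose_sub linear_ident)
  then have CF: "Cinf_on UNIV (P -` U) F"
    using Cinf_on_add[OF f(1)[THEN Cinf_on_lift_iff[OF P UV, THEN iffD1]] Cinf_on_linear]
    unfolding F_def by blast
  obtain T g where T: "open T" "x0 \<in> T" "T \<subseteq> P -` U" "open (F ` T)" "Cinf_on UNIV (F ` T) g"
    "\<And>x. x \<in> T \<Longrightarrow> g (F x) = x"
    by (rule Cinf_on_inverse_function_UNIV[OF opU _ CF derF]) (use x0 Px0 in blast)+
  have Ff: "F z = f z" if "z \<in> V" for z using P(3) that by (simp add: F_def)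
  \<comment> \<open>\<open>F\<close> does not move the component outside \<open>V\<close>, so a point that it sends into \<open>V\<close> lies in \<open>V\<close>.\<close>
  have inV: "z \<in> V" if z: "z \<in> T" "F z \<in> V" for z
  proof -
    have "f (P z) \<in> V" using z T(3) f(2) by blast
    then have "z - P z \<in> V" using z(2) subspace_diff[OF V] F_def[of z] by (metis add_diff_cancel_left')
    then have "P (z - P z) = z - P z" using P(3) by blast
    then have "z = P z" using linear_diff[OF P(1)] P(2,3) by (simp add: range_subsetD)
    then show ?thesis using P(2) by (metis range_subsetD)
  qed
  have TU: "V \<inter> T \<subseteq> U"
    using T(3) P(3) by (metis IntE subsetD subsetI vimageD)
  then have fV: "f z \<in> V" if "z \<in> T" "z \<in> V" for z
    using that f(2) by blast
  have img: "f ` (V \<inter> T) = V \<inter> F ` T"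
  proof (intro equalityI subsetI)
    fix y assume "y \<in> f ` (V \<inter> T)"
    then obtain z where z: "z \<in> V" "z \<in> T" "y = f z" by blast
    then show "y \<in> V \<inter> F ` T" using Ff[of z] fV[of z] imageI[of z T F] by simp
  next
    fix y assume "y \<in> V \<inter> F ` T"
    then obtain z where z: "F z \<in> V" "z \<in> T" "y = F z" by blast
    then show "y \<in> f ` (V \<inter> T)" using Ff[of z] inV[of z] imageI[of z "V \<inter> T" f] by simp
  qed
  show ?thesis
  proof
    show "openin (top_of_set V) (V \<inter> T)" "openin (top_of_set V) (f ` (V \<inter> T))"
      unfolding img using T by (auto intro: openin_open_Int)
    show "x0 \<in> V \<inter> T" using T UV x0 by blast
    show "V \<inter> T \<subseteq> U" by (rule TU)
    show "Cinf_on V (f ` (V \<inter> T)) g"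
      unfolding img using T(5) by (rule Cinf_on_subset) auto
    show "g (f x) = x" if "x \<in> V \<inter> T" for x
      using that T(6)[of x] Ff[of x] by simp
  qed
qed

section \<open>Smooth maps\<close>

text \<open>
  The part of \<^const>\<open>smooth_manifold\<close> that concerns charts. It passes to open subsets and to
  products by looking at charts alone.
\<close>

definition smooth_atlas :: "('a, 'e::euclidean_space) mfd \<Rightarrow> bool" where
  "smooth_atlas M \<longleftrightarrow>
     subspace (model M) \<and>
     (\<forall>(U, \<phi>)\<in>charts M. is_chart M U \<phi>) \<and>
     (\<Union>(U, \<phi>)\<in>charts M. U) = pts M \<and>
     (\<forall>(U, \<phi>)\<in>charts M. \<forall>(V, \<psi>)\<in>charts M.
        Cinf_on (model M) (\<phi> ` (U \<inter> V)) (\<psi> \<circ> inv_into U \<phi>))"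

lemma smooth_manifold_iff:
  "smooth_manifold M \<longleftrightarrow>
     Hausdorff_space (mtop M) \<and> second_countable_top (mtop M) \<and> smooth_atlas M"
  by (auto simp: smooth_manifold_def smooth_atlas_def)

lemma smooth_atlasD:
  assumes "smooth_atlas M"
  shows "subspace (model M)"
    and "(U, \<phi>) \<in> charts M \<Longrightarrow> is_chart M U \<phi>"
    and "p \<in> pts M \<Longrightarrow> \<exists>U \<phi>. (U, \<phi>) \<in> charts M \<and> p \<in> U"
    and "(U, \<phi>) \<in> charts M \<Longrightarrow> (V, \<psi>) \<in> charts M \<Longrightarrow>
      Cinf_on (model M) (\<phi> ` (U \<inter> V)) (\<lambda>x. \<psi> (inv_into U \<phi> x))"
proof -
  have "(\<Union>(U, \<phi>)\<in>charts M. U) = pts M" using assms unfolding smooth_atlas_def by blast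
  then show "p \<in> pts M \<Longrightarrow> \<exists>U \<phi>. (U, \<phi>) \<in> charts M \<and> p \<in> U" by fast
qed (use assms in \<open>auto simp: smooth_atlas_def comp_def\<close>)

lemma smooth_atlasI:
  assumes "subspace (model M)" "\<And>U \<phi>. (U, \<phi>) \<in> charts M \<Longrightarrow> is_chart M U \<phi>"
    and "\<And>p. p \<in> pts M \<Longrightarrow> \<exists>U \<phi>. (U, \<phi>) \<in> charts M \<and> p \<in> U"
    and "\<And>U \<phi> V \<psi>. (U, \<phi>) \<in> charts M \<Longrightarrow> (V, \<psi>) \<in> charts M \<Longrightarrow>
      Cinf_on (model M) (\<phi> ` (U \<inter> V)) (\<lambda>x. \<psi> (inv_into U \<phi> x))"
  shows "smooth_atlas M"
proof -
  have "U \<subseteq> pts M" if "(U, \<phi>) \<in> charts M" for U \<phi>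
    using assms(2)[OF that] by (simp add: is_chart_def openin_subset)
  then have "(\<Union>(U, \<phi>)\<in>charts M. U) = pts M" using assms(3) by fast
  then show ?thesis
    using assms(1,2,4) unfolding smooth_atlas_def comp_def by fast
qed

lemma is_chartD:
  assumes "is_chart M U \<phi>"
  shows "openin (mtop M) U" "U \<subseteq> pts M" "inj_on \<phi> U" "openin (top_of_set (model M)) (\<phi> ` U)"
    and "homeomorphic_maps (subtopology (mtop M) U) (top_of_set (\<phi> ` U)) \<phi> (inv_into U \<phi>)"
    and "openin (mtop M) W \<Longrightarrow> W \<subseteq> U \<Longrightarrow> openin (top_of_set (model M)) (\<phi> ` W)"
    and "openin (top_of_set (model M)) T \<Longrightarrow> openin (mtop M) (U \<inter> \<phi> -` T)"
proof -
  have c: "openin (mtop M) U" "openin (top_of_set (model M)) (\<phi> ` U)"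
    "homeomorphic_map (subtopology (mtop M) U) (top_of_set (\<phi> ` U)) \<phi>"
    using assms by (auto simp: is_chart_def)
  have UM: "U \<subseteq> pts M" using c(1) by (rule openin_subset)
  have top: "topspace (subtopology (mtop M) U) = U" using UM by auto
  show inj: "inj_on \<phi> U" using c(3) top by (simp add: homeomorphic_map_def)
  show "openin (mtop M) U" "openin (top_of_set (model M)) (\<phi> ` U)" "U \<subseteq> pts M"
    using c UM by auto
  obtain g where g: "homeomorphic_maps (subtopology (mtop M) U) (top_of_set (\<phi> ` U)) \<phi> g"
    using c(3) homeomorphic_map_maps by blast
  show "homeomorphic_maps (subtopology (mtop M) U) (top_of_set (\<phi> ` U)) \<phi> (inv_into U \<phi>)"
  proof (rule homeomorphic_maps_eq[OF g])
    fix y assume "y \<in> topspace (top_of_set (\<phi> ` U))"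
    then obtain x where "x \<in> U" "y = \<phi> x" by auto
    then show "g y = inv_into U \<phi> y"
      using g inj top by (auto simp: homeomorphic_maps_def)
  qed simp
  show "openin (top_of_set (model M)) (\<phi> ` W)" if W: "openin (mtop M) W" "W \<subseteq> U"
  proof -
    have "openin (subtopology (mtop M) U) W" using W c(1) by (simp add: openin_open_subtopology)
    then have "openin (top_of_set (\<phi> ` U)) (\<phi> ` W)"
      using homeomorphic_imp_open_map[OF c(3)] by (simp add: open_map_def)
    then show ?thesis using c(2) openin_trans by blast
  qed
  show "openin (mtop M) (U \<inter> \<phi> -` T)" if T: "openin (top_of_set (model M)) T"
  proof -
    obtain T' where "open T'" "T = model M \<inter> T'" using T openin_open by blast
    moreover from this have "\<phi> ` U \<inter> T = \<phi> ` U \<inter> T'" using openin_imp_subset[OF c(2)] by blast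
    ultimately have "openin (top_of_set (\<phi> ` U)) (\<phi> ` U \<inter> T)" by (simp add: openin_open_Int)
    then have "openin (subtopology (mtop M) U) {x \<in> topspace (subtopology (mtop M) U). \<phi> x \<in> \<phi> ` U \<inter> T}"
      using homeomorphic_imp_continuous_map[OF c(3)] openin_continuous_map_preimage by blast
    moreover have "{x \<in> topspace (subtopology (mtop M) U). \<phi> x \<in> \<phi> ` U \<inter> T} = U \<inter> \<phi> -` T"
      using top by auto
    ultimately show ?thesis using c(1) openin_trans_full by fastforce
  qed
qed

lemma is_chartI:
  assumes "openin (mtop M) U" "openin (top_of_set (model M)) (\<phi> ` U)"
    "homeomorphic_maps (subtopology (mtop M) U) (top_of_set (\<phi> ` U)) \<phi> g"
  shows "is_chart M U \<phi>"
  using assms homeomorphic_map_maps unfolding is_chart_def by blast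

lemma openin_vimage_chart_domain:
  assumes "continuous_map X Y f" "openin X U" "openin Y V"
  shows "openin X (U \<inter> f -` V)"
  using openin_continuous_map_preimage_gen[OF assms] by (simp add: vimage_def Int_def)

lemma smooth_map_continuous: "smooth_map M N f \<Longrightarrow> continuous_map (mtop M) (mtop N) f"
  by (simp add: smooth_map_def)

lemma smooth_map_in_pts: "smooth_map M N f \<Longrightarrow> p \<in> pts M \<Longrightarrow> f p \<in> pts N"
  using smooth_map_continuous continuous_map_funspace by blast

lemma smooth_map_coordinates:
  assumes "smooth_map M N f" "(U, \<phi>) \<in> charts M" "(V, \<psi>) \<in> charts N"
  shows "Cinf_on (model M) (\<phi> ` (U \<inter> f -` V)) (\<lambda>x. \<psi> (f (inv_into U \<phi> x)))"
  using assms unfolding smooth_map_def by (auto simp: comp_def)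

lemma smooth_mapI:
  assumes "continuous_map (mtop M) (mtop N) f"
    and "\<And>U \<phi> V \<psi>. (U, \<phi>) \<in> charts M \<Longrightarrow> (V, \<psi>) \<in> charts N \<Longrightarrow>
      Cinf_on (model M) (\<phi> ` (U \<inter> f -` V)) (\<lambda>x. \<psi> (f (inv_into U \<phi> x)))"
  shows "smooth_map M N f"
  using assms unfolding smooth_map_def by (auto simp: comp_def)

text \<open>
  One pair of charts around each point suffices: the transition maps on both sides carry
  smoothness over to all other pairs.
\<close>

lemma smooth_mapI_local:
  fixes M :: "('a, 'e::euclidean_space) mfd" and N :: "('b, 'f::euclidean_space) mfd"
  assumes M: "smooth_atlas M" and N: "smooth_atlas N"
    and cont: "continuous_map (mtop M) (mtop N) f"
    and loc: "\<And>p. p \<in> pts M \<Longrightarrow> \<exists>U \<phi> V \<psi> W. (U, \<phi>) \<in> charts M \<and> (V, \<psi>) \<in> charts N \<and>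
      openin (mtop M) W \<and> p \<in> W \<and> W \<subseteq> U \<and> f ` W \<subseteq> V \<and>
      Cinf_on (model M) (\<phi> ` W) (\<lambda>x. \<psi> (f (inv_into U \<phi> x)))"
  shows "smooth_map M N f"
proof (rule smooth_mapI[OF cont])
  fix U \<phi> V \<psi> assume c: "(U, \<phi>) \<in> charts M" "(V, \<psi>) \<in> charts N"
  note U = is_chartD[OF smooth_atlasD(2)[OF M c(1)]]
  note V = is_chartD[OF smooth_atlasD(2)[OF N c(2)]]
  have op: "openin (mtop M) (U \<inter> f -` V)"
    using openin_vimage_chart_domain[OF cont U(1) V(1)] .
  show "Cinf_on (model M) (\<phi> ` (U \<inter> f -` V)) (\<lambda>x. \<psi> (f (inv_into U \<phi> x)))"
  proof (rule Cinf_on_local)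
    show "subspace (model M)" using M smooth_atlasD by blast
    show "openin (top_of_set (model M)) (\<phi> ` (U \<inter> f -` V))" using U(6)[OF op] by blast
    fix x assume "x \<in> \<phi> ` (U \<inter> f -` V)"
    then obtain p where p: "p \<in> U" "f p \<in> V" "x = \<phi> p" by blast
    then obtain U' \<phi>' V' \<psi>' W where l: "(U', \<phi>') \<in> charts M" "(V', \<psi>') \<in> charts N"
      "openin (mtop M) W" "p \<in> W" "W \<subseteq> U'" "f ` W \<subseteq> V'"
      "Cinf_on (model M) (\<phi>' ` W) (\<lambda>x. \<psi>' (f (inv_into U' \<phi>' x)))"
      using loc[of p] U(2) by blast
    note U' = is_chartD[OF smooth_atlasD(2)[OF M l(1)]]
    note V' = is_chartD[OF smooth_atlasD(2)[OF N l(2)]]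
    let ?O = "W \<inter> (U \<inter> f -` V)"
    have O: "openin (mtop M) ?O" using l(3) op by (rule openin_Int)
    have sub: "\<phi> ` ?O \<subseteq> model M" "\<phi>' ` W \<subseteq> model M" "\<phi>' ` ?O \<subseteq> model M"
      "\<psi>' ` (V' \<inter> V) \<subseteq> model N"
      using openin_imp_subset[OF U(4)] openin_imp_subset[OF U'(4)] openin_imp_subset[OF V'(4)] l(5)
      by blast+
    have tr: "Cinf_on (model M) (\<phi> ` ?O) (\<lambda>x. \<phi>' (inv_into U \<phi> x))"
      by (rule Cinf_on_subset[OF smooth_atlasD(4)[OF M c(1) l(1)]]) (use l(5) in auto)
    have mid: "Cinf_on (model M) (\<phi>' ` ?O) (\<lambda>x. \<psi>' (f (inv_into U' \<phi>' x)))"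
      by (rule Cinf_on_subset[OF l(7)]) auto
    have im1: "(\<lambda>x. \<psi>' (f (inv_into U' \<phi>' x))) ` \<phi>' ` ?O \<subseteq> \<psi>' ` (V' \<inter> V)"
      using l(5,6) U'(3) by (fastforce simp: inv_into_f_f subset_iff)
    have "Cinf_on (model M) (\<phi>' ` ?O) (\<lambda>x. \<psi> (inv_into V' \<psi>' (\<psi>' (f (inv_into U' \<phi>' x)))))"
      using Cinf_on_compose[OF smooth_atlasD(1)[OF M] smooth_atlasD(1)[OF N] sub(3,4) im1 mid
          smooth_atlasD(4)[OF N l(2) c(2)]] .
    moreover have im2: "(\<lambda>x. \<phi>' (inv_into U \<phi> x)) ` \<phi> ` ?O \<subseteq> \<phi>' ` ?O"
      using U(3) by (auto simp: inv_into_f_f)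
    ultimately have "Cinf_on (model M) (\<phi> ` ?O)
      (\<lambda>x. \<psi> (inv_into V' \<psi>' (\<psi>' (f (inv_into U' \<phi>' (\<phi>' (inv_into U \<phi> x)))))))"
      using Cinf_on_compose[OF smooth_atlasD(1)[OF M] smooth_atlasD(1)[OF M] sub(1,3) im2 tr] by blast
    then have "Cinf_on (model M) (\<phi> ` ?O) (\<lambda>x. \<psi> (f (inv_into U \<phi> x)))"
    proof (rule Cinf_on_cong)
      fix y assume "y \<in> \<phi> ` ?O"
      then obtain q where q: "q \<in> W" "q \<in> U" "y = \<phi> q" by blast
      have "f q \<in> V'" "q \<in> U'" using q l(5,6) by auto
      then show "\<psi> (inv_into V' \<psi>' (\<psi>' (f (inv_into U' \<phi>' (\<phi>' (inv_into U \<phi> y)))))) =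
          \<psi> (f (inv_into U \<phi> y))"
        using q U(3) U'(3) V'(3) by (simp add: inv_into_f_f)
    qed
    moreover have "\<phi> ` (U \<inter> f -` V) \<inter> \<phi> ` ?O = \<phi> ` ?O" by auto
    moreover have "openin (top_of_set (model M)) (\<phi> ` ?O)" by (rule U(6)[OF O]) auto
    ultimately show "\<exists>T. openin (top_of_set (model M)) T \<and> x \<in> T \<and>
        Cinf_on (model M) (\<phi> ` (U \<inter> f -` V) \<inter> T) (\<lambda>x. \<psi> (f (inv_into U \<phi> x)))"
      using p l(4) by (intro exI[of _ "\<phi> ` ?O"]) auto
  qed
qed

lemma smooth_map_cong:
  assumes "smooth_atlas M" "smooth_map M N f" "\<And>p. p \<in> pts M \<Longrightarrow> f p = g p"
  shows "smooth_map M N g"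
proof (rule smooth_mapI)
  show "continuous_map (mtop M) (mtop N) g"
    using continuous_map_eq[OF smooth_map_continuous[OF assms(2)]] assms(3) by blast
  fix U \<phi> V \<psi> assume c: "(U, \<phi>) \<in> charts M" "(V, \<psi>) \<in> charts N"
  note U = is_chartD[OF smooth_atlasD(2)[OF assms(1) c(1)]]
  have eq: "U \<inter> f -` V = U \<inter> g -` V" using U(2) assms(3) by auto
  show "Cinf_on (model M) (\<phi> ` (U \<inter> g -` V)) (\<lambda>x. \<psi> (g (inv_into U \<phi> x)))"
    by (rule Cinf_on_cong[OF smooth_map_coordinates[OF assms(2) c, unfolded eq]])
      (use U(2,3) assms(3) in \<open>auto simp: inv_into_f_f subset_iff\<close>)
qed

lemma smooth_map_compose:
  assumes M: "smooth_atlas M" and N: "smooth_atlas N" and K: "smooth_atlas K"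
    and f: "smooth_map M N f" and g: "smooth_map N K g"
  shows "smooth_map M K (\<lambda>x. g (f x))"
proof (rule smooth_mapI_local[OF M K])
  show gf: "continuous_map (mtop M) (mtop K) (\<lambda>x. g (f x))"
    using continuous_map_compose[OF f[THEN smooth_map_continuous] g[THEN smooth_map_continuous]]
    by (simp add: comp_def)
  fix p assume p: "p \<in> pts M"
  obtain U \<phi> where U: "(U, \<phi>) \<in> charts M" "p \<in> U" using smooth_atlasD(3)[OF M p] by blast
  obtain V \<psi> where V: "(V, \<psi>) \<in> charts N" "f p \<in> V"
    using smooth_atlasD(3)[OF N smooth_map_in_pts[OF f p]] by blast
  obtain X \<xi> where X: "(X, \<xi>) \<in> charts K" "g (f p) \<in> X"
    using smooth_atlasD(3)[OF K] smooth_map_in_pts[OF g] smooth_map_in_pts[OF f p] by blast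
  note U' = is_chartD[OF smooth_atlasD(2)[OF M U(1)]]
  note V' = is_chartD[OF smooth_atlasD(2)[OF N V(1)]]
  note X' = is_chartD[OF smooth_atlasD(2)[OF K X(1)]]
  let ?W = "(U \<inter> f -` V) \<inter> (\<lambda>x. g (f x)) -` X"
  have op: "openin (mtop M) ?W"
    by (intro openin_vimage_chart_domain[OF gf] openin_vimage_chart_domain[OF smooth_map_continuous[OF f]] U' V' X')
  have sub: "\<phi> ` ?W \<subseteq> model M" "\<psi> ` (V \<inter> g -` X) \<subseteq> model N"
    using openin_imp_subset[OF U'(4)] openin_imp_subset[OF V'(4)] by blast+
  have im: "(\<lambda>x. \<psi> (f (inv_into U \<phi> x))) ` \<phi> ` ?W \<subseteq> \<psi> ` (V \<inter> g -` X)"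
    using U'(3) by (auto simp: inv_into_f_f)
  have "Cinf_on (model M) (\<phi> ` ?W) (\<lambda>x. \<xi> (g (inv_into V \<psi> (\<psi> (f (inv_into U \<phi> x))))))"
    by (rule Cinf_on_compose[OF smooth_atlasD(1)[OF M] smooth_atlasD(1)[OF N] sub im
          Cinf_on_subset[OF smooth_map_coordinates[OF f U(1) V(1)]]
          smooth_map_coordinates[OF g V(1) X(1)]]) auto
  then have "Cinf_on (model M) (\<phi> ` ?W) (\<lambda>x. \<xi> (g (f (inv_into U \<phi> x))))"
    by (rule Cinf_on_cong) (use U'(3) V'(3) in \<open>auto simp: inv_into_f_f\<close>)
  with op U V X p show "\<exists>U \<phi> V \<psi> W. (U, \<phi>) \<in> charts M \<and> (V, \<psi>) \<in> charts K \<and>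
      openin (mtop M) W \<and> p \<in> W \<and> W \<subseteq> U \<and> (\<lambda>x. g (f x)) ` W \<subseteq> V \<and>
      Cinf_on (model M) (\<phi> ` W) (\<lambda>x. \<psi> (g (f (inv_into U \<phi> x))))"
    by (intro exI[of _ U] exI[of _ \<phi>] exI[of _ X] exI[of _ \<xi>] exI[of _ ?W]) auto
qed

lemma smooth_map_id:
  assumes "smooth_atlas M" shows "smooth_map M M (\<lambda>x. x)"
  using smooth_atlasD(4)[OF assms] by (intro smooth_mapI) auto

lemma smooth_map_const:
  assumes "c \<in> pts N" shows "smooth_map M N (\<lambda>x. c)"
  using assms by (intro smooth_mapI) (auto intro: Cinf_on_const)

section \<open>Open submanifolds\<close>

lemma open_submfd_simps [simp]:
  "mtop (open_submfd M W) = subtopology (mtop M) W" "model (open_submfd M W) = model M"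
  by (simp_all add: open_submfd_def)

lemma charts_open_submfd:
  "(U, \<phi>) \<in> charts (open_submfd M W) \<longleftrightarrow> (\<exists>U'. U = U' \<inter> W \<and> (U', \<phi>) \<in> charts M)"
  by (auto simp: open_submfd_def)

lemma inv_into_Int:
  assumes "inj_on \<phi> U" "x \<in> \<phi> ` (U \<inter> W)"
  shows "inv_into (U \<inter> W) \<phi> x = inv_into U \<phi> x"
  using assms by (auto simp: inv_into_f_f inj_on_Int)

lemma smooth_atlas_open_submfd:
  assumes M: "smooth_atlas M" and W: "openin (mtop M) W"
  shows "smooth_atlas (open_submfd M W)"
proof -
  have chart: "is_chart (open_submfd M W) (U \<inter> W) \<phi>" if "(U, \<phi>) \<in> charts M" for U \<phi>
  proof (rule is_chartI)
    note U = is_chartD[OF smooth_atlasD(2)[OF M that]]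
    have UW: "openin (mtop M) (U \<inter> W)" using U(1) W by blast
    show "openin (mtop (open_submfd M W)) (U \<inter> W)"
      using UW W by (simp add: openin_open_subtopology)
    show "openin (top_of_set (model (open_submfd M W))) (\<phi> ` (U \<inter> W))"
      using U(6)[OF UW] by simp
    have "homeomorphic_maps (subtopology (subtopology (mtop M) U) W)
        (subtopology (top_of_set (\<phi> ` U)) (\<phi> ` (U \<inter> W))) \<phi> (inv_into U \<phi>)"
      by (rule homeomorphic_maps_subtopologies[OF U(5)]) (use U(2) in auto)
    moreover have "\<phi> ` U \<inter> \<phi> ` (U \<inter> W) = \<phi> ` (U \<inter> W)" by auto
    ultimately show "homeomorphic_maps (subtopology (mtop (open_submfd M W)) (U \<inter> W))
        (top_of_set (\<phi> ` (U \<inter> W))) \<phi> (inv_into U \<phi>)"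
      by (simp add: subtopology_subtopology Int_ac)
  qed
  have compat: "Cinf_on (model M) (\<phi> ` ((U \<inter> W) \<inter> (V \<inter> W))) (\<lambda>x. \<psi> (inv_into (U \<inter> W) \<phi> x))"
    if c: "(U, \<phi>) \<in> charts M" "(V, \<psi>) \<in> charts M" for U \<phi> V \<psi>
  proof (rule Cinf_on_cong[OF Cinf_on_subset[OF smooth_atlasD(4)[OF M c]]])
    fix x assume "x \<in> \<phi> ` ((U \<inter> W) \<inter> (V \<inter> W))"
    then show "\<psi> (inv_into U \<phi> x) = \<psi> (inv_into (U \<inter> W) \<phi> x)"
      using inv_into_Int[of \<phi> U x W] is_chartD(3)[OF smooth_atlasD(2)[OF M c(1)]] by auto
  qed auto
  show ?thesis
  proof (rule smooth_atlasI)
    show "subspace (model (open_submfd M W))" using smooth_atlasD(1)[OF M] by simp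
    show "is_chart (open_submfd M W) U \<phi>" if "(U, \<phi>) \<in> charts (open_submfd M W)" for U \<phi>
      using that chart charts_open_submfd by metis
    fix p assume "p \<in> pts (open_submfd M W)"
    then have p: "p \<in> pts M" "p \<in> W" by auto
    then show "\<exists>U \<phi>. (U, \<phi>) \<in> charts (open_submfd M W) \<and> p \<in> U"
      using smooth_atlasD(3)[OF M p(1)] charts_open_submfd by (metis IntI)
  next
    fix U \<phi> V \<psi> assume "(U, \<phi>) \<in> charts (open_submfd M W)" "(V, \<psi>) \<in> charts (open_submfd M W)"
    then show "Cinf_on (model (open_submfd M W)) (\<phi> ` (U \<inter> V)) (\<lambda>x. \<psi> (inv_into U \<phi> x))"
      using compat unfolding charts_open_submfd by auto
  qed
qed

lemma smooth_map_restrict: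
  assumes M: "smooth_atlas M" and f: "smooth_map M N f"
  shows "smooth_map (open_submfd M W) N f"
proof (rule smooth_mapI)
  show "continuous_map (mtop (open_submfd M W)) (mtop N) f"
    using smooth_map_continuous[OF f] by (simp add: continuous_map_from_subtopology)
  fix U \<phi> V \<psi> assume "(U, \<phi>) \<in> charts (open_submfd M W)" and V: "(V, \<psi>) \<in> charts N"
  then obtain U' where U: "U = U' \<inter> W" "(U', \<phi>) \<in> charts M" using charts_open_submfd by metis
  have "Cinf_on (model M) (\<phi> ` (U \<inter> f -` V)) (\<lambda>x. \<psi> (f (inv_into U \<phi> x)))"
  proof (rule Cinf_on_cong[OF Cinf_on_subset[OF smooth_map_coordinates[OF f U(2) V]]])
    fix x assume "x \<in> \<phi> ` (U \<inter> f -` V)"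
    then show "\<psi> (f (inv_into U' \<phi> x)) = \<psi> (f (inv_into U \<phi> x))"
      using inv_into_Int[of \<phi> U' x W] is_chartD(3)[OF smooth_atlasD(2)[OF M U(2)]] U(1) by auto
  qed (use U in auto)
  then show "Cinf_on (model (open_submfd M W)) (\<phi> ` (U \<inter> f -` V)) (\<lambda>x. \<psi> (f (inv_into U \<phi> x)))"
    by simp
qed

lemma smooth_map_into_open_submfd:
  assumes f: "smooth_map M N f" and W: "f ` pts M \<subseteq> W"
  shows "smooth_map M (open_submfd N W) f"
proof (rule smooth_mapI)
  show "continuous_map (mtop M) (mtop (open_submfd N W)) f"
    using smooth_map_continuous[OF f] W by (auto simp: continuous_map_in_subtopology)
  fix U \<phi> V \<psi> assume c: "(U, \<phi>) \<in> charts M" "(V, \<psi>) \<in> charts (open_submfd N W)"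
  then obtain V' where V: "V = V' \<inter> W" "(V', \<psi>) \<in> charts N" using charts_open_submfd by metis
  show "Cinf_on (model M) (\<phi> ` (U \<inter> f -` V)) (\<lambda>x. \<psi> (f (inv_into U \<phi> x)))"
    by (rule Cinf_on_subset[OF smooth_map_coordinates[OF f c(1) V(2)]]) (use V in auto)
qed

lemma smooth_map_from_open_submfd:
  assumes "smooth_atlas M" "smooth_atlas N" "openin (mtop N) W" "smooth_map M (open_submfd N W) f"
  shows "smooth_map M N f"
  using smooth_map_compose[OF assms(1) smooth_atlas_open_submfd[OF assms(2,3)] assms(2,4)
      smooth_map_restrict[OF assms(2) smooth_map_id[OF assms(2)]]] .

lemma smooth_map_local:
  assumes M: "smooth_atlas M" and N: "smooth_atlas N"
    and loc: "\<And>p. p \<in> pts M \<Longrightarrow> \<exists>W. openin (mtop M) W \<and> p \<in> W \<and> smooth_map (open_submfd M W) N f"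
  shows "smooth_map M N f"
proof (rule smooth_mapI_local[OF M N])
  have inN: "f p \<in> pts N" if p: "p \<in> pts M" for p
    using loc[OF p] smooth_map_in_pts p by fastforce
  show "continuous_map (mtop M) (mtop N) f"
    unfolding continuous_map_def
  proof (intro conjI allI impI)
    show "f \<in> pts M \<rightarrow> pts N" using inN by blast
    fix V assume V: "openin (mtop N) V"
    show "openin (mtop M) {x \<in> pts M. f x \<in> V}"
    proof (subst openin_subopen, intro ballI)
      fix p assume "p \<in> {x \<in> pts M. f x \<in> V}"
      then have p: "p \<in> pts M" "f p \<in> V" by auto
      obtain W where W: "openin (mtop M) W" "p \<in> W" "smooth_map (open_submfd M W) N f"
        using loc[OF p(1)] by blast
      have "openin (subtopology (mtop M) W) {x \<in> topspace (subtopology (mtop M) W). f x \<in> V}"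
        using openin_continuous_map_preimage[OF smooth_map_continuous[OF W(3)] V] by simp
      then have "openin (mtop M) {x \<in> topspace (subtopology (mtop M) W). f x \<in> V}"
        using W(1) openin_trans_full by blast
      then show "\<exists>T. openin (mtop M) T \<and> p \<in> T \<and> T \<subseteq> {x \<in> pts M. f x \<in> V}"
        using p W(2)
        by (intro exI[of _ "{x \<in> topspace (subtopology (mtop M) W). f x \<in> V}"] conjI) auto
    qed
  qed
  fix p assume p: "p \<in> pts M"
  obtain W where W: "openin (mtop M) W" "p \<in> W" "smooth_map (open_submfd M W) N f"
    using loc[OF p] by blast
  obtain U \<phi> where U: "(U, \<phi>) \<in> charts M" "p \<in> U" using smooth_atlasD(3)[OF M p] by blast
  obtain V \<psi> where V: "(V, \<psi>) \<in> charts N" "f p \<in> V" using smooth_atlasD(3)[OF N inN[OF p]] by blast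
  note U' = is_chartD[OF smooth_atlasD(2)[OF M U(1)]]
  note V' = is_chartD[OF smooth_atlasD(2)[OF N V(1)]]
  have UW: "(U \<inter> W, \<phi>) \<in> charts (open_submfd M W)" using U charts_open_submfd by metis
  have "openin (mtop (open_submfd M W)) (U \<inter> W)"
    using U'(1) W(1) by (simp add: openin_open_subtopology openin_Int)
  then have "openin (mtop (open_submfd M W)) (U \<inter> W \<inter> f -` V)"
    by (rule openin_vimage_chart_domain[OF smooth_map_continuous[OF W(3)] _ V'(1)])
  then have op: "openin (mtop M) (U \<inter> W \<inter> f -` V)"
    using W(1) by (simp add: openin_open_subtopology)
  have "Cinf_on (model M) (\<phi> ` (U \<inter> W \<inter> f -` V)) (\<lambda>x. \<psi> (f (inv_into U \<phi> x)))"
    by (rule Cinf_on_cong[OF smooth_map_coordinates[OF W(3) UW V(1), simplified]])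
      (use U'(3) in \<open>auto simp: inv_into_f_f inj_on_Int\<close>)
  with op U V W(2) show "\<exists>U \<phi> V \<psi> W. (U, \<phi>) \<in> charts M \<and> (V, \<psi>) \<in> charts N \<and>
      openin (mtop M) W \<and> p \<in> W \<and> W \<subseteq> U \<and> f ` W \<subseteq> V \<and>
      Cinf_on (model M) (\<phi> ` W) (\<lambda>x. \<psi> (f (inv_into U \<phi> x)))"
    by (intro exI[of _ U] exI[of _ \<phi>] exI[of _ V] exI[of _ \<psi>] exI[of _ "U \<inter> W \<inter> f -` V"]) auto
qed

section \<open>Products\<close>

lemma prod_mfd_simps [simp]:
  "mtop (prod_mfd M N) = prod_topology (mtop M) (mtop N)"
  "model (prod_mfd M N) = model M \<times> model N"
  by (simp_all add: prod_mfd_def)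

lemma charts_prod_mfdE:
  assumes "(X, \<xi>) \<in> charts (prod_mfd M N)"
  obtains U \<phi> V \<psi> where "X = U \<times> V" "\<xi> = map_prod \<phi> \<psi>" "(U, \<phi>) \<in> charts M" "(V, \<psi>) \<in> charts N"
  using assms by (auto simp: prod_mfd_def)

lemma charts_prod_mfdI:
  "(U, \<phi>) \<in> charts M \<Longrightarrow> (V, \<psi>) \<in> charts N \<Longrightarrow> (U \<times> V, map_prod \<phi> \<psi>) \<in> charts (prod_mfd M N)"
  by (auto simp: prod_mfd_def)

lemma inv_into_map_prod:
  assumes "inj_on \<phi> U" "inj_on \<psi> V" "x \<in> \<phi> ` U" "y \<in> \<psi> ` V"
  shows "inv_into (U \<times> V) (map_prod \<phi> \<psi>) (x, y) = (inv_into U \<phi> x, inv_into V \<psi> y)"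
proof -
  obtain u v where uv: "u \<in> U" "x = \<phi> u" "v \<in> V" "y = \<psi> v" using assms by blast
  have "inv_into (U \<times> V) (map_prod \<phi> \<psi>) (map_prod \<phi> \<psi> (u, v)) = (u, v)"
    using uv assms(1,2) by (intro inv_into_f_f map_prod_inj_on) auto
  then show ?thesis using uv assms(1,2) by (simp add: inv_into_f_f)
qed

lemma subspace_product: "subspace V \<Longrightarrow> subspace W \<Longrightarrow> subspace (V \<times> W)"
  by (auto simp: subspace_def zero_prod_def)

lemma Cinf_on_fst_comp:
  assumes "subspace V" "subspace W" "S \<subseteq> V" "T \<subseteq> W" "Cinf_on V S f"
  shows "Cinf_on (V \<times> W) (S \<times> T) (\<lambda>z. f (fst z))"
  by (rule Cinf_on_compose[OF subspace_product[OF assms(1,2)] assms(1) _ assms(3) _ Cinf_on_linear assms(5)])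
    (use assms in \<open>auto intro: linear_fst\<close>)

lemma Cinf_on_snd_comp:
  assumes "subspace V" "subspace W" "S \<subseteq> V" "T \<subseteq> W" "Cinf_on W T f"
  shows "Cinf_on (V \<times> W) (S \<times> T) (\<lambda>z. f (snd z))"
  by (rule Cinf_on_compose[OF subspace_product[OF assms(1,2)] assms(2) _ assms(4) _ Cinf_on_linear assms(5)])
    (use assms in \<open>auto intro: linear_snd\<close>)

lemma chart_image_subset:
  "smooth_atlas M \<Longrightarrow> (U, \<phi>) \<in> charts M \<Longrightarrow> \<phi> ` U \<subseteq> model M"
  using is_chartD(4)[OF smooth_atlasD(2)] openin_imp_subset by blast

lemma smooth_atlas_prod_mfd:
  fixes M :: "('a, 'e::euclidean_space) mfd" and N :: "('b, 'f::euclidean_space) mfd"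
  assumes M: "smooth_atlas M" and N: "smooth_atlas N"
  shows "smooth_atlas (prod_mfd M N)"
proof (rule smooth_atlasI)
  show "subspace (model (prod_mfd M N))"
    using M N by (simp add: subspace_product smooth_atlasD(1))
  fix X \<xi> assume "(X, \<xi>) \<in> charts (prod_mfd M N)"
  then obtain U \<phi> V \<psi> where X: "X = U \<times> V" "\<xi> = map_prod \<phi> \<psi>"
    and c: "(U, \<phi>) \<in> charts M" "(V, \<psi>) \<in> charts N" by (rule charts_prod_mfdE)
  note U = is_chartD[OF smooth_atlasD(2)[OF M c(1)]]
  note V = is_chartD[OF smooth_atlasD(2)[OF N c(2)]]
  have im: "\<xi> ` X = \<phi> ` U \<times> \<psi> ` V" unfolding X by (auto simp: map_prod_surj_on)
  show "is_chart (prod_mfd M N) X \<xi>"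
  proof (rule is_chartI)
    show "openin (mtop (prod_mfd M N)) X"
      using U(1) V(1) by (simp add: X openin_prod_Times_iff)
    show "openin (top_of_set (model (prod_mfd M N))) (\<xi> ` X)"
      using U(4) V(4) by (simp add: im openin_Times)
    have "homeomorphic_maps (prod_topology (subtopology (mtop M) U) (subtopology (mtop N) V))
       (prod_topology (top_of_set (\<phi> ` U)) (top_of_set (\<psi> ` V)))
       (\<lambda>(x, y). (\<phi> x, \<psi> y)) (\<lambda>(x, y). (inv_into U \<phi> x, inv_into V \<psi> y))"
      using U(5) V(5) homeomorphic_maps_prod by blast
    then show "homeomorphic_maps (subtopology (mtop (prod_mfd M N)) X) (top_of_set (\<xi> ` X)) \<xi>
        (\<lambda>(x, y). (inv_into U \<phi> x, inv_into V \<psi> y))"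
      unfolding im by (simp add: X(1) X(2) subtopology_Times map_prod_def)
  qed
  fix X' \<xi>' assume "(X', \<xi>') \<in> charts (prod_mfd M N)"
  then obtain U' \<phi>' V' \<psi>' where X': "X' = U' \<times> V'" "\<xi>' = map_prod \<phi>' \<psi>'"
    and c': "(U', \<phi>') \<in> charts M" "(V', \<psi>') \<in> charts N" by (rule charts_prod_mfdE)
  have sub: "\<phi> ` (U \<inter> U') \<subseteq> model M" "\<psi> ` (V \<inter> V') \<subseteq> model N"
    using chart_image_subset M N c by blast+
  note sp = smooth_atlasD(1)[OF M] smooth_atlasD(1)[OF N]
  have "Cinf_on (model M \<times> model N) (\<phi> ` (U \<inter> U') \<times> \<psi> ` (V \<inter> V'))
      (\<lambda>z. (\<phi>' (inv_into U \<phi> (fst z)), \<psi>' (inv_into V \<psi> (snd z))))"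
    by (intro Cinf_on_Pair Cinf_on_fst_comp[OF sp sub] Cinf_on_snd_comp[OF sp sub]
        smooth_atlasD(4)[OF M c(1) c'(1)] smooth_atlasD(4)[OF N c(2) c'(2)])
  then have "Cinf_on (model M \<times> model N) (\<phi> ` (U \<inter> U') \<times> \<psi> ` (V \<inter> V')) (\<lambda>z. \<xi>' (inv_into X \<xi> z))"
  proof (rule Cinf_on_cong)
    fix z assume "z \<in> \<phi> ` (U \<inter> U') \<times> \<psi> ` (V \<inter> V')"
    then show "(\<phi>' (inv_into U \<phi> (fst z)), \<psi>' (inv_into V \<psi> (snd z))) = \<xi>' (inv_into X \<xi> z)"
      using inv_into_map_prod[OF U(3) V(3), of "fst z" "snd z"] by (auto simp: X X')
  qed
  moreover have "\<xi> ` (X \<inter> X') = \<phi> ` (U \<inter> U') \<times> \<psi> ` (V \<inter> V')"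
    by (simp add: X X' Times_Int_Times map_prod_surj_on)
  ultimately show "Cinf_on (model (prod_mfd M N)) (\<xi> ` (X \<inter> X')) (\<lambda>x. \<xi>' (inv_into X \<xi> x))"
    by simp
next
  fix p assume "p \<in> pts (prod_mfd M N)"
  then obtain x y where p: "p = (x, y)" "x \<in> pts M" "y \<in> pts N" by auto
  obtain U \<phi> where "(U, \<phi>) \<in> charts M" "x \<in> U" using smooth_atlasD(3)[OF M p(2)] by blast
  moreover obtain V \<psi> where "(V, \<psi>) \<in> charts N" "y \<in> V" using smooth_atlasD(3)[OF N p(3)] by blast
  ultimately show "\<exists>X \<xi>. (X, \<xi>) \<in> charts (prod_mfd M N) \<and> p \<in> X"
    using charts_prod_mfdI p(1) by blast
qed

lemma second_countable_prod_topology: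
  assumes "second_countable_top X" "second_countable_top Y"
  shows "second_countable_top (prod_topology X Y)"
proof -
  obtain B where B: "countable B" "\<forall>b\<in>B. openin X b"
    "\<forall>U. openin X U \<longrightarrow> (\<exists>\<U>\<subseteq>B. U = \<Union>\<U>)"
    using assms(1) unfolding second_countable_top_def by blast
  obtain C where C: "countable C" "\<forall>b\<in>C. openin Y b"
    "\<forall>U. openin Y U \<longrightarrow> (\<exists>\<U>\<subseteq>C. U = \<Union>\<U>)"
    using assms(2) unfolding second_countable_top_def by blast
  let ?D = "(\<lambda>(b, c). b \<times> c) ` (B \<times> C)"
  have "\<exists>\<U>\<subseteq>?D. W = \<Union>\<U>" if W: "openin (prod_topology X Y) W" for W
  proof (intro exI conjI)
    show "{d \<in> ?D. d \<subseteq> W} \<subseteq> ?D" by blast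
    show "W = \<Union>{d \<in> ?D. d \<subseteq> W}"
    proof (intro equalityI subsetI)
      fix z assume "z \<in> W"
      then obtain x y U V where z: "z = (x, y)" "openin X U" "openin Y V" "x \<in> U" "y \<in> V" "U \<times> V \<subseteq> W"
        using W unfolding openin_prod_topology_alt by (metis surj_pair)
      obtain b where b: "b \<in> B" "x \<in> b" "b \<subseteq> U" using B(3) z(2,4) by (metis Sup_upper UnionE subset_iff)
      obtain c where c: "c \<in> C" "y \<in> c" "c \<subseteq> V" using C(3) z(3,5) by (metis Sup_upper UnionE subset_iff)
      have "b \<times> c \<in> {d \<in> ?D. d \<subseteq> W}" using b c z(6) by blast
      then show "z \<in> \<Union>{d \<in> ?D. d \<subseteq> W}" using z(1) b c by blast
    qed auto
  qed
  moreover have "countable ?D" using B(1) C(1) by auto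
  moreover have "\<forall>d\<in>?D. openin (prod_topology X Y) d"
    using B(2) C(2) by (auto simp: openin_prod_Times_iff)
  ultimately show ?thesis unfolding second_countable_top_def by blast
qed

lemma smooth_manifold_prod_mfd:
  assumes "smooth_manifold M" "smooth_manifold N"
  shows "smooth_manifold (prod_mfd M N)"
  using assms unfolding smooth_manifold_iff
  by (simp add: Hausdorff_space_prod_topology second_countable_prod_topology smooth_atlas_prod_mfd)

lemma smooth_map_fst:
  assumes M: "smooth_atlas M" and N: "smooth_atlas N"
  shows "smooth_map (prod_mfd M N) M fst"
proof (rule smooth_mapI)
  show "continuous_map (mtop (prod_mfd M N)) (mtop M) fst" by (simp add: continuous_map_fst)
  fix X \<xi> U' \<phi>' assume "(X, \<xi>) \<in> charts (prod_mfd M N)" and c': "(U', \<phi>') \<in> charts M"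
  then obtain U \<phi> V \<psi> where X: "X = U \<times> V" "\<xi> = map_prod \<phi> \<psi>"
    and c: "(U, \<phi>) \<in> charts M" "(V, \<psi>) \<in> charts N" by (elim charts_prod_mfdE)
  note U = is_chartD[OF smooth_atlasD(2)[OF M c(1)]]
  note V = is_chartD[OF smooth_atlasD(2)[OF N c(2)]]
  have sub: "\<phi> ` (U \<inter> U') \<subseteq> model M" "\<psi> ` V \<subseteq> model N"
    using chart_image_subset M N c by blast+
  have "Cinf_on (model M \<times> model N) (\<phi> ` (U \<inter> U') \<times> \<psi> ` V) (\<lambda>z. \<phi>' (inv_into U \<phi> (fst z)))"
    by (intro Cinf_on_fst_comp[OF smooth_atlasD(1)[OF M] smooth_atlasD(1)[OF N] sub]
        smooth_atlasD(4)[OF M c(1) c'])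
  then have "Cinf_on (model M \<times> model N) (\<phi> ` (U \<inter> U') \<times> \<psi> ` V) (\<lambda>z. \<phi>' (fst (inv_into X \<xi> z)))"
  proof (rule Cinf_on_cong)
    fix z assume "z \<in> \<phi> ` (U \<inter> U') \<times> \<psi> ` V"
    then show "\<phi>' (inv_into U \<phi> (fst z)) = \<phi>' (fst (inv_into X \<xi> z))"
      using inv_into_map_prod[OF U(3) V(3), of "fst z" "snd z"] by (auto simp: X)
  qed
  moreover have "\<xi> ` (X \<inter> fst -` U') = \<phi> ` (U \<inter> U') \<times> \<psi> ` V"
    by (auto simp: X image_iff)
  ultimately show "Cinf_on (model (prod_mfd M N)) (\<xi> ` (X \<inter> fst -` U')) (\<lambda>x. \<phi>' (fst (inv_into X \<xi> x)))"
    by simp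
qed

lemma smooth_map_snd:
  assumes M: "smooth_atlas M" and N: "smooth_atlas N"
  shows "smooth_map (prod_mfd M N) N snd"
proof (rule smooth_mapI)
  show "continuous_map (mtop (prod_mfd M N)) (mtop N) snd" by (simp add: continuous_map_snd)
  fix X \<xi> V' \<psi>' assume "(X, \<xi>) \<in> charts (prod_mfd M N)" and c': "(V', \<psi>') \<in> charts N"
  then obtain U \<phi> V \<psi> where X: "X = U \<times> V" "\<xi> = map_prod \<phi> \<psi>"
    and c: "(U, \<phi>) \<in> charts M" "(V, \<psi>) \<in> charts N" by (elim charts_prod_mfdE)
  note U = is_chartD[OF smooth_atlasD(2)[OF M c(1)]]
  note V = is_chartD[OF smooth_atlasD(2)[OF N c(2)]]
  have sub: "\<phi> ` U \<subseteq> model M" "\<psi> ` (V \<inter> V') \<subseteq> model N"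
    using chart_image_subset M N c by blast+
  have "Cinf_on (model M \<times> model N) (\<phi> ` U \<times> \<psi> ` (V \<inter> V')) (\<lambda>z. \<psi>' (inv_into V \<psi> (snd z)))"
    by (intro Cinf_on_snd_comp[OF smooth_atlasD(1)[OF M] smooth_atlasD(1)[OF N] sub]
        smooth_atlasD(4)[OF N c(2) c'])
  then have "Cinf_on (model M \<times> model N) (\<phi> ` U \<times> \<psi> ` (V \<inter> V')) (\<lambda>z. \<psi>' (snd (inv_into X \<xi> z)))"
  proof (rule Cinf_on_cong)
    fix z assume "z \<in> \<phi> ` U \<times> \<psi> ` (V \<inter> V')"
    then show "\<psi>' (inv_into V \<psi> (snd z)) = \<psi>' (snd (inv_into X \<xi> z))"
      using inv_into_map_prod[OF U(3) V(3), of "fst z" "snd z"] by (auto simp: X)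
  qed
  moreover have "\<xi> ` (X \<inter> snd -` V') = \<phi> ` U \<times> \<psi> ` (V \<inter> V')"
    by (auto simp: X image_iff)
  ultimately show "Cinf_on (model (prod_mfd M N)) (\<xi> ` (X \<inter> snd -` V')) (\<lambda>x. \<psi>' (snd (inv_into X \<xi> x)))"
    by simp
qed

lemma smooth_map_Pair:
  assumes f: "smooth_map M N f" and g: "smooth_map M K g"
  shows "smooth_map M (prod_mfd N K) (\<lambda>x. (f x, g x))"
proof (rule smooth_mapI)
  show "continuous_map (mtop M) (mtop (prod_mfd N K)) (\<lambda>x. (f x, g x))"
    using f g by (simp add: continuous_map_paired smooth_map_continuous)
  fix U \<phi> X \<xi> assume c: "(U, \<phi>) \<in> charts M" and "(X, \<xi>) \<in> charts (prod_mfd N K)"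
  then obtain V \<psi> V' \<psi>' where X: "X = V \<times> V'" "\<xi> = map_prod \<psi> \<psi>'"
    and c': "(V, \<psi>) \<in> charts N" "(V', \<psi>') \<in> charts K" by (elim charts_prod_mfdE)
  show "Cinf_on (model M) (\<phi> ` (U \<inter> (\<lambda>x. (f x, g x)) -` X))
      (\<lambda>x. \<xi> (f (inv_into U \<phi> x), g (inv_into U \<phi> x)))"
    unfolding X map_prod_simp
    by (intro Cinf_on_Pair Cinf_on_subset[OF smooth_map_coordinates[OF f c c'(1)]]
        Cinf_on_subset[OF smooth_map_coordinates[OF g c c'(2)]]) auto
qed

section \<open>Smooth maps on subsets\<close>

lemma smooth_on_subset_if_smooth_map:
  assumes "smooth_atlas M" "smooth_map M N f" "A \<subseteq> pts M"
  shows "smooth_on_subset M A N f"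
  unfolding smooth_on_subset_def
proof (intro conjI ballI exI)
  show "f \<in> A \<rightarrow> pts N" using smooth_map_in_pts[OF assms(2)] assms(3) by auto
  show "smooth_map (open_submfd M (pts M)) N f" by (rule smooth_map_restrict[OF assms(1,2)])
qed (use assms(3) in auto)

text \<open>
  The composition of a Lie groupoid is smooth only as a map on the set of composable pairs. In this
  form its smoothness can be used for composites of smooth maps.
\<close>

lemma smooth_map_compose_smooth_on_subset:
  assumes M: "smooth_atlas M" and N: "smooth_atlas N" and K: "smooth_atlas K"
    and f: "smooth_map M N f" and A: "f ` pts M \<subseteq> A" and g: "smooth_on_subset N A K g"
  shows "smooth_map M K (\<lambda>x. g (f x))"
proof (rule smooth_map_local[OF M K])
  fix p assume p: "p \<in> pts M"
  then have "f p \<in> A" using A by blast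
  then obtain W F where W: "openin (mtop N) W" "f p \<in> W" "smooth_map (open_submfd N W) K F"
    "\<forall>q\<in>A \<inter> W. F q = g q"
    using g unfolding smooth_on_subset_def by blast
  let ?O = "pts M \<inter> f -` W"
  have O: "openin (mtop M) ?O"
    by (rule openin_vimage_chart_domain[OF smooth_map_continuous[OF f] openin_topspace W(1)])
  have MO: "smooth_atlas (open_submfd M ?O)" by (rule smooth_atlas_open_submfd[OF M O])
  have "smooth_map (open_submfd M ?O) (open_submfd N W) f"
    by (rule smooth_map_into_open_submfd[OF smooth_map_restrict[OF M f]]) auto
  then have "smooth_map (open_submfd M ?O) K (\<lambda>x. F (f x))"
    by (rule smooth_map_compose[OF MO smooth_atlas_open_submfd[OF N W(1)] K _ W(3)])
  then have "smooth_map (open_submfd M ?O) K (\<lambda>x. g (f x))"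
    by (rule smooth_map_cong[OF MO]) (use W(4) A in auto)
  then show "\<exists>W. openin (mtop M) W \<and> p \<in> W \<and> smooth_map (open_submfd M W) K (\<lambda>x. g (f x))"
    using O p W(2) by blast
qed

section \<open>Submersions and embeddings\<close>

text \<open>
  Let \<open>B\<close> be a linear right inverse of the differential \<open>D\<close>. On the affine slice
  \<open>w \<mapsto> x0 + B (w - f x0)\<close> the map \<open>f\<close> has the identity as its differential; inverting it there gives
  the section.
\<close>

theorem Cinf_on_local_section:
  fixes f :: "'a::euclidean_space \<Rightarrow> 'b::euclidean_space"
  assumes V: "subspace V" and W: "subspace W" and S: "openin (top_of_set V) S" "x0 \<in> S"
    and f: "Cinf_on V S f" "f ` S \<subseteq> W"
    and D: "(f has_derivative D) (at x0 within S)" "D ` V = W"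
  obtains T s where "openin (top_of_set W) T" "f x0 \<in> T" "Cinf_on W T s" "s ` T \<subseteq> S"
    "s (f x0) = x0" "\<forall>y\<in>T. f (s y) = y"
proof -
  have "linear D" using D(1) has_derivative_linear by blast
  then obtain B where B: "range B \<subseteq> V" "linear B" "\<forall>w\<in>W. D (B w) = w"
    using linear_exists_right_inverse_on[OF _ V, of D] D(2) by auto
  have blB: "bounded_linear B" using B(2) linear_conv_bounded_linear by blast
  define k where "k w = x0 + B (w - f x0)" for w
  have SV: "S \<subseteq> V" using S openin_imp_subset by blast
  have kV: "k w \<in> V" for w
    unfolding k_def using SV S(2) B(1) subspace_add[OF V] by blast
  define U where "U = W \<inter> k -` S"
  have Ck: "Cinf_on W' T (\<lambda>w. k (g w))" if "Cinf_on W' T g" for W' T and g :: "'b \<Rightarrow> 'b"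
    unfolding k_def diff_conv_add_uminus
    by (intro Cinf_on_add Cinf_on_const Cinf_on_linear_comp[OF B(2)] that)
  have y0: "f x0 \<in> U"
    using S(2) f(2) linear_0[OF B(2)] by (auto simp: U_def k_def)
  have op: "openin (top_of_set W) U"
  proof -
    obtain X where X: "open X" "S = V \<inter> X" using S(1) openin_open by blast
    have "U = W \<inter> k -` X" using kV X(2) by (auto simp: U_def)
    moreover have "open (k -` X)"
      using X(1) unfolding k_def
      by (intro continuous_open_vimage continuous_intros)
       (auto intro!: continuous_intros bounded_linear.continuous[OF blB])
    ultimately show ?thesis by (simp add: openin_open_Int)
  qed
  have UW: "U \<subseteq> W" "k ` U \<subseteq> S" by (auto simp: U_def)
  have Ch: "Cinf_on W U (\<lambda>w. f (k w))"
    by (rule Cinf_on_compose[OF W V UW(1) SV UW(2) _ f(1)]) (intro Ck Cinf_on_linear linear_ident)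
  have "(k has_derivative B) (at (f x0) within U)"
    unfolding k_def
    by (auto intro!: derivative_eq_intros bounded_linear.has_derivative[OF blB])
  moreover have "k (f x0) = x0" using linear_0[OF B(2)] by (simp add: k_def)
  ultimately have der: "((\<lambda>w. f (k w)) has_derivative (\<lambda>w. D (B w))) (at (f x0) within U)"
    using has_derivative_in_compose[where f = k and g = f and g' = D] has_derivative_subset[OF D(1) UW(2)]
    by simp
  have im: "(\<lambda>w. f (k w)) ` U \<subseteq> W" using f(2) UW(2) by blast
  obtain T g where T: "openin (top_of_set W) T" "f x0 \<in> T" "T \<subseteq> U"
    "openin (top_of_set W) ((\<lambda>w. f (k w)) ` T)" "Cinf_on W ((\<lambda>w. f (k w)) ` T) g"
    "\<forall>w\<in>T. g (f (k w)) = w"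
  proof (rule Cinf_on_inverse_function[OF W op y0 Ch im der])
    show "D (B w) = w" if "w \<in> W" for w using B(3) that by blast
  qed blast
  have kx0: "k (f x0) = x0" using linear_0[OF B(2)] by (simp add: k_def)
  show ?thesis
  proof
    show "openin (top_of_set W) ((\<lambda>w. f (k w)) ` T)" by (rule T)
    show "f x0 \<in> (\<lambda>w. f (k w)) ` T" using T(2) kx0 by (metis image_eqI)
    show "Cinf_on W ((\<lambda>w. f (k w)) ` T) (\<lambda>y. k (g y))" by (rule Ck[OF T(5)])
    show "(\<lambda>y. k (g y)) ` (\<lambda>w. f (k w)) ` T \<subseteq> S"
    proof clarify
      fix w assume w: "w \<in> T"
      then have "g (f (k w)) = w" "k w \<in> S" using T(3,6) UW(2) by blast+
      then show "k (g (f (k w))) \<in> S" by simp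
    qed
    show "k (g (f x0)) = x0" using T(2,6) kx0 by metis
    show "\<forall>y\<in>(\<lambda>w. f (k w)) ` T. f (k (g y)) = y" using T(6) by auto
  qed
qed

text \<open>
  Dually, if \<open>L\<close> is a linear left inverse of the differential, then \<open>L \<circ> f\<close> has the identity as its
  differential, and its local inverse composed with \<open>L\<close> is a retraction.
\<close>

theorem Cinf_on_local_retraction:
  fixes f :: "'a::euclidean_space \<Rightarrow> 'b::euclidean_space"
  assumes V: "subspace V" and W: "subspace W" and S: "openin (top_of_set V) S" "x0 \<in> S"
    and f: "Cinf_on V S f" "f ` S \<subseteq> W"
    and D: "(f has_derivative D) (at x0 within S)" "inj_on D V"
  obtains X R r where "openin (top_of_set V) X" "x0 \<in> X" "X \<subseteq> S" "openin (top_of_set W) R"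
    "f ` X \<subseteq> R" "Cinf_on W R r" "r ` R \<subseteq> X" "\<forall>x\<in>X. r (f x) = x"
proof -
  have "linear D" using D(1) has_derivative_linear by blast
  then obtain L where L: "range L \<subseteq> V" "linear L" "\<forall>v\<in>V. L (D v) = v"
    using linear_exists_left_inverse_on[OF _ V D(2)] by auto
  have blL: "bounded_linear L" using L(2) linear_conv_bounded_linear by blast
  let ?h = "\<lambda>x. L (f x)"
  have im: "?h ` S \<subseteq> V" using L(1) by blast
  have der: "(?h has_derivative (\<lambda>v. L (D v))) (at x0 within S)"
    using bounded_linear.has_derivative[OF blL D(1)] .
  obtain T g where T: "openin (top_of_set V) T" "x0 \<in> T" "T \<subseteq> S"
    "openin (top_of_set V) (?h ` T)" "Cinf_on V (?h ` T) g" "\<forall>w\<in>T. g (?h w) = w"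
  proof (rule Cinf_on_inverse_function[OF V S Cinf_on_linear_comp[OF L(2) f(1)] im der])
    show "L (D v) = v" if "v \<in> V" for v using L(3) that by blast
  qed blast
  let ?R = "W \<inter> L -` (?h ` T)"
  have op: "openin (top_of_set W) ?R"
    using open_projection_vimage[OF L(2,1) T(4)] by (simp add: openin_open_Int)
  have TV: "?h ` T \<subseteq> V" using L(1) by blast
  have C: "Cinf_on W ?R (\<lambda>w. g (L w))"
    by (rule Cinf_on_compose[OF W V _ TV _ Cinf_on_linear[OF L(2)] T(5)]) auto
  show ?thesis
    by (rule that[OF T(1-3) op _ C]) (use T(3,6) f(2) in auto)
qed

lemma smooth_map_from_coordinates:
  fixes M :: "('a, 'e::euclidean_space) mfd" and N :: "('b, 'f::euclidean_space) mfd"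
  assumes M: "smooth_atlas M" and N: "smooth_atlas N"
    and c: "(U, \<phi>) \<in> charts M" "(V, \<psi>) \<in> charts N"
    and T: "openin (top_of_set (model M)) T" "T \<subseteq> \<phi> ` U"
    and h: "Cinf_on (model M) T h" "h ` T \<subseteq> \<psi> ` V"
  shows "openin (mtop M) (U \<inter> \<phi> -` T)"
    and "smooth_map (open_submfd M (U \<inter> \<phi> -` T)) N (\<lambda>p. inv_into V \<psi> (h (\<phi> p)))"
proof -
  note U = is_chartD[OF smooth_atlasD(2)[OF M c(1)]]
  note V = is_chartD[OF smooth_atlasD(2)[OF N c(2)]]
  let ?O = "U \<inter> \<phi> -` T"
  show O: "openin (mtop M) ?O" using U(7)[OF T(1)] .
  have OT: "\<phi> ` ?O = T" using T(2) by blast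
  show "smooth_map (open_submfd M ?O) N (\<lambda>p. inv_into V \<psi> (h (\<phi> p)))"
  proof (rule smooth_mapI_local[OF smooth_atlas_open_submfd[OF M O] N])
    have "continuous_map (subtopology (mtop M) U) (top_of_set (\<phi> ` U)) \<phi>"
      using U(5) by (simp add: homeomorphic_maps_def)
    then have c1: "continuous_map (subtopology (mtop M) ?O) (top_of_set T) \<phi>"
      unfolding continuous_map_in_subtopology using continuous_map_from_subtopology_mono by fastforce
    have "continuous_on T h" using h(1) by (metis Cinf_on_def Ck_on.simps(1))
    then have c2: "continuous_map (top_of_set T) (top_of_set (\<psi> ` V)) h"
      using h(2) by (auto simp: continuous_map_in_subtopology)
    have c3: "continuous_map (top_of_set (\<psi> ` V)) (mtop N) (inv_into V \<psi>)"
      using V(5) continuous_map_into_fulltopology by (auto simp: homeomorphic_maps_def)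
    show "continuous_map (mtop (open_submfd M ?O)) (mtop N) (\<lambda>p. inv_into V \<psi> (h (\<phi> p)))"
      using continuous_map_compose[OF continuous_map_compose[OF c1 c2] c3] by (simp add: comp_def)
    fix p assume "p \<in> pts (open_submfd M ?O)"
    then have p: "p \<in> ?O" by simp
    have "(U \<inter> ?O, \<phi>) \<in> charts (open_submfd M ?O)" using c(1) charts_open_submfd by metis
    moreover have "U \<inter> ?O = ?O" by blast
    ultimately have ch: "(?O, \<phi>) \<in> charts (open_submfd M ?O)" by simp
    have "Cinf_on (model M) (\<phi> ` ?O) (\<lambda>x. \<psi> (inv_into V \<psi> (h (\<phi> (inv_into ?O \<phi> x)))))"
    proof (rule Cinf_on_cong)
      show "Cinf_on (model M) (\<phi> ` ?O) h" using h(1) OT by simp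
      fix x assume x: "x \<in> \<phi> ` ?O"
      then have "h x \<in> \<psi> ` V" using h(2) OT by blast
      then show "h x = \<psi> (inv_into V \<psi> (h (\<phi> (inv_into ?O \<phi> x))))"
        using f_inv_into_f[OF x] by (simp add: f_inv_into_f)
    qed
    moreover have "(\<lambda>p. inv_into V \<psi> (h (\<phi> p))) ` ?O \<subseteq> V"
    proof clarify
      fix q assume "q \<in> U" "\<phi> q \<in> T"
      then have "h (\<phi> q) \<in> \<psi> ` V" using h(2) by blast
      then show "inv_into V \<psi> (h (\<phi> q)) \<in> V" by (rule inv_into_into)
    qed
    moreover have "openin (mtop (open_submfd M ?O)) ?O"
      using O by (simp add: openin_open_subtopology)
    ultimately show "\<exists>U' \<phi>' V' \<psi>' W. (U', \<phi>') \<in> charts (open_submfd M ?O) \<and> (V', \<psi>') \<in> charts N \<and>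
      openin (mtop (open_submfd M ?O)) W \<and> p \<in> W \<and> W \<subseteq> U' \<and> (\<lambda>p. inv_into V \<psi> (h (\<phi> p))) ` W \<subseteq> V' \<and>
      Cinf_on (model (open_submfd M ?O)) (\<phi>' ` W) (\<lambda>x. \<psi>' (inv_into V \<psi> (h (\<phi> (inv_into U' \<phi>' x)))))"
      using ch c(2) p
      by (intro exI[of _ ?O] exI[of _ \<phi>] exI[of _ V] exI[of _ \<psi>]) simp
  qed
qed

context
  fixes M :: "('a, 'e::euclidean_space) mfd" and N :: "('b, 'f::euclidean_space) mfd" and f U \<phi> V \<psi>
  assumes M: "smooth_atlas M" and N: "smooth_atlas N" and f: "smooth_map M N f"
    and c: "(U, \<phi>) \<in> charts M" "(V, \<psi>) \<in> charts N"
begin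

lemma coordinate_map_facts:
  shows "openin (top_of_set (model M)) (\<phi> ` (U \<inter> f -` V))"
    and "(\<lambda>x. \<psi> (f (inv_into U \<phi> x))) ` \<phi> ` (U \<inter> f -` V) \<subseteq> model N"
proof -
  note U = is_chartD[OF smooth_atlasD(2)[OF M c(1)]]
  note V = is_chartD[OF smooth_atlasD(2)[OF N c(2)]]
  show "openin (top_of_set (model M)) (\<phi> ` (U \<inter> f -` V))"
    by (rule U(6)) (use openin_vimage_chart_domain[OF smooth_map_continuous[OF f] U(1) V(1)] in auto)
  show "(\<lambda>x. \<psi> (f (inv_into U \<phi> x))) ` \<phi> ` (U \<inter> f -` V) \<subseteq> model N"
    using chart_image_subset[OF N c(2)] U(3) by (auto simp: inv_into_f_f)
qed

end

theorem submersion_local_section: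
  fixes M :: "('a, 'e::euclidean_space) mfd" and N :: "('b, 'f::euclidean_space) mfd"
  assumes M: "smooth_atlas M" and N: "smooth_atlas N" and f: "submersion M N f" and p: "p \<in> pts M"
  shows "\<exists>W s. openin (mtop N) W \<and> f p \<in> W \<and> smooth_map (open_submfd N W) M s \<and>
    s (f p) = p \<and> (\<forall>q\<in>W. f (s q) = q)"
proof -
  have sm: "smooth_map M N f" using f by (simp add: submersion_def)
  obtain U \<phi> where U: "(U, \<phi>) \<in> charts M" "p \<in> U" using smooth_atlasD(3)[OF M p] by blast
  obtain V \<psi> where V: "(V, \<psi>) \<in> charts N" "f p \<in> V"
    using smooth_atlasD(3)[OF N smooth_map_in_pts[OF sm p]] by blast
  note U' = is_chartD[OF smooth_atlasD(2)[OF M U(1)]]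
  note V' = is_chartD[OF smooth_atlasD(2)[OF N V(1)]]
  let ?F = "\<lambda>x. \<psi> (f (inv_into U \<phi> x))" and ?S = "\<phi> ` (U \<inter> f -` V)"
  obtain D where "chart_differential f p U \<phi> V \<psi> D" and Dim: "D ` model M = model N"
    using f U V unfolding submersion_def by fast
  then have D: "(?F has_derivative D) (at (\<phi> p) within ?S)"
    by (simp add: chart_differential_def comp_def)
  have x0: "\<phi> p \<in> ?S" using U V by auto
  have Fp: "?F (\<phi> p) = \<psi> (f p)" using U U'(3) by (simp add: inv_into_f_f)
  obtain T s where T: "openin (top_of_set (model N)) T" "?F (\<phi> p) \<in> T" "Cinf_on (model N) T s"
    "s ` T \<subseteq> ?S" "s (?F (\<phi> p)) = \<phi> p" "\<forall>y\<in>T. ?F (s y) = y"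
    by (rule Cinf_on_local_section[OF smooth_atlasD(1)[OF M] smooth_atlasD(1)[OF N]
          coordinate_map_facts(1)[OF M N sm U(1) V(1)] x0 smooth_map_coordinates[OF sm U(1) V(1)]
          coordinate_map_facts(2)[OF M N sm U(1) V(1)] D Dim]) (rule that)
  have sT: "\<exists>q. q \<in> U \<and> f q \<in> V \<and> s y = \<phi> q \<and> \<psi> (f q) = y" if y: "y \<in> T" for y
  proof -
    obtain q where "q \<in> U" "f q \<in> V" "s y = \<phi> q" using T(4) y by blast
    moreover from this have "\<psi> (f q) = y" using T(6) y U'(3) by (metis inv_into_f_f)
    ultimately show ?thesis by blast
  qed
  have TV: "T \<subseteq> \<psi> ` V" using sT by blast
  have sU: "s ` T \<subseteq> \<phi> ` U" using T(4) by blast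
  let ?s = "\<lambda>q. inv_into U \<phi> (s (\<psi> q))" and ?W = "V \<inter> \<psi> -` T"
  note coord = smooth_map_from_coordinates[OF N M V(1) U(1) T(1) TV T(3) sU]
  have "f (?s q) = q" if "q \<in> ?W" for q
  proof -
    obtain q' where q': "q' \<in> U" "f q' \<in> V" "s (\<psi> q) = \<phi> q'" "\<psi> (f q') = \<psi> q" using sT \<open>q \<in> ?W\<close> by blast
    then have "f q' = q" using V'(3) that by (auto dest: inj_onD)
    then show ?thesis using q' U'(3) by (simp add: inv_into_f_f)
  qed
  moreover have "?s (f p) = p" using T(5) Fp U U'(3) by (simp add: inv_into_f_f)
  moreover have "f p \<in> ?W" using V T(2) Fp by simp
  ultimately show ?thesis using coord by blast
qed

theorem immersion_local_retraction:
  fixes M :: "('a, 'e::euclidean_space) mfd" and N :: "('b, 'f::euclidean_space) mfd"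
  assumes M: "smooth_atlas M" and N: "smooth_atlas N" and f: "immersion M N f" and p: "p \<in> pts M"
  shows "\<exists>X W r. openin (mtop M) X \<and> p \<in> X \<and> openin (mtop N) W \<and> f ` X \<subseteq> W \<and>
    smooth_map (open_submfd N W) M r \<and> (\<forall>q\<in>X. r (f q) = q)"
proof -
  have sm: "smooth_map M N f" using f by (simp add: immersion_def)
  obtain U \<phi> where U: "(U, \<phi>) \<in> charts M" "p \<in> U" using smooth_atlasD(3)[OF M p] by blast
  obtain V \<psi> where V: "(V, \<psi>) \<in> charts N" "f p \<in> V"
    using smooth_atlasD(3)[OF N smooth_map_in_pts[OF sm p]] by blast
  note U' = is_chartD[OF smooth_atlasD(2)[OF M U(1)]]
  note V' = is_chartD[OF smooth_atlasD(2)[OF N V(1)]]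
  let ?F = "\<lambda>x. \<psi> (f (inv_into U \<phi> x))" and ?S = "\<phi> ` (U \<inter> f -` V)"
  obtain D where "chart_differential f p U \<phi> V \<psi> D" and Dinj: "inj_on D (model M)"
    using f U V unfolding immersion_def by fast
  then have D: "(?F has_derivative D) (at (\<phi> p) within ?S)"
    by (simp add: chart_differential_def comp_def)
  have x0: "\<phi> p \<in> ?S" using U V by auto
  obtain X R r where X: "openin (top_of_set (model M)) X" "\<phi> p \<in> X" "X \<subseteq> ?S"
    "openin (top_of_set (model N)) R" "?F ` X \<subseteq> R" "Cinf_on (model N) R r" "r ` R \<subseteq> X"
    "\<forall>x\<in>X. r (?F x) = x"
    by (rule Cinf_on_local_retraction[OF smooth_atlasD(1)[OF M] smooth_atlasD(1)[OF N]
          coordinate_map_facts(1)[OF M N sm U(1) V(1)] x0 smooth_map_coordinates[OF sm U(1) V(1)]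
          coordinate_map_facts(2)[OF M N sm U(1) V(1)] D Dinj]) (rule that)
  let ?T = "R \<inter> \<psi> ` V"
  have T: "openin (top_of_set (model N)) ?T" using X(4) V'(4) by blast
  have "Cinf_on (model N) ?T r" using X(6) by (rule Cinf_on_subset) auto
  moreover have "r ` ?T \<subseteq> \<phi> ` U" using X(3,7) by blast
  ultimately have coord: "openin (mtop N) (V \<inter> \<psi> -` ?T)"
    "smooth_map (open_submfd N (V \<inter> \<psi> -` ?T)) M (\<lambda>q. inv_into U \<phi> (r (\<psi> q)))"
    using smooth_map_from_coordinates[OF N M V(1) U(1) T] by blast+
  have q: "f q \<in> V \<inter> \<psi> -` ?T \<and> inv_into U \<phi> (r (\<psi> (f q))) = q" if "q \<in> U \<inter> \<phi> -` X" for q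
  proof -
    have "\<phi> q \<in> ?S" using that X(3) by blast
    then have "f q \<in> V" using that U'(3) by (auto dest: inj_onD)
    moreover have Fq: "?F (\<phi> q) = \<psi> (f q)" using that U'(3) by (simp add: inv_into_f_f)
    moreover have "?F (\<phi> q) \<in> R" "r (?F (\<phi> q)) = \<phi> q" using X(5,8) that by blast+
    ultimately show ?thesis using that U'(3) by (auto simp: inv_into_f_f)
  qed
  have "openin (mtop M) (U \<inter> \<phi> -` X)" by (rule U'(7)[OF X(1)])
  moreover have "p \<in> U \<inter> \<phi> -` X" using U X(2) by blast
  ultimately show ?thesis using coord q by blast
qed

text \<open>
  The chain rule for \<open>F \<circ> G = id\<close>. It shows that \<open>D\<close> is onto when \<open>G\<close> is a section of \<open>F\<close>, and that
  \<open>E\<close> is injective when \<open>F\<close> is a retraction of \<open>G\<close>.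
\<close>

lemma derivative_left_inverse:
  fixes F :: "'a::euclidean_space \<Rightarrow> 'b::euclidean_space" and G :: "'b \<Rightarrow> 'a"
  assumes W: "subspace W" and T: "openin (top_of_set W) T" "y \<in> T"
    and GS: "G ` T \<subseteq> S" and FG: "\<And>y. y \<in> T \<Longrightarrow> F (G y) = y"
    and G: "(G has_derivative E) (at y within T)" and F: "(F has_derivative D) (at (G y) within S)"
    and w: "w \<in> W"
  shows "D (E w) = w"
proof (rule has_derivative_unique_on_subspace[OF W T _ _ w])
  have "((\<lambda>y. F (G y)) has_derivative (\<lambda>w. D (E w))) (at y within T)"
    by (rule has_derivative_in_compose[OF G has_derivative_subset[OF F GS]])
  then show "((\<lambda>y. y) has_derivative (\<lambda>w. D (E w))) (at y within T)"
    by (rule has_derivative_transform[OF T(2), rotated]) (simp add: FG)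
qed (rule has_derivative_ident)

text \<open>
  Together with the existence of local sections this describes submersions without reference to
  differentials. All submersions below are recognized in this way.
\<close>

theorem submersionI_local_sections:
  fixes M :: "('a, 'e::euclidean_space) mfd" and N :: "('b, 'f::euclidean_space) mfd"
  assumes M: "smooth_atlas M" and N: "smooth_atlas N" and f: "smooth_map M N f"
    and sec: "\<And>p. p \<in> pts M \<Longrightarrow> \<exists>W s. openin (mtop N) W \<and> f p \<in> W \<and>
      smooth_map (open_submfd N W) M s \<and> s (f p) = p \<and> (\<forall>q\<in>W. f (s q) = q)"
  shows "submersion M N f"
proof -
  have "\<exists>D. chart_differential f p U \<phi> V \<psi> D \<and> D ` model M = model N"
    if c: "(U, \<phi>) \<in> charts M" "(V, \<psi>) \<in> charts N" "p \<in> U" "f p \<in> V" for U \<phi> V \<psi> p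
  proof -
    note U = is_chartD[OF smooth_atlasD(2)[OF M c(1)]]
    note V = is_chartD[OF smooth_atlasD(2)[OF N c(2)]]
    let ?F = "\<lambda>x. \<psi> (f (inv_into U \<phi> x))" and ?S = "\<phi> ` (U \<inter> f -` V)"
    have x0: "\<phi> p \<in> ?S" using c by auto
    obtain D where D: "(?F has_derivative D) (at (\<phi> p) within ?S)" "range D \<subseteq> model N"
      by (rule Cinf_on_has_derivative[OF smooth_map_coordinates[OF f c(1,2)] x0])
        (rule has_derivative_into_subspace[OF smooth_atlasD(1)[OF N]
            coordinate_map_facts(2)[OF M N f c(1,2)] x0], assumption)
    obtain W s where s: "openin (mtop N) W" "f p \<in> W" "smooth_map (open_submfd N W) M s"
      "s (f p) = p" "\<forall>q\<in>W. f (s q) = q" using sec[of p] c(3) U(2) by blast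
    have NW: "smooth_atlas (open_submfd N W)" by (rule smooth_atlas_open_submfd[OF N s(1)])
    have cW: "(V \<inter> W, \<psi>) \<in> charts (open_submfd N W)" using c(2) charts_open_submfd by metis
    let ?G = "\<lambda>y. \<phi> (s (inv_into (V \<inter> W) \<psi> y))" and ?T = "\<psi> ` ((V \<inter> W) \<inter> s -` U)"
    have inj: "inj_on \<psi> (V \<inter> W)" using V(3) inj_on_Int by blast
    have y0: "\<psi> (f p) \<in> ?T" using c s by auto
    have G: "?G (\<psi> q) = \<phi> (s q)" if "q \<in> V \<inter> W" for q using that inj by (simp add: inv_into_f_f)
    have T: "openin (top_of_set (model N)) ?T"
      using coordinate_map_facts(1)[OF NW M s(3) cW c(1)] by simp
    obtain E where E: "(?G has_derivative E) (at (\<psi> (f p)) within ?T)" "range E \<subseteq> model M"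
      by (rule Cinf_on_has_derivative[OF smooth_map_coordinates[OF s(3) cW c(1)] y0])
        (rule has_derivative_into_subspace[OF smooth_atlasD(1)[OF M]
            coordinate_map_facts(2)[OF NW M s(3) cW c(1)] y0], assumption)
    have GS: "?G ` ?T \<subseteq> ?S"
    proof clarify
      fix q assume q: "q \<in> V" "q \<in> W" "s q \<in> U"
      then have "?G (\<psi> q) = \<phi> (s q)" "s q \<in> U \<inter> f -` V" using G s(5) by auto
      then show "?G (\<psi> q) \<in> ?S" by (metis imageI)
    qed
    have FG: "?F (?G y) = y" if y: "y \<in> ?T" for y
    proof -
      obtain q where "q \<in> V \<inter> W" "s q \<in> U" "y = \<psi> q" using y by blast
      then show ?thesis using G[of q] U(3) s(5) by (simp add: inv_into_f_f)
    qed
    have D': "(?F has_derivative D) (at (?G (\<psi> (f p))) within ?S)"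
      using D(1) G[of "f p"] c(4) s(2,4) by simp
    have "D (E w) = w" if "w \<in> model N" for w
      by (rule derivative_left_inverse[OF smooth_atlasD(1)[OF N] T y0 GS FG E(1) D' that])
    then have "model N \<subseteq> D ` model M" using E(2) by (metis image_eqI range_subsetD subsetI)
    then have "D ` model M = model N" using D(2) by blast
    then show ?thesis using D(1) by (auto simp: chart_differential_def comp_def)
  qed
  then show ?thesis using f unfolding submersion_def by blast
qed

text \<open>
  The retraction has to invert \<open>f\<close> on the whole part of the image that lies in \<open>W\<close>, not only on the
  image of a small neighbourhood of \<open>p\<close>: this makes \<open>f\<close> injective and open onto its image.
\<close>

theorem smooth_embeddingI_local_retractions:
  fixes M :: "('a, 'e::euclidean_space) mfd" and N :: "('b, 'f::euclidean_space) mfd"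
  assumes M: "smooth_atlas M" and N: "smooth_atlas N" and f: "smooth_map M N f"
    and retr: "\<And>p. p \<in> pts M \<Longrightarrow> \<exists>W r. openin (mtop N) W \<and> f p \<in> W \<and>
      smooth_map (open_submfd N W) M r \<and> (\<forall>q\<in>pts M. f q \<in> W \<longrightarrow> r (f q) = q)"
  shows "smooth_embedding M N f"
proof -
  have inj: "inj_on f (pts M)"
  proof (rule inj_onI)
    fix p q assume "p \<in> pts M" "q \<in> pts M" "f p = f q"
    then show "p = q" using retr[of p] by metis
  qed
  have op: "openin (subtopology (mtop N) (f ` pts M)) (f ` X)" if X: "openin (mtop M) X" for X
  proof (subst openin_subopen, intro ballI)
    fix y assume "y \<in> f ` X"
    then obtain p where p: "p \<in> X" "y = f p" by blast
    have XM: "X \<subseteq> pts M" using X openin_subset by blast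
    obtain W r where r: "openin (mtop N) W" "f p \<in> W" "smooth_map (open_submfd N W) M r"
      "\<forall>q\<in>pts M. f q \<in> W \<longrightarrow> r (f q) = q" using retr[of p] p XM by blast
    have "openin (subtopology (mtop N) W) (W \<inter> r -` X)"
      using openin_vimage_chart_domain[OF smooth_map_continuous[OF r(3)] _ X, of W] r(1)
      by (simp add: openin_open_subtopology)
    then have op: "openin (mtop N) (W \<inter> r -` X)" using r(1) openin_trans_full by blast
    have "openin (subtopology (mtop N) (f ` pts M)) ((W \<inter> r -` X) \<inter> f ` pts M)"
      using op openin_subtopology_Int by blast
    moreover have "y \<in> (W \<inter> r -` X) \<inter> f ` pts M" using p r XM by auto
    moreover have "(W \<inter> r -` X) \<inter> f ` pts M \<subseteq> f ` X" using r(4) by auto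
    ultimately show "\<exists>T. openin (subtopology (mtop N) (f ` pts M)) T \<and> y \<in> T \<and> T \<subseteq> f ` X"
      by blast
  qed
  have cont: "continuous_map (mtop M) (subtopology (mtop N) (f ` pts M)) f"
    using smooth_map_continuous[OF f] by (auto simp: continuous_map_in_subtopology)
  have img: "f ` pts M = topspace (subtopology (mtop N) (f ` pts M))"
    using smooth_map_in_pts[OF f] by auto
  have emb: "embedding_map (mtop M) (mtop N) f"
    unfolding embedding_map_def
    by (rule bijective_open_imp_homeomorphic_map[OF cont _ img inj]) (simp add: open_map_def op)
  have "\<exists>D. chart_differential f p U \<phi> V \<psi> D \<and> inj_on D (model M)"
    if c: "(U, \<phi>) \<in> charts M" "(V, \<psi>) \<in> charts N" "p \<in> U" "f p \<in> V" for U \<phi> V \<psi> p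
  proof -
    note U = is_chartD[OF smooth_atlasD(2)[OF M c(1)]]
    note V = is_chartD[OF smooth_atlasD(2)[OF N c(2)]]
    let ?F = "\<lambda>x. \<psi> (f (inv_into U \<phi> x))" and ?S = "\<phi> ` (U \<inter> f -` V)"
    have x0: "\<phi> p \<in> ?S" using c by auto
    obtain D where D: "(?F has_derivative D) (at (\<phi> p) within ?S)"
      by (rule Cinf_on_has_derivative[OF smooth_map_coordinates[OF f c(1,2)] x0])
    obtain W r where r: "openin (mtop N) W" "f p \<in> W" "smooth_map (open_submfd N W) M r"
      "\<forall>q\<in>pts M. f q \<in> W \<longrightarrow> r (f q) = q" using retr[of p] c(3) U(2) by blast
    have NW: "smooth_atlas (open_submfd N W)" by (rule smooth_atlas_open_submfd[OF N r(1)])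
    have cW: "(V \<inter> W, \<psi>) \<in> charts (open_submfd N W)" using c(2) charts_open_submfd by metis
    let ?G = "\<lambda>y. \<phi> (r (inv_into (V \<inter> W) \<psi> y))" and ?T = "\<psi> ` ((V \<inter> W) \<inter> r -` U)"
      and ?S' = "\<phi> ` (U \<inter> f -` (V \<inter> W))"
    have inj: "inj_on \<psi> (V \<inter> W)" using V(3) inj_on_Int by blast
    have F: "?F (\<phi> q) = \<psi> (f q)" if "q \<in> U" for q using that U(3) by (simp add: inv_into_f_f)
    have rf: "r (f q) = q" if "q \<in> U" "f q \<in> W" for q using r(4) that U(2) by blast
    have y0: "?F (\<phi> p) \<in> ?T" using F[OF c(3)] c rf r(2) by auto
    have S': "openin (top_of_set (model M)) ?S'"
      by (rule U(6)) (use openin_vimage_chart_domain[OF smooth_map_continuous[OF f] U(1), of "V \<inter> W"]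
          V(1) r(1) in auto)
    have x0': "\<phi> p \<in> ?S'" using c r(2) by auto
    obtain E where E: "(?G has_derivative E) (at (?F (\<phi> p)) within ?T)"
      by (rule Cinf_on_has_derivative[OF smooth_map_coordinates[OF r(3) cW c(1)], of "?F (\<phi> p)"])
        (use y0 in auto)
    have FT: "?F ` ?S' \<subseteq> ?T"
    proof clarify
      fix q assume q: "q \<in> U" "f q \<in> V" "f q \<in> W"
      then have "f q \<in> (V \<inter> W) \<inter> r -` U" using rf by simp
      then show "?F (\<phi> q) \<in> ?T" unfolding F[OF q(1)] by (rule imageI)
    qed
    have GF: "?G (?F x) = x" if x: "x \<in> ?S'" for x
    proof -
      obtain q where "q \<in> U" "f q \<in> V \<inter> W" "x = \<phi> q" using x by blast
      then show ?thesis using F[of q] inj rf by (simp add: inv_into_f_f)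
    qed
    have "E (D v) = v" if "v \<in> model M" for v
      by (rule derivative_left_inverse[OF smooth_atlasD(1)[OF M] S' x0' FT GF
            has_derivative_subset[OF D] E that]) auto
    then have "inj_on D (model M)" by (metis inj_onI)
    then show ?thesis using D by (auto simp: chart_differential_def comp_def)
  qed
  then have "immersion M N f" using f unfolding immersion_def by blast
  then show ?thesis using emb by (simp add: smooth_embedding_def)
qed

text \<open>
  A local retraction of an immersion inverts it on the image of a neighbourhood \<open>X\<close>. For an embedding
  this image is open in the whole image, so that after shrinking its domain the retraction extends
  the inverse.
\<close>

theorem smooth_embedding_inverse:
  fixes M :: "('a, 'e::euclidean_space) mfd" and N :: "('b, 'f::euclidean_space) mfd"
  assumes M: "smooth_atlas M" and N: "smooth_atlas N" and f: "smooth_embedding M N f"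
  shows "smooth_on_subset N (f ` pts M) M (inv_into (pts M) f)"
  unfolding smooth_on_subset_def
proof (intro conjI ballI)
  show "inv_into (pts M) f \<in> f ` pts M \<rightarrow> pts M" by (intro funcsetI inv_into_into)
  have emb: "homeomorphic_map (mtop M) (subtopology (mtop N) (f ` pts M)) f" and imm: "immersion M N f"
    using f by (auto simp: smooth_embedding_def embedding_map_def)
  then have inj: "inj_on f (pts M)" by (simp add: homeomorphic_map_def)
  fix y assume "y \<in> f ` pts M"
  then obtain p where p: "p \<in> pts M" "y = f p" by blast
  obtain X W r where r: "openin (mtop M) X" "p \<in> X" "openin (mtop N) W" "f ` X \<subseteq> W"
    "smooth_map (open_submfd N W) M r" "\<forall>q\<in>X. r (f q) = q"
    using immersion_local_retraction[OF M N imm p(1)] by blast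
  have "openin (subtopology (mtop N) (f ` pts M)) (f ` X)"
    using homeomorphic_imp_open_map[OF emb] r(1) by (simp add: open_map_def)
  then obtain W' where W': "openin (mtop N) W'" "f ` X = W' \<inter> f ` pts M"
    using openin_subtopology by metis
  have XM: "X \<subseteq> pts M" using r(1) openin_subset by blast
  let ?W = "W \<inter> W'"
  have "smooth_map (open_submfd (open_submfd N W) W') M r"
    by (rule smooth_map_restrict[OF smooth_atlas_open_submfd[OF N r(3)] r(5)])
  moreover have "open_submfd (open_submfd N W) W' = open_submfd N ?W"
    unfolding open_submfd_def
    by (simp add: subtopology_subtopology) (auto simp flip: Int_assoc)
  ultimately have "smooth_map (open_submfd N ?W) M r" by simp
  moreover have "r q = inv_into (pts M) f q" if q: "q \<in> f ` pts M \<inter> ?W" for q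
  proof -
    obtain x where x: "x \<in> X" "q = f x" using q W'(2) by blast
    then show ?thesis using r(6) inj XM by (auto simp: inv_into_f_f)
  qed
  moreover have "openin (mtop N) ?W" using r(3) W'(1) by blast
  moreover have "y \<in> ?W" using p r(2,4) W'(2) by blast
  ultimately show "\<exists>W F. openin (mtop N) W \<and> y \<in> W \<and> smooth_map (open_submfd N W) M F \<and>
      (\<forall>q\<in>f ` pts M \<inter> W. F q = inv_into (pts M) f q)"
    by blast
qed

lemma smooth_manifold_atlas: "smooth_manifold M \<Longrightarrow> smooth_atlas M"
  by (simp add: smooth_manifold_iff)

lemma smooth_map_openin_vimage:
  assumes "smooth_map M N f" "openin (mtop N) V"
  shows "openin (mtop M) {p \<in> pts M. f p \<in> V}"
  using openin_continuous_map_preimage[OF smooth_map_continuous[OF assms(1)] assms(2)] .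

lemma diffeomorphism_inv_into:
  assumes M: "smooth_atlas M" and N: "smooth_atlas N" and f: "diffeomorphism M N f"
  shows "bij_betw f (pts M) (pts N)" "smooth_map M N f" "smooth_map N M (inv_into (pts M) f)"
proof -
  obtain g where g: "smooth_map M N f" "smooth_map N M g" "\<forall>x\<in>pts M. g (f x) = x" "\<forall>y\<in>pts N. f (g y) = y"
    using f unfolding diffeomorphism_def by blast
  show bij: "bij_betw f (pts M) (pts N)"
    using g smooth_map_in_pts[OF g(1)] smooth_map_in_pts[OF g(2)]
    by (intro bij_betw_byWitness[where f' = g]) auto
  show "smooth_map M N f" by (rule g)
  show "smooth_map N M (inv_into (pts M) f)"
  proof (rule smooth_map_cong[OF N g(2)])
    fix y assume "y \<in> pts N"
    then show "g y = inv_into (pts M) f y"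
      using g(4) smooth_map_in_pts[OF g(2)] bij by (metis bij_betw_inv_into_left)
  qed
qed

section \<open>Lie groupoids\<close>

locale lie_gpd =
  fixes C :: "('m, 'em::euclidean_space, 'o, 'eo::euclidean_space, 'z) smcat_scheme"
  assumes C: "lie_groupoid C"
begin

abbreviation "inverse_mor \<gamma> \<equiv> THE \<delta>. is_inverse C \<gamma> \<delta>"

lemma cat: "is_category C" using C by (simp add: lie_groupoid_def)

lemma src_in: "\<gamma> \<in> pts (Mor C) \<Longrightarrow> src C \<gamma> \<in> pts (Obj C)"
  and tgt_in: "\<gamma> \<in> pts (Mor C) \<Longrightarrow> tgt C \<gamma> \<in> pts (Obj C)"
  and id_in: "x \<in> pts (Obj C) \<Longrightarrow> idm C x \<in> pts (Mor C)"
  and src_id: "x \<in> pts (Obj C) \<Longrightarrow> src C (idm C x) = x"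
  and tgt_id: "x \<in> pts (Obj C) \<Longrightarrow> tgt C (idm C x) = x"
  and id_right: "\<gamma> \<in> pts (Mor C) \<Longrightarrow> cmp C \<gamma> (idm C (src C \<gamma>)) = \<gamma>"
  and id_left: "\<gamma> \<in> pts (Mor C) \<Longrightarrow> cmp C (idm C (tgt C \<gamma>)) \<gamma> = \<gamma>"
  using cat unfolding is_category_def by blast+

lemma cmp_in: "\<gamma> \<in> pts (Mor C) \<Longrightarrow> \<delta> \<in> pts (Mor C) \<Longrightarrow> src C \<gamma> = tgt C \<delta> \<Longrightarrow> cmp C \<gamma> \<delta> \<in> pts (Mor C)"
  and src_cmp: "\<gamma> \<in> pts (Mor C) \<Longrightarrow> \<delta> \<in> pts (Mor C) \<Longrightarrow> src C \<gamma> = tgt C \<delta> \<Longrightarrow> src C (cmp C \<gamma> \<delta>) = src C \<delta>"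
  and tgt_cmp: "\<gamma> \<in> pts (Mor C) \<Longrightarrow> \<delta> \<in> pts (Mor C) \<Longrightarrow> src C \<gamma> = tgt C \<delta> \<Longrightarrow> tgt C (cmp C \<gamma> \<delta>) = tgt C \<gamma>"
  using cat unfolding is_category_def composable_def by blast+

lemma assoc:
  "\<gamma>3 \<in> pts (Mor C) \<Longrightarrow> \<gamma>2 \<in> pts (Mor C) \<Longrightarrow> \<gamma>1 \<in> pts (Mor C) \<Longrightarrow>
    src C \<gamma>3 = tgt C \<gamma>2 \<Longrightarrow> src C \<gamma>2 = tgt C \<gamma>1 \<Longrightarrow>
    cmp C (cmp C \<gamma>3 \<gamma>2) \<gamma>1 = cmp C \<gamma>3 (cmp C \<gamma>2 \<gamma>1)"
  using cat unfolding is_category_def composable_def by blast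

lemma is_inverse_unique:
  assumes g: "\<gamma> \<in> pts (Mor C)" and d: "is_inverse C \<gamma> \<delta>" "is_inverse C \<gamma> \<delta>'"
  shows "\<delta> = \<delta>'"
proof -
  have d': "\<delta> \<in> pts (Mor C)" "\<delta>' \<in> pts (Mor C)" "src C \<delta> = tgt C \<gamma>" "tgt C \<delta> = src C \<gamma>"
    "src C \<delta>' = tgt C \<gamma>" "tgt C \<delta>' = src C \<gamma>" "cmp C \<delta> \<gamma> = idm C (src C \<gamma>)"
    "cmp C \<gamma> \<delta>' = idm C (tgt C \<gamma>)"
    using d unfolding is_inverse_def by blast+
  have "\<delta> = cmp C \<delta> (cmp C \<gamma> \<delta>')" using id_right[OF d'(1)] d' by simp
  also have "\<dots> = cmp C (cmp C \<delta> \<gamma>) \<delta>'" using assoc[of \<delta> \<gamma> \<delta>'] d' g by simp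
  also have "\<dots> = \<delta>'" using id_left[OF d'(2)] d' by simp
  finally show ?thesis .
qed

lemma is_inverse_inverse_mor: "\<gamma> \<in> pts (Mor C) \<Longrightarrow> is_inverse C \<gamma> (inverse_mor \<gamma>)"
proof (rule theI')
  assume g: "\<gamma> \<in> pts (Mor C)"
  then obtain \<delta> where "is_inverse C \<gamma> \<delta>" using C by (auto simp: lie_groupoid_def)
  then show "\<exists>!\<delta>. is_inverse C \<gamma> \<delta>" using is_inverse_unique[OF g] by blast
qed

lemma inverse_mor:
  assumes "\<gamma> \<in> pts (Mor C)"
  shows "inverse_mor \<gamma> \<in> pts (Mor C)" "src C (inverse_mor \<gamma>) = tgt C \<gamma>"
    "tgt C (inverse_mor \<gamma>) = src C \<gamma>" "cmp C (inverse_mor \<gamma>) \<gamma> = idm C (src C \<gamma>)"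
    "cmp C \<gamma> (inverse_mor \<gamma>) = idm C (tgt C \<gamma>)"
  using is_inverse_inverse_mor[OF assms] unfolding is_inverse_def by blast+

lemma atlas_Mor: "smooth_atlas (Mor C)" and atlas_Obj: "smooth_atlas (Obj C)"
  and manifold_Mor: "smooth_manifold (Mor C)" and manifold_Obj: "smooth_manifold (Obj C)"
  and submersion_src: "submersion (Mor C) (Obj C) (src C)"
  and submersion_tgt: "submersion (Mor C) (Obj C) (tgt C)"
  and smooth_id: "smooth_map (Obj C) (Mor C) (idm C)"
  and smooth_inverse: "smooth_map (Mor C) (Mor C) inverse_mor"
  using C by (auto simp: lie_groupoid_def smooth_manifold_atlas)

lemma smooth_src: "smooth_map (Mor C) (Obj C) (src C)"
  and smooth_tgt: "smooth_map (Mor C) (Obj C) (tgt C)"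
  using submersion_src submersion_tgt by (auto simp: submersion_def)

lemma smooth_cmp:
  assumes P: "smooth_atlas P" and f: "smooth_map P (Mor C) f" and g: "smooth_map P (Mor C) g"
    and fg: "\<And>p. p \<in> pts P \<Longrightarrow> src C (f p) = tgt C (g p)"
  shows "smooth_map P (Mor C) (\<lambda>p. cmp C (f p) (g p))"
proof -
  have "smooth_on_subset (prod_mfd (Mor C) (Mor C)) (composable C) (Mor C) (\<lambda>(\<gamma>2, \<gamma>1). cmp C \<gamma>2 \<gamma>1)"
    using C by (simp add: lie_groupoid_def)
  moreover have "(\<lambda>p. (f p, g p)) ` pts P \<subseteq> composable C"
    using fg smooth_map_in_pts[OF f] smooth_map_in_pts[OF g] by (auto simp: composable_def)
  ultimately have "smooth_map P (Mor C) (\<lambda>p. (\<lambda>(\<gamma>2, \<gamma>1). cmp C \<gamma>2 \<gamma>1) (f p, g p))"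
    using smooth_map_compose_smooth_on_subset[OF P smooth_atlas_prod_mfd[OF atlas_Mor atlas_Mor]
        atlas_Mor smooth_map_Pair[OF f g]] by blast
  then show ?thesis by simp
qed

end

section \<open>Principal bundles\<close>

text \<open>
  \<open>\<kappa>\<close> is the group component of the inverse trivialization. Its equivariance makes
  \<open>(\<kappa> p)\<^sup>-\<^sup>1 \<otimes> \<kappa> q\<close> the group element that moves \<open>p\<close> to \<open>q\<close> in the same fibre.
\<close>

lemma principal_bundle_trivialization:
  fixes P :: "('p, 'ep::euclidean_space) mfd" and B :: "('b, 'eb::euclidean_space) mfd"
    and MG :: "('g, 'eg::euclidean_space) mfd"
  assumes pb: "principal_bundle G MG P B \<pi> \<rho>" and b: "b \<in> pts B"
  obtains U \<Phi> \<kappa> where "openin (mtop B) U" "b \<in> U"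
    "openin (mtop P) {p \<in> pts P. \<pi> p \<in> U}"
    "smooth_map (prod_mfd (open_submfd B U) MG) P \<Phi>"
    "smooth_map (open_submfd P {p \<in> pts P. \<pi> p \<in> U}) MG \<kappa>"
    "\<forall>u\<in>U. \<forall>g\<in>carrier G. \<pi> (\<Phi> (u, g)) = u"
    "\<forall>p\<in>pts P. \<pi> p \<in> U \<longrightarrow> \<kappa> p \<in> carrier G \<and> \<Phi> (\<pi> p, \<kappa> p) = p"
    "\<forall>p\<in>pts P. \<pi> p \<in> U \<longrightarrow> (\<forall>g\<in>carrier G. \<kappa> (\<rho> p g) = \<kappa> p \<otimes>\<^bsub>G\<^esub> g \<and> \<pi> (\<rho> p g) = \<pi> p)"
    "\<forall>u\<in>U. \<forall>g\<in>carrier G. \<forall>h\<in>carrier G. \<Phi> (u, g \<otimes>\<^bsub>G\<^esub> h) = \<rho> (\<Phi> (u, g)) h"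
proof -
  have P: "smooth_atlas P" and B: "smooth_atlas B" and pi: "smooth_map P B \<pi>"
    and lg: "lie_group G MG"
    using pb by (auto simp: principal_bundle_def right_lie_action_def smooth_manifold_atlas)
  have G: "group G" and MG: "smooth_atlas MG" "pts MG = carrier G"
    using lg by (auto simp: lie_group_def smooth_manifold_atlas)
  obtain U \<Phi> where U: "openin (mtop B) U" "b \<in> U"
    and diff: "diffeomorphism (prod_mfd (open_submfd B U) MG) (open_submfd P {p \<in> pts P. \<pi> p \<in> U}) \<Phi>"
    and pr: "\<forall>u\<in>U. \<forall>g\<in>carrier G. \<pi> (\<Phi> (u, g)) = u"
    and eq: "\<forall>u\<in>U. \<forall>g\<in>carrier G. \<forall>h\<in>carrier G. \<Phi> (u, g \<otimes>\<^bsub>G\<^esub> h) = \<rho> (\<Phi> (u, g)) h"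
    using pb b unfolding principal_bundle_def by blast
  let ?V = "{p \<in> pts P. \<pi> p \<in> U}"
  have V: "openin (mtop P) ?V" by (rule smooth_map_openin_vimage[OF pi U(1)])
  have UB: "U \<subseteq> pts B" using U(1) openin_subset by blast
  have BU: "smooth_atlas (open_submfd B U)" and PV: "smooth_atlas (open_submfd P ?V)"
    using smooth_atlas_open_submfd B P U V by blast+
  have prodA: "smooth_atlas (prod_mfd (open_submfd B U) MG)" by (rule smooth_atlas_prod_mfd[OF BU MG(1)])
  obtain \<Psi> where Phi: "smooth_map (prod_mfd (open_submfd B U) MG) (open_submfd P ?V) \<Phi>"
    and Psi: "smooth_map (open_submfd P ?V) (prod_mfd (open_submfd B U) MG) \<Psi>"
    and inv1: "\<forall>x\<in>pts (prod_mfd (open_submfd B U) MG). \<Psi> (\<Phi> x) = x"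
    and inv2: "\<forall>y\<in>pts (open_submfd P ?V). \<Phi> (\<Psi> y) = y"
    using diff unfolding diffeomorphism_def by blast
  have inv1': "\<Psi> (\<Phi> (u, g)) = (u, g)" if "u \<in> U" "g \<in> carrier G" for u g
    using inv1 that UB MG(2) by auto
  have k: "snd (\<Psi> p) \<in> carrier G \<and> \<Phi> (\<pi> p, snd (\<Psi> p)) = p" if p: "p \<in> pts P" "\<pi> p \<in> U" for p
  proof -
    obtain u g where ug: "\<Psi> p = (u, g)" by force
    have "(u, g) \<in> pts (prod_mfd (open_submfd B U) MG)"
      using smooth_map_in_pts[OF Psi, of p] p ug by simp
    then have "u \<in> U" "g \<in> carrier G" using MG(2) by auto
    moreover have "\<Phi> (u, g) = p" using inv2 p ug by force
    ultimately show ?thesis using pr ug by fastforce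
  qed
  have act: "snd (\<Psi> (\<rho> p g)) = snd (\<Psi> p) \<otimes>\<^bsub>G\<^esub> g \<and> \<pi> (\<rho> p g) = \<pi> p"
    if p: "p \<in> pts P" "\<pi> p \<in> U" "g \<in> carrier G" for p g
  proof -
    have m: "snd (\<Psi> p) \<otimes>\<^bsub>G\<^esub> g \<in> carrier G" using k[OF p(1,2)] p(3) G by (simp add: group.is_monoid monoid.m_closed)
    have "\<rho> p g = \<Phi> (\<pi> p, snd (\<Psi> p) \<otimes>\<^bsub>G\<^esub> g)"
      using eq k[OF p(1,2)] p by metis
    then show ?thesis using inv1'[OF p(2) m] pr p(2) m by simp
  qed
  show ?thesis
  proof (rule that[of U \<Phi> "\<lambda>p. snd (\<Psi> p)"])
    show "smooth_map (prod_mfd (open_submfd B U) MG) P \<Phi>"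
      by (rule smooth_map_from_open_submfd[OF prodA P V Phi])
    show "smooth_map (open_submfd P ?V) MG (\<lambda>p. snd (\<Psi> p))"
      by (rule smooth_map_compose[OF PV prodA MG(1) Psi smooth_map_snd[OF BU MG(1)]])
  qed (use U V pr eq k act in blast)+
qed

context
  fixes G and MG :: "('g, 'eg::euclidean_space) mfd" and P :: "('p, 'ep::euclidean_space) mfd"
    and B :: "('b, 'eb::euclidean_space) mfd" and \<pi> \<rho>
  assumes pb: "principal_bundle G MG P B \<pi> \<rho>"
begin

lemma principal_bundle_group: "group G" "smooth_atlas MG" "pts MG = carrier G"
  using pb by (auto simp: principal_bundle_def right_lie_action_def lie_group_def smooth_manifold_atlas)

lemma principal_bundle_smooth: "smooth_atlas P" "smooth_atlas B" "smooth_map P B \<pi>"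
  using pb by (auto simp: principal_bundle_def smooth_manifold_atlas)

lemma principal_bundle_transitive:
  assumes p: "p \<in> pts P" and q: "q \<in> pts P" and pq: "\<pi> p = \<pi> q"
  obtains g where "g \<in> carrier G" "q = \<rho> p g"
proof -
  interpret group G by (rule principal_bundle_group)
  have "\<pi> p \<in> pts B" using smooth_map_in_pts[OF principal_bundle_smooth(3) p] .
  then obtain U \<Phi> \<kappa> where U: "\<pi> p \<in> U"
    "\<forall>p\<in>pts P. \<pi> p \<in> U \<longrightarrow> \<kappa> p \<in> carrier G \<and> \<Phi> (\<pi> p, \<kappa> p) = p"
    "\<forall>u\<in>U. \<forall>g\<in>carrier G. \<forall>h\<in>carrier G. \<Phi> (u, g \<otimes>\<^bsub>G\<^esub> h) = \<rho> (\<Phi> (u, g)) h"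
    by (rule principal_bundle_trivialization[OF pb])
  have k: "\<kappa> p \<in> carrier G" "\<Phi> (\<pi> p, \<kappa> p) = p" "\<kappa> q \<in> carrier G" "\<Phi> (\<pi> p, \<kappa> q) = q"
    using U p q pq by metis+
  have "\<kappa> p \<otimes>\<^bsub>G\<^esub> (inv\<^bsub>G\<^esub> \<kappa> p \<otimes>\<^bsub>G\<^esub> \<kappa> q) = \<kappa> q"
    using k by (simp flip: m_assoc)
  then have q_eq: "q = \<rho> p (inv\<^bsub>G\<^esub> \<kappa> p \<otimes>\<^bsub>G\<^esub> \<kappa> q)"
    using U(1,3) k by (metis inv_closed m_closed)
  show ?thesis by (rule that[OF _ q_eq]) (use k in simp)
qed

lemma principal_bundle_surj: "\<pi> ` pts P = pts B"
proof (intro equalityI subsetI)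
  fix b assume b: "b \<in> pts B"
  obtain U \<Phi> \<kappa> where U: "openin (mtop B) U" "b \<in> U" "smooth_map (prod_mfd (open_submfd B U) MG) P \<Phi>"
    "\<forall>u\<in>U. \<forall>g\<in>carrier G. \<pi> (\<Phi> (u, g)) = u"
    by (rule principal_bundle_trivialization[OF pb b])
  have one: "\<one>\<^bsub>G\<^esub> \<in> carrier G" using principal_bundle_group(1) by (simp add: group.is_monoid monoid.one_closed)
  then have "\<Phi> (b, \<one>\<^bsub>G\<^esub>) \<in> pts P" using smooth_map_in_pts[OF U(3)] b U(2) principal_bundle_group(3) by simp
  then show "b \<in> \<pi> ` pts P" using U(2,4) one by force
qed (use smooth_map_in_pts[OF principal_bundle_smooth(3)] in blast)

lemma principal_bundle_submersion: "submersion P B \<pi>"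
proof (rule submersionI_local_sections[OF principal_bundle_smooth])
  fix p assume p: "p \<in> pts P"
  have "\<pi> p \<in> pts B" using smooth_map_in_pts[OF principal_bundle_smooth(3) p] .
  then obtain U \<Phi> \<kappa> where U: "openin (mtop B) U" "\<pi> p \<in> U"
    "smooth_map (prod_mfd (open_submfd B U) MG) P \<Phi>"
    "\<forall>u\<in>U. \<forall>g\<in>carrier G. \<pi> (\<Phi> (u, g)) = u"
    "\<forall>p\<in>pts P. \<pi> p \<in> U \<longrightarrow> \<kappa> p \<in> carrier G \<and> \<Phi> (\<pi> p, \<kappa> p) = p"
    by (rule principal_bundle_trivialization[OF pb])
  have BU: "smooth_atlas (open_submfd B U)" using smooth_atlas_open_submfd principal_bundle_smooth U(1) by blast
  have k: "\<kappa> p \<in> carrier G" using U p by blast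
  then have "smooth_map (open_submfd B U) (prod_mfd (open_submfd B U) MG) (\<lambda>u. (u, \<kappa> p))"
    by (intro smooth_map_Pair smooth_map_id[OF BU] smooth_map_const) (simp add: principal_bundle_group)
  then have "smooth_map (open_submfd B U) P (\<lambda>u. \<Phi> (u, \<kappa> p))"
    by (rule smooth_map_compose[OF BU smooth_atlas_prod_mfd[OF BU principal_bundle_group(2)]
          principal_bundle_smooth(1) _ U(3)])
  then show "\<exists>W s. openin (mtop B) W \<and> \<pi> p \<in> W \<and> smooth_map (open_submfd B W) P s \<and>
      s (\<pi> p) = p \<and> (\<forall>q\<in>W. \<pi> (s q) = q)"
    using U p k by blast
qed

end

text \<open>
  The fibres are single points, so \<open>\<pi>\<close> is bijective; its inverse agrees locally with the smooth
  sections of the submersion \<open>\<pi>\<close>.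
\<close>

lemma principal_bundle_trivial_group_diffeomorphism:
  fixes P :: "('p, 'ep::euclidean_space) mfd" and B :: "('b, 'eb::euclidean_space) mfd"
    and MG :: "('g, 'eg::euclidean_space) mfd"
  assumes pb: "principal_bundle G MG P B \<pi> \<rho>" and triv: "carrier G = {\<one>\<^bsub>G\<^esub>}"
  shows "diffeomorphism P B \<pi>"
proof -
  note sm = principal_bundle_smooth[OF pb]
  have one: "\<rho> p \<one>\<^bsub>G\<^esub> = p" if "p \<in> pts P" for p
    using pb that by (simp add: principal_bundle_def right_lie_action_def)
  have inj: "inj_on \<pi> (pts P)"
  proof (rule inj_onI)
    fix p q assume pq: "p \<in> pts P" "q \<in> pts P" "\<pi> p = \<pi> q"
    then obtain g where "g \<in> carrier G" "q = \<rho> p g" by (rule principal_bundle_transitive[OF pb])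
    then show "p = q" using one[OF pq(1)] triv by simp
  qed
  note surj = principal_bundle_surj[OF pb]
  have "smooth_map B P (inv_into (pts P) \<pi>)"
  proof (rule smooth_map_local[OF sm(2,1)])
    fix b assume b: "b \<in> pts B"
    then have "b \<in> \<pi> ` pts P" using surj by simp
    then obtain p where p: "p \<in> pts P" "\<pi> p = b" by blast
    obtain W s where s: "openin (mtop B) W" "b \<in> W" "smooth_map (open_submfd B W) P s" "\<forall>q\<in>W. \<pi> (s q) = q"
      using submersion_local_section[OF sm(1,2) principal_bundle_submersion[OF pb] p(1)] p(2) by blast
    have "smooth_map (open_submfd B W) P (inv_into (pts P) \<pi>)"
    proof (rule smooth_map_cong[OF smooth_atlas_open_submfd[OF sm(2) s(1)] s(3)])
      fix q assume q: "q \<in> pts (open_submfd B W)"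
      then have "s q \<in> pts P" "\<pi> (s q) = q" using smooth_map_in_pts[OF s(3) q] s(4) by auto
      then show "s q = inv_into (pts P) \<pi> q" using inj by (metis inv_into_f_f)
    qed
    then show "\<exists>W. openin (mtop B) W \<and> b \<in> W \<and> smooth_map (open_submfd B W) P (inv_into (pts P) \<pi>)"
      using s by blast
  qed
  then show ?thesis
    unfolding diffeomorphism_def using sm(3) inj surj
    by (intro conjI exI[of _ "inv_into (pts P) \<pi>"]) (auto simp: inv_into_f_f f_inv_into_f)
qed

section \<open>Lie groups, group bundles and change of objects\<close>

lemma lie_groupD:
  assumes "lie_group G MG"
  shows "group G" "smooth_manifold MG" "smooth_atlas MG" "pts MG = carrier G"
  using assms by (auto simp: lie_group_def smooth_manifold_atlas)

lemma smooth_map_mult: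
  assumes lg: "lie_group G MG" and P: "smooth_atlas P" and f: "smooth_map P MG f" and g: "smooth_map P MG g"
  shows "smooth_map P MG (\<lambda>p. f p \<otimes>\<^bsub>G\<^esub> g p)"
proof -
  have "smooth_map (prod_mfd MG MG) MG (\<lambda>(g, h). g \<otimes>\<^bsub>G\<^esub> h)" using lg by (simp add: lie_group_def)
  from smooth_map_compose[OF P smooth_atlas_prod_mfd lie_groupD(3)[OF lg] smooth_map_Pair[OF f g] this]
  show ?thesis using lie_groupD(3)[OF lg] by simp
qed

lemma smooth_map_inv:
  assumes lg: "lie_group G MG" and P: "smooth_atlas P" and f: "smooth_map P MG f"
  shows "smooth_map P MG (\<lambda>p. inv\<^bsub>G\<^esub> (f p))"
proof -
  have "smooth_map MG MG (\<lambda>g. inv\<^bsub>G\<^esub> g)" using lg by (simp add: lie_group_def)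
  from smooth_map_compose[OF P lie_groupD(3)[OF lg] lie_groupD(3)[OF lg] f this] show ?thesis .
qed

lemma smooth_map_fst_comp:
  assumes "smooth_atlas P" "smooth_atlas M" "smooth_atlas N" "smooth_map P (prod_mfd M N) f"
  shows "smooth_map P M (\<lambda>p. fst (f p))"
  using smooth_map_compose[OF assms(1) smooth_atlas_prod_mfd[OF assms(2,3)] assms(2,4) smooth_map_fst[OF assms(2,3)]] .

lemma smooth_map_snd_comp:
  assumes "smooth_atlas P" "smooth_atlas M" "smooth_atlas N" "smooth_map P (prod_mfd M N) f"
  shows "smooth_map P N (\<lambda>p. snd (f p))"
  using smooth_map_compose[OF assms(1) smooth_atlas_prod_mfd[OF assms(2,3)] assms(3,4) smooth_map_snd[OF assms(2,3)]] .

lemma group_bundle_simps [simp]: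
  "Mor (group_bundle M G MG) = prod_mfd M MG" "Obj (group_bundle M G MG) = M"
  "src (group_bundle M G MG) = fst" "tgt (group_bundle M G MG) = fst"
  "cmp (group_bundle M G MG) (x, g) (y, h) = (x, g \<otimes>\<^bsub>G\<^esub> h)"
  "idm (group_bundle M G MG) x = (x, \<one>\<^bsub>G\<^esub>)"
  by (simp_all add: group_bundle_def)

lemma lie_groupoid_group_bundle:
  fixes M :: "('x, 'ex::euclidean_space) mfd" and MG :: "('g, 'eg::euclidean_space) mfd"
  assumes M: "smooth_manifold M" and lg: "lie_group G MG"
  shows "lie_groupoid (group_bundle M G MG)"
proof -
  interpret group G using lie_groupD(1)[OF lg] .
  let ?C = "group_bundle M G MG"
  note MG = lie_groupD(2-4)[OF lg]
  have aM: "smooth_atlas M" using M by (rule smooth_manifold_atlas)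
  have aP: "smooth_atlas (prod_mfd M MG)" by (rule smooth_atlas_prod_mfd[OF aM MG(2)])
  have aPP: "smooth_atlas (prod_mfd (prod_mfd M MG) (prod_mfd M MG))" by (rule smooth_atlas_prod_mfd[OF aP aP])
  have f1: "smooth_map (prod_mfd M MG) M fst" and s1: "smooth_map (prod_mfd M MG) MG snd"
    using smooth_map_fst smooth_map_snd aM MG(2) by blast+
  have cat: "is_category ?C"
    unfolding is_category_def composable_def by (auto simp: MG(3) m_assoc)
  have inv: "is_inverse ?C z w \<longleftrightarrow> w = (fst z, inv\<^bsub>G\<^esub> (snd z))" if "z \<in> pts (Mor ?C)" for z w
  proof -
    obtain x g y h where z: "z = (x, g)" "w = (y, h)" by force
    have "h = inv\<^bsub>G\<^esub> g" if "h \<in> carrier G" "h \<otimes>\<^bsub>G\<^esub> g = \<one>\<^bsub>G\<^esub>" "g \<in> carrier G"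
      using that inv_equality by metis
    then show ?thesis using that by (auto simp: z is_inverse_def MG(3))
  qed
  have "smooth_map (prod_mfd M MG) (prod_mfd M MG) (\<lambda>z. (fst z, inv\<^bsub>G\<^esub> (snd z)))"
    by (intro smooth_map_Pair f1 smooth_map_inv[OF lg aP s1])
  then have sinv: "smooth_map (prod_mfd M MG) (prod_mfd M MG) (\<lambda>z. THE w. is_inverse ?C z w)"
    by (rule smooth_map_cong[OF aP]) (use inv in simp)
  have "smooth_map M (prod_mfd M MG) (\<lambda>x. (x, \<one>\<^bsub>G\<^esub>))"
    by (intro smooth_map_Pair smooth_map_id[OF aM] smooth_map_const) (simp add: MG(3))
  then have sid: "smooth_map M (prod_mfd M MG) (idm ?C)" by (simp add: group_bundle_def)
  have "smooth_map (prod_mfd (prod_mfd M MG) (prod_mfd M MG)) (prod_mfd M MG)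
      (\<lambda>z. (fst (fst z), snd (fst z) \<otimes>\<^bsub>G\<^esub> snd (snd z)))"
    by (intro smooth_map_Pair smooth_map_mult[OF lg aPP] smooth_map_fst_comp[OF aPP aM MG(2)]
        smooth_map_snd_comp[OF aPP aM MG(2)] smooth_map_fst[OF aP aP] smooth_map_snd[OF aP aP])
  then have "smooth_map (prod_mfd (prod_mfd M MG) (prod_mfd M MG)) (prod_mfd M MG)
      (\<lambda>(z, w). cmp ?C z w)"
    by (rule smooth_map_cong[OF aPP]) (auto simp: MG(3))
  then have scmp: "smooth_on_subset (prod_mfd (prod_mfd M MG) (prod_mfd M MG)) (composable ?C)
      (prod_mfd M MG) (\<lambda>(z, w). cmp ?C z w)"
    by (rule smooth_on_subset_if_smooth_map[OF aPP]) (auto simp: composable_def)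
  have sub: "submersion (prod_mfd M MG) M fst"
  proof (rule submersionI_local_sections[OF aP aM f1])
    fix p assume "p \<in> pts (prod_mfd M MG)"
    then have p: "fst p \<in> pts M" "snd p \<in> pts MG" by auto
    have "smooth_map (open_submfd M (pts M)) (prod_mfd M MG) (\<lambda>x. (x, snd p))"
      by (rule smooth_map_restrict[OF aM]) (intro smooth_map_Pair smooth_map_id[OF aM] smooth_map_const p)
    then show "\<exists>W s. openin (mtop M) W \<and> fst p \<in> W \<and> smooth_map (open_submfd M W) (prod_mfd M MG) s \<and>
        s (fst p) = p \<and> (\<forall>q\<in>W. fst (s q) = q)"
      using p by (intro exI[of _ "pts M"] exI[of _ "\<lambda>x. (x, snd p)"]) simp
  qed
  have "\<exists>w. is_inverse ?C z w" if "z \<in> pts (Mor ?C)" for z using inv[OF that] by blast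
  then show ?thesis
    unfolding lie_groupoid_def
    using cat sinv sid scmp sub M smooth_manifold_prod_mfd[OF M MG(1)] by simp
qed

lemma identify_objects_simps [simp]:
  "Mor (identify_objects f B E) = Mor E" "Obj (identify_objects f B E) = B"
  "src (identify_objects f B E) \<gamma> = f (src E \<gamma>)" "tgt (identify_objects f B E) \<gamma> = f (tgt E \<gamma>)"
  "cmp (identify_objects f B E) = cmp E"
  "idm (identify_objects f B E) x = idm E (inv_into (pts (Obj E)) f x)"
  by (simp_all add: identify_objects_def)

lemma lie_groupoid_identify_objects:
  fixes E :: "('m, 'em::euclidean_space, 'o, 'eo::euclidean_space) smcat"
    and B :: "('b, 'eb::euclidean_space) mfd"
  assumes E: "lie_groupoid E" and B: "smooth_manifold B" and f: "diffeomorphism (Obj E) B f"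
  shows "lie_groupoid (identify_objects f B E)"
proof -
  interpret lie_gpd E by (rule lie_gpd.intro[OF E])
  let ?C = "identify_objects f B E" and ?g = "inv_into (pts (Obj E)) f"
  have aB: "smooth_atlas B" using B by (rule smooth_manifold_atlas)
  note d = diffeomorphism_inv_into[OF atlas_Obj aB f]
  have fin: "f x \<in> pts B" if "x \<in> pts (Obj E)" for x using d(1) that bij_betwE by blast
  have gin: "?g y \<in> pts (Obj E)" if "y \<in> pts B" for y using smooth_map_in_pts[OF d(3) that] .
  have gf: "?g (f x) = x" if "x \<in> pts (Obj E)" for x using d(1) that by (rule bij_betw_inv_into_left)
  have fg: "f (?g y) = y" if "y \<in> pts B" for y using d(1) that by (rule bij_betw_inv_into_right)
  have feq: "f x = f y \<longleftrightarrow> x = y" if "x \<in> pts (Obj E)" "y \<in> pts (Obj E)" for x y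
    using gf that by metis
  have comp: "composable ?C = composable E"
    using feq src_in tgt_in unfolding composable_def by auto
  have cat': "is_category ?C"
    unfolding is_category_def comp
  proof (intro conjI)
    show "src ?C \<in> pts (Mor ?C) \<rightarrow> pts (Obj ?C)" "tgt ?C \<in> pts (Mor ?C) \<rightarrow> pts (Obj ?C)"
      "idm ?C \<in> pts (Obj ?C) \<rightarrow> pts (Mor ?C)"
      using fin src_in tgt_in id_in gin by auto
    show "\<forall>x\<in>pts (Obj ?C). src ?C (idm ?C x) = x \<and> tgt ?C (idm ?C x) = x"
      using src_id tgt_id gin fg by simp
    show "\<forall>(\<gamma>2, \<gamma>1)\<in>composable E. cmp ?C \<gamma>2 \<gamma>1 \<in> pts (Mor ?C) \<and>
        src ?C (cmp ?C \<gamma>2 \<gamma>1) = src ?C \<gamma>1 \<and> tgt ?C (cmp ?C \<gamma>2 \<gamma>1) = tgt ?C \<gamma>2"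
      using cmp_in src_cmp tgt_cmp by (auto simp: composable_def)
    show "\<forall>\<gamma>\<in>pts (Mor ?C). cmp ?C \<gamma> (idm ?C (src ?C \<gamma>)) = \<gamma> \<and> cmp ?C (idm ?C (tgt ?C \<gamma>)) \<gamma> = \<gamma>"
      using gf src_in tgt_in id_left id_right by simp
    show "\<forall>\<gamma>3 \<gamma>2 \<gamma>1. (\<gamma>3, \<gamma>2) \<in> composable E \<longrightarrow> (\<gamma>2, \<gamma>1) \<in> composable E \<longrightarrow>
        cmp ?C (cmp ?C \<gamma>3 \<gamma>2) \<gamma>1 = cmp ?C \<gamma>3 (cmp ?C \<gamma>2 \<gamma>1)"
      using assoc by (simp add: composable_def)
  qed
  have inv: "is_inverse ?C \<gamma> \<delta> \<longleftrightarrow> is_inverse E \<gamma> \<delta>" if "\<gamma> \<in> pts (Mor E)" for \<gamma> \<delta>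
  proof (cases "\<delta> \<in> pts (Mor E)")
    case True
    then show ?thesis using that feq src_in tgt_in gf unfolding is_inverse_def by simp
  qed (simp add: is_inverse_def)
  have sinv: "smooth_map (Mor ?C) (Mor ?C) (\<lambda>\<gamma>. THE \<delta>. is_inverse ?C \<gamma> \<delta>)"
    unfolding identify_objects_simps
    by (rule smooth_map_cong[OF atlas_Mor smooth_inverse]) (simp add: inv)
  have sid: "smooth_map (Obj ?C) (Mor ?C) (idm ?C)"
    using smooth_map_compose[OF aB atlas_Obj atlas_Mor d(3) smooth_id]
    by (simp add: identify_objects_def comp_def)
  have sub: "submersion (Mor E) B (\<lambda>\<gamma>. f (h \<gamma>))" if h: "submersion (Mor E) (Obj E) h" for h
  proof (rule submersionI_local_sections[OF atlas_Mor aB])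
    have sh: "smooth_map (Mor E) (Obj E) h" using h by (simp add: submersion_def)
    show "smooth_map (Mor E) B (\<lambda>\<gamma>. f (h \<gamma>))"
      by (rule smooth_map_compose[OF atlas_Mor atlas_Obj aB sh d(2)])
    fix p assume p: "p \<in> pts (Mor E)"
    obtain W s where W: "openin (mtop (Obj E)) W" "h p \<in> W" "smooth_map (open_submfd (Obj E) W) (Mor E) s"
      "s (h p) = p" "\<forall>q\<in>W. h (s q) = q"
      using submersion_local_section[OF atlas_Mor atlas_Obj h p] by blast
    let ?W = "{y \<in> pts B. ?g y \<in> W}"
    have op: "openin (mtop B) ?W" by (rule smooth_map_openin_vimage[OF d(3) W(1)])
    have aW: "smooth_atlas (open_submfd B ?W)" by (rule smooth_atlas_open_submfd[OF aB op])
    have "smooth_map (open_submfd B ?W) (open_submfd (Obj E) W) ?g"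
      by (rule smooth_map_into_open_submfd[OF smooth_map_restrict[OF aB d(3)]]) auto
    then have "smooth_map (open_submfd B ?W) (Mor E) (\<lambda>y. s (?g y))"
      by (rule smooth_map_compose[OF aW smooth_atlas_open_submfd[OF atlas_Obj W(1)] atlas_Mor _ W(3)])
    moreover have "f (h p) \<in> ?W" "s (?g (f (h p))) = p"
      using W(2,4) smooth_map_in_pts[OF sh p] fin gf by auto
    moreover have "\<forall>q\<in>?W. f (h (s (?g q))) = q" using W(5) fg by simp
    ultimately show "\<exists>W s. openin (mtop B) W \<and> f (h p) \<in> W \<and> smooth_map (open_submfd B W) (Mor E) s \<and>
        s (f (h p)) = p \<and> (\<forall>q\<in>W. f (h (s q)) = q)"
      using op by blast
  qed
  have "submersion (Mor ?C) (Obj ?C) (src ?C)" "submersion (Mor ?C) (Obj ?C) (tgt ?C)"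
    using sub[OF submersion_src] sub[OF submersion_tgt] by (simp_all add: identify_objects_def comp_def)
  moreover have "\<forall>\<gamma>\<in>pts (Mor ?C). \<exists>\<delta>. is_inverse ?C \<gamma> \<delta>"
    using inv is_inverse_inverse_mor by auto
  moreover have "smooth_on_subset (prod_mfd (Mor ?C) (Mor ?C)) (composable ?C) (Mor ?C) (\<lambda>(\<gamma>2, \<gamma>1). cmp ?C \<gamma>2 \<gamma>1)"
    using E by (simp add: comp lie_groupoid_def)
  ultimately show ?thesis
    unfolding lie_groupoid_def using cat' sinv sid manifold_Mor B by simp
qed

lemma one_object_2_group_simps [simp]:
  "Mor (one_object_2_group G MG) = MG" "Obj (one_object_2_group G MG) = point_mfd"
  "src (one_object_2_group G MG) = (\<lambda>_. ())" "tgt (one_object_2_group G MG) = (\<lambda>_. ())"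
  "cmp (one_object_2_group G MG) = (\<lambda>k h. k \<otimes>\<^bsub>G\<^esub> h)" "idm (one_object_2_group G MG) = (\<lambda>_. \<one>\<^bsub>G\<^esub>)"
  "gmor (one_object_2_group G MG) = G"
  "gobj (one_object_2_group G MG) = \<lparr>carrier = UNIV, monoid.mult = (\<lambda>_ _. ()), one = ()\<rparr>"
  by (simp_all add: one_object_2_group_def)

lemma twisted_category_simps [simp]:
  "Mor (twisted_category E \<G> \<eta>) = prod_mfd (Mor E) (Mor \<G>)"
  "Obj (twisted_category E \<G> \<eta>) = prod_mfd (Obj E) (Obj \<G>)"
  "src (twisted_category E \<G> \<eta>) = map_prod (src E) (src \<G>)"
  "tgt (twisted_category E \<G> \<eta>) = map_prod (tgt E) (tgt \<G>)"
  "cmp (twisted_category E \<G> \<eta>) (\<gamma>2, k2) (\<gamma>1, k1) = (cmp E \<gamma>2 (\<eta> \<gamma>1 k2), cmp \<G> k2 k1)"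
  "idm (twisted_category E \<G> \<eta>) = map_prod (idm E) (idm \<G>)"
  by (simp_all add: twisted_category_def)

lemma pts_point_mfd [simp]: "pts point_mfd = UNIV"
  by (simp add: point_mfd_def)

section \<open>From twisted principal bundles to extensions\<close>

text \<open>
  The sequence is exact at the middle term because \<open>G\<close> acts transitively on the fibre of \<open>\<pi>1\<close> over
  a unit. The map \<open>i\<close> is a functor because \<open>\<eta>\<close> fixes units: on a pair of units the functoriality of
  the action reads \<open>\<rho>1 1\<^sub>x (k2 k1) = \<rho>1 1\<^sub>x k2 \<circ> \<rho>1 1\<^sub>x k1\<close>.
\<close>

theorem twisted_principal_bundle_extension:
  fixes X :: "('n, 'en::euclidean_space, 'p, 'ep::euclidean_space) smcat"
    and E :: "('m, 'em::euclidean_space, 'o, 'eo::euclidean_space) smcat"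
    and MG :: "('g, 'eg::euclidean_space) mfd"
  assumes tpb: "twisted_principal_bundle (one_object_2_group G MG) X E \<pi>1 \<pi>0 \<eta> \<rho>1 \<rho>0"
  defines "E' \<equiv> identify_objects \<pi>0 (Obj X) E"
  shows "diffeomorphism (Obj E) (Obj X) \<pi>0"
    and "lie_groupoid_extension G MG (Obj X) E' X (\<lambda>(x, g). \<rho>1 (idm E' x) g) \<pi>1"
proof -
  have X: "lie_groupoid X" and E: "lie_groupoid E" and pi: "smooth_functor E X \<pi>1 \<pi>0"
    and act: "twisted_action (one_object_2_group G MG) E \<eta> \<rho>1 \<rho>0"
    and pb1: "principal_bundle G MG (Mor E) (Mor X) \<pi>1 \<rho>1"
    and pb0: "principal_bundle (gobj (one_object_2_group G MG)) point_mfd (Obj E) (Obj X) \<pi>0 \<rho>0"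
    using tpb by (simp_all add: twisted_principal_bundle_def)
  interpret X: lie_gpd X by (rule lie_gpd.intro[OF X])
  interpret E: lie_gpd E by (rule lie_gpd.intro[OF E])
  show diff: "diffeomorphism (Obj E) (Obj X) \<pi>0"
    by (rule principal_bundle_trivial_group_diffeomorphism[OF pb0]) auto
  note d = diffeomorphism_inv_into[OF E.atlas_Obj X.atlas_Obj diff]
  have E': "lie_groupoid E'"
    unfolding E'_def by (rule lie_groupoid_identify_objects[OF E X.manifold_Obj diff])
  interpret E': lie_gpd E' by (rule lie_gpd.intro[OF E'])
  have E'_simps: "Mor E' = Mor E" "Obj E' = Obj X" "cmp E' = cmp E"
    "\<And>\<gamma>. src E' \<gamma> = \<pi>0 (src E \<gamma>)" "\<And>\<gamma>. tgt E' \<gamma> = \<pi>0 (tgt E \<gamma>)"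
    by (simp_all add: E'_def)
  have ra1: "right_lie_action G MG (Mor E) \<rho>1" and ra0: "right_lie_action (gobj (one_object_2_group G MG)) point_mfd (Obj E) \<rho>0"
    and adm: "admissible E (one_object_2_group G MG) \<eta>"
    and func: "smooth_functor (twisted_category E (one_object_2_group G MG) \<eta>) E
      (\<lambda>(\<gamma>, k). \<rho>1 \<gamma> k) (\<lambda>(x, a). \<rho>0 x a)"
    using act by (simp_all add: twisted_action_def)
  have lg: "lie_group G MG" using ra1 by (simp add: right_lie_action_def)
  interpret group G using lie_groupD(1)[OF lg] .
  note MG = lie_groupD(2-4)[OF lg]
  have rho0: "\<rho>0 x a = x" if "x \<in> pts (Obj E)" for x a
    using ra0 that by (simp add: right_lie_action_def)
  have rho1_one: "\<rho>1 \<gamma> \<one>\<^bsub>G\<^esub> = \<gamma>" if "\<gamma> \<in> pts (Mor E)" for \<gamma>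
    using ra1 that by (simp add: right_lie_action_def)
  have rho1_src: "src E (\<rho>1 \<gamma> k) = src E \<gamma>" "tgt E (\<rho>1 \<gamma> k) = tgt E \<gamma>"
    if "\<gamma> \<in> pts (Mor E)" "k \<in> carrier G" for \<gamma> k
    using func that rho0 E.src_in E.tgt_in MG(3) unfolding smooth_functor_def by auto
  have rho1_cmp: "\<rho>1 (cmp E \<gamma>2 (\<eta> \<gamma>1 k2)) (k2 \<otimes>\<^bsub>G\<^esub> k1) = cmp E (\<rho>1 \<gamma>2 k2) (\<rho>1 \<gamma>1 k1)"
    if "\<gamma>2 \<in> pts (Mor E)" "\<gamma>1 \<in> pts (Mor E)" "src E \<gamma>2 = tgt E \<gamma>1" "k2 \<in> carrier G" "k1 \<in> carrier G"
    for \<gamma>2 \<gamma>1 k2 k1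
  proof -
    have "((\<gamma>2, k2), (\<gamma>1, k1)) \<in> composable (twisted_category E (one_object_2_group G MG) \<eta>)"
      using that MG(3) by (simp add: composable_def)
    then show ?thesis using func unfolding smooth_functor_def by fastforce
  qed
  have pi1: "\<pi>1 (idm E' x) = idm X x" if "x \<in> pts (Obj X)" for x
  proof -
    have "inv_into (pts (Obj E)) \<pi>0 x \<in> pts (Obj E)" using smooth_map_in_pts[OF d(3) that] .
    then show ?thesis
      using pi bij_betw_inv_into_right[OF d(1) that] by (simp add: smooth_functor_def E'_def)
  qed
  let ?i = "\<lambda>(x, g). \<rho>1 (idm E' x) g"
  have idE': "idm E' x \<in> pts (Mor E)" if "x \<in> pts (Obj X)" for x
    using E'.id_in that by (simp add: E'_simps)
  have smi: "smooth_map (prod_mfd (Obj X) MG) (Mor E) ?i"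
  proof -
    have aP: "smooth_atlas (prod_mfd (Obj X) MG)" by (rule smooth_atlas_prod_mfd[OF X.atlas_Obj MG(2)])
    have "smooth_map (prod_mfd (Obj X) MG) (Mor E) (\<lambda>z. idm E' (fst z))"
      using smooth_map_compose[OF aP X.atlas_Obj E.atlas_Mor smooth_map_fst[OF X.atlas_Obj MG(2)]]
        E'.smooth_id by (simp add: E'_simps)
    then have "smooth_map (prod_mfd (Obj X) MG) (prod_mfd (Mor E) MG) (\<lambda>z. (idm E' (fst z), snd z))"
      by (rule smooth_map_Pair[OF _ smooth_map_snd[OF X.atlas_Obj MG(2)]])
    moreover have "smooth_map (prod_mfd (Mor E) MG) (Mor E) (\<lambda>(p, g). \<rho>1 p g)"
      using ra1 by (simp add: right_lie_action_def)
    ultimately show ?thesis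
      using smooth_map_compose[OF aP smooth_atlas_prod_mfd[OF E.atlas_Mor MG(2)] E.atlas_Mor]
      by (fastforce simp: case_prod_unfold)
  qed
  have i_in: "\<rho>1 (idm E' x) g \<in> pts (Mor E)" if "x \<in> pts (Obj X)" "g \<in> carrier G" for x g
    using smooth_map_in_pts[OF smi, of "(x, g)"] that MG(3) by simp
  have src_i: "src E' (\<rho>1 (idm E' x) g) = x" "tgt E' (\<rho>1 (idm E' x) g) = x"
    if "x \<in> pts (Obj X)" "g \<in> carrier G" for x g
    using rho1_src[OF idE' that(2)] that(1) E'.src_id E'.tgt_id by (simp_all add: E'_simps)
  have i_cmp: "\<rho>1 (idm E' x) (g \<otimes>\<^bsub>G\<^esub> h) = cmp E' (\<rho>1 (idm E' x) g) (\<rho>1 (idm E' x) h)"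
    if x: "x \<in> pts (Obj X)" and gh: "g \<in> carrier G" "h \<in> carrier G" for x g h
  proof -
    define y where "y = inv_into (pts (Obj E)) \<pi>0 x"
    have y: "y \<in> pts (Obj E)" "idm E' x = idm E y"
      using smooth_map_in_pts[OF d(3) x] by (simp_all add: y_def E'_def)
    have "\<eta> (idm E y) g = idm E y" using adm y(1) gh(1) MG(3) by (simp add: admissible_def)
    moreover have "cmp E (idm E y) (idm E y) = idm E y"
      using E.id_right[OF E.id_in[OF y(1)]] E.src_id[OF y(1)] by simp
    ultimately show ?thesis
      using rho1_cmp[of "idm E y" "idm E y" g h] gh E.id_in[OF y(1)] E.src_id[OF y(1)] E.tgt_id[OF y(1)]
      by (simp add: y(2) E'_simps)
  qed
  have f1: "smooth_functor (group_bundle (Obj X) G MG) E' ?i (\<lambda>x. x)"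
    unfolding smooth_functor_def
  proof (intro conjI)
    show "smooth_map (Mor (group_bundle (Obj X) G MG)) (Mor E') ?i"
      "smooth_map (Obj (group_bundle (Obj X) G MG)) (Obj E') (\<lambda>x. x)"
      using smi smooth_map_id[OF X.atlas_Obj] by (simp_all add: E'_simps(1,2))
    show "\<forall>\<gamma>\<in>pts (Mor (group_bundle (Obj X) G MG)). src E' (?i \<gamma>) = src (group_bundle (Obj X) G MG) \<gamma> \<and>
        tgt E' (?i \<gamma>) = tgt (group_bundle (Obj X) G MG) \<gamma>"
      using src_i MG(3) by auto
    show "\<forall>x\<in>pts (Obj (group_bundle (Obj X) G MG)). ?i (idm (group_bundle (Obj X) G MG) x) = idm E' x"
      using rho1_one idE' by simp
    show "\<forall>(\<gamma>2, \<gamma>1)\<in>composable (group_bundle (Obj X) G MG).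
        ?i (cmp (group_bundle (Obj X) G MG) \<gamma>2 \<gamma>1) = cmp E' (?i \<gamma>2) (?i \<gamma>1)"
      using i_cmp MG(3) by (auto simp: composable_def)
  qed
  have sm_pi1: "smooth_map (Mor E) (Mor X) \<pi>1" using pi by (simp add: smooth_functor_def)
  have f2: "smooth_functor E' X \<pi>1 (\<lambda>x. x)"
    unfolding smooth_functor_def
  proof (intro conjI)
    show "smooth_map (Mor E') (Mor X) \<pi>1" "smooth_map (Obj E') (Obj X) (\<lambda>x. x)"
      using sm_pi1 smooth_map_id[OF X.atlas_Obj] by (simp_all add: E'_simps(1,2))
    show "\<forall>\<gamma>\<in>pts (Mor E'). src X (\<pi>1 \<gamma>) = src E' \<gamma> \<and> tgt X (\<pi>1 \<gamma>) = tgt E' \<gamma>"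
      using pi by (simp add: smooth_functor_def E'_simps)
    show "\<forall>x\<in>pts (Obj E'). \<pi>1 (idm E' x) = idm X x" using pi1 by (simp add: E'_simps)
    have "composable E' \<subseteq> composable E"
      using bij_betw_imp_inj_on[OF d(1)] E.src_in E.tgt_in
      by (auto simp: composable_def E'_simps dest: inj_onD)
    then show "\<forall>(\<gamma>2, \<gamma>1)\<in>composable E'. \<pi>1 (cmp E' \<gamma>2 \<gamma>1) = cmp X (\<pi>1 \<gamma>2) (\<pi>1 \<gamma>1)"
      using pi unfolding smooth_functor_def E'_simps by blast
  qed
  have act_pi: "\<pi>1 (\<rho>1 \<gamma> g) = \<pi>1 \<gamma>" if "\<gamma> \<in> pts (Mor E)" "g \<in> carrier G" for \<gamma> g
  proof -
    have b: "\<pi>1 \<gamma> \<in> pts (Mor X)" using smooth_map_in_pts[OF sm_pi1 that(1)] .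
    obtain U \<Phi> \<kappa> where "\<pi>1 \<gamma> \<in> U" "\<forall>p\<in>pts (Mor E). \<pi>1 p \<in> U \<longrightarrow>
        (\<forall>g\<in>carrier G. \<kappa> (\<rho>1 p g) = \<kappa> p \<otimes>\<^bsub>G\<^esub> g \<and> \<pi>1 (\<rho>1 p g) = \<pi>1 p)"
      by (rule principal_bundle_trivialization[OF pb1 b])
    then show ?thesis using that by blast
  qed
  have emb: "smooth_embedding (prod_mfd (Obj X) MG) (Mor E) ?i"
  proof (rule smooth_embeddingI_local_retractions[OF smooth_atlas_prod_mfd[OF X.atlas_Obj MG(2)] E.atlas_Mor smi])
    fix p assume "p \<in> pts (prod_mfd (Obj X) MG)"
    then obtain x0 g0 where p: "p = (x0, g0)" "x0 \<in> pts (Obj X)" "g0 \<in> carrier G" using MG(3) by auto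
    obtain U \<Phi> \<kappa> where U: "openin (mtop (Mor X)) U" "idm X x0 \<in> U"
      "openin (mtop (Mor E)) {p \<in> pts (Mor E). \<pi>1 p \<in> U}"
      "smooth_map (open_submfd (Mor E) {p \<in> pts (Mor E). \<pi>1 p \<in> U}) MG \<kappa>"
      "\<forall>p\<in>pts (Mor E). \<pi>1 p \<in> U \<longrightarrow> \<kappa> p \<in> carrier G \<and> \<Phi> (\<pi>1 p, \<kappa> p) = p"
      "\<forall>p\<in>pts (Mor E). \<pi>1 p \<in> U \<longrightarrow>
        (\<forall>g\<in>carrier G. \<kappa> (\<rho>1 p g) = \<kappa> p \<otimes>\<^bsub>G\<^esub> g \<and> \<pi>1 (\<rho>1 p g) = \<pi>1 p)"
      by (rule principal_bundle_trivialization[OF pb1 X.id_in[OF p(2)]])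
    let ?V = "{p \<in> pts (Mor E). \<pi>1 p \<in> U}"
    have src': "smooth_map (Mor E) (Obj X) (src E')" using E'.smooth_src by (simp add: E'_simps(1,2))
    have id': "smooth_map (Obj X) (Mor E) (idm E')" using E'.smooth_id by (simp add: E'_simps(1,2))
    have ids: "smooth_map (Mor E) (Mor E) (\<lambda>e. idm E' (src E' e))"
      by (rule smooth_map_compose[OF E.atlas_Mor X.atlas_Obj E.atlas_Mor src' id'])
    \<comment> \<open>The retraction compares \<open>e\<close> with the unit at its source, both read in one trivialization;
      it returns \<open>g\<close> because \<open>\<kappa> (\<rho>1 1\<^sub>x g) = \<kappa> 1\<^sub>x \<otimes> g\<close>.\<close>
    define W where "W = {e \<in> pts (Mor E). idm E' (src E' e) \<in> ?V} \<inter> ?V"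
    have W: "openin (mtop (Mor E)) W"
      unfolding W_def using smooth_map_openin_vimage[OF ids U(3)] U(3) by (rule openin_Int)
    have aW: "smooth_atlas (open_submfd (Mor E) W)" by (rule smooth_atlas_open_submfd[OF E.atlas_Mor W])
    have aV: "smooth_atlas (open_submfd (Mor E) ?V)" by (rule smooth_atlas_open_submfd[OF E.atlas_Mor U(3)])
    have k1: "smooth_map (open_submfd (Mor E) W) MG (\<lambda>e. \<kappa> (idm E' (src E' e)))"
      by (rule smooth_map_compose[OF aW aV MG(2) smooth_map_into_open_submfd[OF smooth_map_restrict[OF E.atlas_Mor ids]] U(4)])
        (auto simp: W_def)
    have k2: "smooth_map (open_submfd (Mor E) W) MG \<kappa>"
      by (rule smooth_map_compose[OF aW aV MG(2) smooth_map_into_open_submfd[OF smooth_map_restrict[OF E.atlas_Mor smooth_map_id[OF E.atlas_Mor]]] U(4)])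
        (auto simp: W_def)
    let ?r = "\<lambda>e. (src E' e, inv\<^bsub>G\<^esub> (\<kappa> (idm E' (src E' e))) \<otimes>\<^bsub>G\<^esub> \<kappa> e)"
    have r: "smooth_map (open_submfd (Mor E) W) (prod_mfd (Obj X) MG) ?r"
      by (intro smooth_map_Pair smooth_map_mult[OF lg aW] smooth_map_inv[OF lg aW] k1 k2
          smooth_map_restrict[OF E.atlas_Mor src'])
    have retr: "?r (?i q) = q" if q: "q \<in> pts (prod_mfd (Obj X) MG)" "?i q \<in> W" for q
    proof -
      obtain x g where xg: "q = (x, g)" "x \<in> pts (Obj X)" "g \<in> carrier G" using q(1) MG(3) by auto
      have s: "src E' (\<rho>1 (idm E' x) g) = x" using src_i xg by simp
      then have v: "idm E' x \<in> ?V" using q(2) xg(1) unfolding W_def by auto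
      then have "\<kappa> (\<rho>1 (idm E' x) g) = \<kappa> (idm E' x) \<otimes>\<^bsub>G\<^esub> g" "\<kappa> (idm E' x) \<in> carrier G"
        using U(5,6) xg(3) by auto
      then show ?thesis using s xg by (simp flip: m_assoc)
    qed
    have "?i p \<in> W"
      using p i_in src_i pi1 act_pi idE' U(2) by (simp add: W_def)
    then show "\<exists>W r. openin (mtop (Mor E)) W \<and> ?i p \<in> W \<and>
        smooth_map (open_submfd (Mor E) W) (prod_mfd (Obj X) MG) r \<and>
        (\<forall>q\<in>pts (prod_mfd (Obj X) MG). ?i q \<in> W \<longrightarrow> r (?i q) = q)"
      using W r retr by blast
  qed
  have inj: "inj_on ?i (pts (Obj X) \<times> carrier G)"
    using emb MG(3) by (simp add: smooth_embedding_def embedding_map_def homeomorphic_map_def)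
  have img: "?i ` (pts (Obj X) \<times> carrier G) = {\<gamma> \<in> pts (Mor E). \<exists>x\<in>pts (Obj X). \<pi>1 \<gamma> = idm X x}"
  proof (intro equalityI subsetI)
    fix \<gamma> assume "\<gamma> \<in> ?i ` (pts (Obj X) \<times> carrier G)"
    then obtain x g where "x \<in> pts (Obj X)" "g \<in> carrier G" "\<gamma> = \<rho>1 (idm E' x) g" by auto
    then show "\<gamma> \<in> {\<gamma> \<in> pts (Mor E). \<exists>x\<in>pts (Obj X). \<pi>1 \<gamma> = idm X x}"
      using i_in act_pi[OF idE'] pi1 by auto
  next
    fix \<gamma> assume "\<gamma> \<in> {\<gamma> \<in> pts (Mor E). \<exists>x\<in>pts (Obj X). \<pi>1 \<gamma> = idm X x}"
    then obtain x where x: "\<gamma> \<in> pts (Mor E)" "x \<in> pts (Obj X)" "\<pi>1 (idm E' x) = \<pi>1 \<gamma>" using pi1 by auto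
    obtain g where "g \<in> carrier G" "\<gamma> = \<rho>1 (idm E' x) g"
      by (rule principal_bundle_transitive[OF pb1 idE'[OF x(2)] x(1,3)])
    then show "\<gamma> \<in> ?i ` (pts (Obj X) \<times> carrier G)" using x(2) by force
  qed
  show "lie_groupoid_extension G MG (Obj X) E' X ?i \<pi>1"
    unfolding lie_groupoid_extension_def
    using lg lie_groupoid_group_bundle[OF X.manifold_Obj lg] E' X f1 f2 emb inj img
      principal_bundle_submersion[OF pb1] principal_bundle_surj[OF pb1]
    by (simp add: E'_simps(1,2))
qed

section \<open>From extensions to twisted principal bundles\<close>

lemma smooth_manifold_point_mfd: "smooth_manifold point_mfd"
proof -
  have ch: "is_chart point_mfd UNIV (\<lambda>_. 0)"
  proof (rule is_chartI)
    show "homeomorphic_maps (subtopology (mtop point_mfd) UNIV) (top_of_set (range (\<lambda>_. 0::real)))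
       (\<lambda>_. 0) (\<lambda>_. ())"
      by (auto simp: point_mfd_def homeomorphic_maps_def)
  qed (auto simp: point_mfd_def)
  have "smooth_atlas point_mfd"
    by (rule smooth_atlasI) (use ch in \<open>auto simp: point_mfd_def intro: Cinf_on_const\<close>)
  moreover have "second_countable_top (mtop point_mfd)"
  proof -
    have "\<exists>\<U>\<subseteq>UNIV. U = \<Union>\<U>" for U :: "unit set" by (rule exI[of _ "{U}"]) auto
    then show ?thesis
      unfolding second_countable_top_def
      by (intro exI[of _ UNIV]) (auto simp: point_mfd_def)
  qed
  ultimately show ?thesis
    by (simp add: smooth_manifold_iff point_mfd_def)
qed

abbreviation unit_group :: "unit monoid" where
  "unit_group \<equiv> \<lparr>carrier = UNIV, monoid.mult = (\<lambda>_ _. ()), one = ()\<rparr>"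

lemma lie_group_point: "lie_group unit_group point_mfd"
proof -
  have "group unit_group" by (rule groupI) auto
  moreover have "smooth_map (prod_mfd point_mfd point_mfd) point_mfd (\<lambda>(g, h). g \<otimes>\<^bsub>unit_group\<^esub> h)"
    using smooth_map_const[of "()" point_mfd "prod_mfd point_mfd point_mfd"] by (simp add: case_prod_unfold)
  moreover have "smooth_map point_mfd point_mfd (\<lambda>g. inv\<^bsub>unit_group\<^esub> g)"
    using smooth_map_const[of "()" point_mfd point_mfd] by simp
  ultimately show ?thesis by (simp add: lie_group_def smooth_manifold_point_mfd)
qed

lemma right_lie_action_point:
  fixes M :: "('x, 'ex::euclidean_space) mfd"
  assumes "smooth_atlas M"
  shows "right_lie_action unit_group point_mfd M (\<lambda>x _. x)"
  using smooth_map_fst[OF assms smooth_manifold_atlas[OF smooth_manifold_point_mfd]]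
  by (simp add: right_lie_action_def lie_group_point case_prod_unfold)

text \<open>
  The bundle of objects of the twisted principal bundle that comes from an extension.
\<close>

lemma principal_bundle_point:
  fixes M :: "('x, 'ex::euclidean_space) mfd"
  assumes M: "smooth_manifold M"
  shows "principal_bundle unit_group point_mfd M M (\<lambda>x. x) (\<lambda>x _. x)"
proof -
  have aM: "smooth_atlas M" using M by (rule smooth_manifold_atlas)
  note pt = smooth_manifold_atlas[OF smooth_manifold_point_mfd]
  have aM': "smooth_atlas (open_submfd M (pts M))" by (rule smooth_atlas_open_submfd[OF aM]) simp
  have "smooth_map (prod_mfd (open_submfd M (pts M)) point_mfd) (open_submfd M (pts M)) fst"
    by (rule smooth_map_fst[OF aM' pt])
  moreover have "smooth_map (open_submfd M (pts M)) (prod_mfd (open_submfd M (pts M)) point_mfd) (\<lambda>x. (x, ()))"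
    by (intro smooth_map_Pair smooth_map_id[OF aM'] smooth_map_const) simp
  ultimately have "diffeomorphism (prod_mfd (open_submfd M (pts M)) point_mfd) (open_submfd M (pts M)) fst"
    unfolding diffeomorphism_def by (intro conjI exI[of _ "\<lambda>x. (x, ())"]) auto
  moreover have "{p \<in> pts M. p \<in> pts M} = pts M" by blast
  ultimately show ?thesis
    unfolding principal_bundle_def
    using M smooth_map_id[OF aM] right_lie_action_point[OF aM]
    by (auto intro!: exI[of _ "pts M"] exI[of _ fst])
qed

text \<open>
  The interchange law, that multiplication is a functor, is commutativity of \<open>G\<close>.
\<close>

lemma lie_2_group_one_object:
  fixes MG :: "('g, 'eg::euclidean_space) mfd" and G :: "'g monoid"
  assumes lg: "lie_group G MG" and comm: "comm_group G"
  shows "lie_2_group (one_object_2_group G MG)"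
proof -
  interpret comm_group G by (rule comm)
  let ?C = "one_object_2_group G MG"
  note MG = lie_groupD(2-4)[OF lg]
  note pt = smooth_manifold_atlas[OF smooth_manifold_point_mfd]
  have cat: "is_category ?C"
    unfolding is_category_def composable_def by (auto simp: MG(3) m_assoc)
  have inv: "is_inverse ?C k h \<longleftrightarrow> h = inv\<^bsub>G\<^esub> k" if "k \<in> carrier G" for k h
  proof -
    have "h = inv\<^bsub>G\<^esub> k" if "h \<in> carrier G" "h \<otimes>\<^bsub>G\<^esub> k = \<one>\<^bsub>G\<^esub>"
      using that \<open>k \<in> carrier G\<close> inv_equality by metis
    then show ?thesis using that by (auto simp: is_inverse_def MG(3))
  qed
  have "smooth_map MG MG (\<lambda>k. inv\<^bsub>G\<^esub> k)" using lg by (simp add: lie_group_def)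
  then have sinv: "smooth_map MG MG (\<lambda>k. THE h. is_inverse ?C k h)"
    by (rule smooth_map_cong[OF MG(2)]) (simp add: inv MG(3))
  have sub: "submersion MG point_mfd (\<lambda>_. ())"
  proof (rule submersionI_local_sections[OF MG(2) pt smooth_map_const])
    fix k assume "k \<in> pts MG"
    then show "\<exists>W s. openin (mtop point_mfd) W \<and> () \<in> W \<and> smooth_map (open_submfd point_mfd W) MG s \<and>
        s () = k \<and> (\<forall>q\<in>W. () = q)"
      using openin_topspace[of "mtop point_mfd"]
      by (intro exI[of _ UNIV] exI[of _ "\<lambda>_. k"]) (auto intro: smooth_map_const)
  qed simp
  have aPP: "smooth_atlas (prod_mfd MG MG)" by (rule smooth_atlas_prod_mfd[OF MG(2,2)])
  have "smooth_map (prod_mfd MG MG) MG (\<lambda>(g, h). cmp ?C g h)" using lg by (simp add: lie_group_def)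
  then have scmp: "smooth_on_subset (prod_mfd MG MG) (composable ?C) MG (\<lambda>(g, h). cmp ?C g h)"
    by (rule smooth_on_subset_if_smooth_map[OF aPP]) (auto simp: composable_def)
  have sid: "smooth_map point_mfd MG (\<lambda>_. \<one>\<^bsub>G\<^esub>)" by (rule smooth_map_const) (simp add: MG(3))
  have "\<forall>k\<in>pts (Mor ?C). \<exists>h. is_inverse ?C k h" using inv MG(3) by simp
  then have "lie_groupoid ?C"
    unfolding lie_groupoid_def
    using cat sinv sub scmp sid MG(1) smooth_manifold_point_mfd by simp
  then show ?thesis
    unfolding lie_2_group_def
    using lg lie_group_point by (auto simp: composable_def MG(3) m_ac)
qed

text \<open>
  All algebraic identities hold because \<open>g \<mapsto> i (x, g)\<close> is a homomorphism into the isotropy group at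
  \<open>x\<close>. In the twisted composition the factor \<open>i (s \<gamma>1, k2\<^sup>-\<^sup>1)\<close> contributed by \<open>\<eta>\<close> cancels the first
  factor of \<open>i (s \<gamma>1, k2 k1)\<close>; this is the reason for the definition of \<open>\<eta>\<close>. Commutativity enters
  in \<open>\<eta> \<gamma> (k2 k1) = \<eta> (\<eta> \<gamma> k2) k1\<close>, where the right-hand side multiplies \<open>k1\<close> and \<open>k2\<close> in the
  opposite order.
\<close>

theorem lie_groupoid_extension_twisted_principal_bundle:
  fixes G :: "'g monoid" and MG :: "('g, 'eg::euclidean_space) mfd"
    and M :: "('x, 'ex::euclidean_space) mfd"
    and \<Gamma>2 :: "('m2, 'e2::euclidean_space, 'x, 'ex) smcat"
    and \<Gamma>1 :: "('m1, 'e1::euclidean_space, 'x, 'ex) smcat"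
  assumes comm: "comm_group G" and ext: "lie_groupoid_extension G MG M \<Gamma>2 \<Gamma>1 i \<phi>"
  shows "twisted_principal_bundle (one_object_2_group G MG) \<Gamma>1 \<Gamma>2 \<phi> (\<lambda>x. x)
    (\<lambda>\<gamma> g. cmp \<Gamma>2 (cmp \<Gamma>2 (i (tgt \<Gamma>2 \<gamma>, g)) \<gamma>) (i (src \<Gamma>2 \<gamma>, inv\<^bsub>G\<^esub> g)))
    (\<lambda>\<gamma> g. cmp \<Gamma>2 \<gamma> (i (src \<Gamma>2 \<gamma>, g)))
    (\<lambda>x _. x)"
proof -
  interpret comm_group G by (rule comm)
  have lg: "lie_group G MG" and Obj: "Obj \<Gamma>2 = M" "Obj \<Gamma>1 = M"
    and Gam: "lie_groupoid \<Gamma>2" "lie_groupoid \<Gamma>1"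
    and fi: "smooth_functor (group_bundle M G MG) \<Gamma>2 i (\<lambda>x. x)"
    and fphi: "smooth_functor \<Gamma>2 \<Gamma>1 \<phi> (\<lambda>x. x)"
    and emb: "smooth_embedding (prod_mfd M MG) (Mor \<Gamma>2) i"
    and sub: "submersion (Mor \<Gamma>2) (Mor \<Gamma>1) \<phi>" and surj: "\<phi> ` pts (Mor \<Gamma>2) = pts (Mor \<Gamma>1)"
    and inj: "inj_on i (pts M \<times> carrier G)"
    and ker: "i ` (pts M \<times> carrier G) = {\<gamma> \<in> pts (Mor \<Gamma>2). \<exists>x\<in>pts M. \<phi> \<gamma> = idm \<Gamma>1 x}"
    using ext unfolding lie_groupoid_extension_def by blast+
  interpret G2: lie_gpd \<Gamma>2 by (rule lie_gpd.intro[OF Gam(1)])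
  interpret G1: lie_gpd \<Gamma>1 by (rule lie_gpd.intro[OF Gam(2)])
  note MG = lie_groupD(2-4)[OF lg]
  note aM = G2.atlas_Obj[unfolded Obj]
  have aP: "smooth_atlas (prod_mfd M MG)" by (rule smooth_atlas_prod_mfd[OF aM MG(2)])
  have sm_i: "smooth_map (prod_mfd M MG) (Mor \<Gamma>2) i" using fi by (simp add: smooth_functor_def)
  have sm_phi: "smooth_map (Mor \<Gamma>2) (Mor \<Gamma>1) \<phi>" using fphi by (simp add: smooth_functor_def)
  have ends: "src \<Gamma>2 \<gamma> \<in> pts M" "tgt \<Gamma>2 \<gamma> \<in> pts M" if "\<gamma> \<in> pts (Mor \<Gamma>2)" for \<gamma>
    using G2.src_in[OF that] G2.tgt_in[OF that] Obj by simp_all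
  have i_in: "i (x, g) \<in> pts (Mor \<Gamma>2)" and i_src: "src \<Gamma>2 (i (x, g)) = x" and i_tgt: "tgt \<Gamma>2 (i (x, g)) = x"
    if "x \<in> pts M" "g \<in> carrier G" for x g
    using smooth_map_in_pts[OF sm_i, of "(x, g)"] fi that MG(3) by (auto simp: smooth_functor_def)
  have i_one: "i (x, \<one>\<^bsub>G\<^esub>) = idm \<Gamma>2 x" if "x \<in> pts M" for x
    using fi that by (simp add: smooth_functor_def)
  have i_cmp: "cmp \<Gamma>2 (i (x, g)) (i (x, h)) = i (x, g \<otimes>\<^bsub>G\<^esub> h)"
    if "x \<in> pts M" "g \<in> carrier G" "h \<in> carrier G" for x g h
  proof -
    have "((x, g), (x, h)) \<in> composable (group_bundle M G MG)" using that MG(3) by (simp add: composable_def)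
    then have "i (cmp (group_bundle M G MG) (x, g) (x, h)) = cmp \<Gamma>2 (i (x, g)) (i (x, h))"
      using fi unfolding smooth_functor_def by blast
    then show ?thesis by simp
  qed
  have i_cmp_left: "cmp \<Gamma>2 (i (x, g)) (cmp \<Gamma>2 (i (x, h)) \<delta>) = cmp \<Gamma>2 (i (x, g \<otimes>\<^bsub>G\<^esub> h)) \<delta>"
    if "\<delta> \<in> pts (Mor \<Gamma>2)" "tgt \<Gamma>2 \<delta> = x" "x \<in> pts M" "g \<in> carrier G" "h \<in> carrier G" for x g h \<delta>
    using G2.assoc[of "i (x, g)" "i (x, h)" \<delta>] that i_in i_src i_tgt i_cmp by simp
  have i_one_right: "cmp \<Gamma>2 \<gamma> (i (x, \<one>\<^bsub>G\<^esub>)) = \<gamma>" if "\<gamma> \<in> pts (Mor \<Gamma>2)" "x = src \<Gamma>2 \<gamma>" for \<gamma> x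
    using G2.id_right[OF that(1)] i_one ends(1)[OF that(1)] that(2) by simp
  have i_one_left: "cmp \<Gamma>2 (i (x, \<one>\<^bsub>G\<^esub>)) \<gamma> = \<gamma>" if "\<gamma> \<in> pts (Mor \<Gamma>2)" "x = tgt \<Gamma>2 \<gamma>" for \<gamma> x
    using G2.id_left[OF that(1)] i_one ends(2)[OF that(1)] that(2) by simp
  have cancel: "inv\<^bsub>G\<^esub> g \<otimes>\<^bsub>G\<^esub> (g \<otimes>\<^bsub>G\<^esub> h) = h" if "g \<in> carrier G" "h \<in> carrier G" for g h
    using that by (simp flip: m_assoc)
  \<comment> \<open>Rewriting with these rules associates composites to the right and merges adjacent
    values of \<open>i\<close>.\<close>
  note alg = G2.assoc G2.cmp_in G2.src_cmp G2.tgt_cmp ends i_in i_src i_tgt i_cmp i_cmp_left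
    i_one_left i_one_right cancel
  have phi_src: "src \<Gamma>1 (\<phi> \<gamma>) = src \<Gamma>2 \<gamma>" and phi_tgt: "tgt \<Gamma>1 (\<phi> \<gamma>) = tgt \<Gamma>2 \<gamma>"
    if "\<gamma> \<in> pts (Mor \<Gamma>2)" for \<gamma>
    using fphi that by (simp_all add: smooth_functor_def)
  have phi_id: "\<phi> (idm \<Gamma>2 x) = idm \<Gamma>1 x" if "x \<in> pts M" for x
    using fphi that Obj by (simp add: smooth_functor_def)
  have phi_cmp: "\<phi> (cmp \<Gamma>2 \<gamma> \<delta>) = cmp \<Gamma>1 (\<phi> \<gamma>) (\<phi> \<delta>)"
    if "\<gamma> \<in> pts (Mor \<Gamma>2)" "\<delta> \<in> pts (Mor \<Gamma>2)" "src \<Gamma>2 \<gamma> = tgt \<Gamma>2 \<delta>" for \<gamma> \<delta>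
  proof -
    have "(\<gamma>, \<delta>) \<in> composable \<Gamma>2" using that by (simp add: composable_def)
    then show ?thesis using fphi unfolding smooth_functor_def by blast
  qed
  have phi_i: "\<phi> (i (x, g)) = idm \<Gamma>1 x" if x: "x \<in> pts M" and g: "g \<in> carrier G" for x g
  proof -
    have "i (x, g) \<in> i ` (pts M \<times> carrier G)" using x g by blast
    then obtain y where y: "y \<in> pts M" "\<phi> (i (x, g)) = idm \<Gamma>1 y" unfolding ker by blast
    have "x = src \<Gamma>1 (\<phi> (i (x, g)))" using phi_src[OF i_in[OF x g]] i_src[OF x g] by simp
    then show ?thesis using y G1.src_id[of y] Obj by simp
  qed
  define \<rho> where "\<rho> \<gamma> g = cmp \<Gamma>2 \<gamma> (i (src \<Gamma>2 \<gamma>, g))" for \<gamma> g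
  define \<eta> where "\<eta> \<gamma> g = cmp \<Gamma>2 (cmp \<Gamma>2 (i (tgt \<Gamma>2 \<gamma>, g)) \<gamma>) (i (src \<Gamma>2 \<gamma>, inv\<^bsub>G\<^esub> g))" for \<gamma> g
  have rho: "\<rho> \<gamma> g \<in> pts (Mor \<Gamma>2)" "src \<Gamma>2 (\<rho> \<gamma> g) = src \<Gamma>2 \<gamma>" "tgt \<Gamma>2 (\<rho> \<gamma> g) = tgt \<Gamma>2 \<gamma>"
    if "\<gamma> \<in> pts (Mor \<Gamma>2)" "g \<in> carrier G" for \<gamma> g
    using that by (simp_all add: \<rho>_def alg)
  have rho_one: "\<rho> \<gamma> \<one>\<^bsub>G\<^esub> = \<gamma>" if "\<gamma> \<in> pts (Mor \<Gamma>2)" for \<gamma>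
    using that by (simp add: \<rho>_def alg)
  have rho_rho: "\<rho> (\<rho> \<gamma> g) h = \<rho> \<gamma> (g \<otimes>\<^bsub>G\<^esub> h)"
    if "\<gamma> \<in> pts (Mor \<Gamma>2)" "g \<in> carrier G" "h \<in> carrier G" for \<gamma> g h
    using that by (simp add: \<rho>_def alg)
  have phi_rho: "\<phi> (\<rho> \<gamma> g) = \<phi> \<gamma>" if "\<gamma> \<in> pts (Mor \<Gamma>2)" "g \<in> carrier G" for \<gamma> g
    using that phi_cmp[of \<gamma> "i (src \<Gamma>2 \<gamma>, g)"] phi_i G1.id_right[of "\<phi> \<gamma>"] phi_src
      smooth_map_in_pts[OF sm_phi] by (simp add: \<rho>_def alg)
  have eta: "\<eta> \<gamma> g \<in> pts (Mor \<Gamma>2)" "src \<Gamma>2 (\<eta> \<gamma> g) = src \<Gamma>2 \<gamma>" "tgt \<Gamma>2 (\<eta> \<gamma> g) = tgt \<Gamma>2 \<gamma>"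
    if "\<gamma> \<in> pts (Mor \<Gamma>2)" "g \<in> carrier G" for \<gamma> g
    using that by (simp_all add: \<eta>_def alg)
  have eta_cmp: "\<eta> (cmp \<Gamma>2 \<gamma>2 \<gamma>1) k = cmp \<Gamma>2 (\<eta> \<gamma>2 k) (\<eta> \<gamma>1 k)"
    if "\<gamma>2 \<in> pts (Mor \<Gamma>2)" "\<gamma>1 \<in> pts (Mor \<Gamma>2)" "src \<Gamma>2 \<gamma>2 = tgt \<Gamma>2 \<gamma>1" "k \<in> carrier G" for \<gamma>2 \<gamma>1 k
    using that by (simp add: \<eta>_def alg)
  have eta_id: "\<eta> (idm \<Gamma>2 x) k = idm \<Gamma>2 x" if "x \<in> pts M" "k \<in> carrier G" for x k
  proof -
    have "\<eta> (i (x, \<one>\<^bsub>G\<^esub>)) k = i (x, \<one>\<^bsub>G\<^esub>)" using that by (simp add: \<eta>_def alg)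
    then show ?thesis using i_one[OF that(1)] by simp
  qed
  have eta_mult: "\<eta> \<gamma> (k2 \<otimes>\<^bsub>G\<^esub> k1) = \<eta> (\<eta> \<gamma> k2) k1"
    if "\<gamma> \<in> pts (Mor \<Gamma>2)" "k2 \<in> carrier G" "k1 \<in> carrier G" for \<gamma> k2 k1
    using that by (simp add: \<eta>_def alg inv_mult_group m_comm[of k2 k1] m_comm[of "inv\<^bsub>G\<^esub> k1" "inv\<^bsub>G\<^esub> k2"])
  have eta_one: "\<eta> \<gamma> \<one>\<^bsub>G\<^esub> = \<gamma>" if "\<gamma> \<in> pts (Mor \<Gamma>2)" for \<gamma>
    using that by (simp add: \<eta>_def alg)
  have rho_functor: "\<rho> (cmp \<Gamma>2 \<gamma>2 (\<eta> \<gamma>1 k2)) (k2 \<otimes>\<^bsub>G\<^esub> k1) = cmp \<Gamma>2 (\<rho> \<gamma>2 k2) (\<rho> \<gamma>1 k1)"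
    if "\<gamma>2 \<in> pts (Mor \<Gamma>2)" "\<gamma>1 \<in> pts (Mor \<Gamma>2)" "src \<Gamma>2 \<gamma>2 = tgt \<Gamma>2 \<gamma>1" "k2 \<in> carrier G" "k1 \<in> carrier G"
    for \<gamma>2 \<gamma>1 k2 k1
    using that by (simp add: \<rho>_def \<eta>_def alg)
  have smooth_i: "smooth_map P (Mor \<Gamma>2) (\<lambda>p. i (f p, g p))"
    if "smooth_atlas P" "smooth_map P M f" "smooth_map P MG g" for P :: "('p, 'ep::euclidean_space) mfd" and f g
    using smooth_map_compose[OF that(1) aP G2.atlas_Mor smooth_map_Pair[OF that(2,3)] sm_i] .
  have smooth_ends: "smooth_map P M (\<lambda>p. src \<Gamma>2 (f p))" "smooth_map P M (\<lambda>p. tgt \<Gamma>2 (f p))"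
    if "smooth_atlas P" "smooth_map P (Mor \<Gamma>2) f" for P :: "('p, 'ep::euclidean_space) mfd" and f
    using smooth_map_compose[OF that(1) G2.atlas_Mor G2.atlas_Obj that(2) G2.smooth_src]
      smooth_map_compose[OF that(1) G2.atlas_Mor G2.atlas_Obj that(2) G2.smooth_tgt] Obj by simp_all
  have smooth_rho: "smooth_map P (Mor \<Gamma>2) (\<lambda>p. \<rho> (f p) (g p))"
    if P: "smooth_atlas P" "smooth_map P (Mor \<Gamma>2) f" "smooth_map P MG g"
    for P :: "('p, 'ep::euclidean_space) mfd" and f g
    unfolding \<rho>_def
    by (rule G2.smooth_cmp[OF P(1,2) smooth_i[OF P(1) smooth_ends(1)[OF P(1,2)] P(3)]])
      (use smooth_map_in_pts[OF P(2)] smooth_map_in_pts[OF P(3)] MG(3) in \<open>simp add: alg\<close>)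
  have smooth_eta: "smooth_map P (Mor \<Gamma>2) (\<lambda>p. \<eta> (f p) (g p))"
    if P: "smooth_atlas P" "smooth_map P (Mor \<Gamma>2) f" "smooth_map P MG g"
    for P :: "('p, 'ep::euclidean_space) mfd" and f g
    unfolding \<eta>_def
    by (rule G2.smooth_cmp[OF P(1) G2.smooth_cmp[OF P(1) smooth_i[OF P(1) smooth_ends(2)[OF P(1,2)] P(3)] P(2)]
          smooth_i[OF P(1) smooth_ends(1)[OF P(1,2)] smooth_map_inv[OF lg P(1,3)]]])
      (use smooth_map_in_pts[OF P(2)] smooth_map_in_pts[OF P(3)] MG(3) in \<open>simp_all add: alg\<close>)
  let ?\<G> = "one_object_2_group G MG"
  have aPG: "smooth_atlas (prod_mfd (Mor \<Gamma>2) MG)" by (rule smooth_atlas_prod_mfd[OF G2.atlas_Mor MG(2)])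
  note prj = smooth_map_fst[OF G2.atlas_Mor MG(2)] smooth_map_snd[OF G2.atlas_Mor MG(2)]
  have adm: "admissible \<Gamma>2 ?\<G> \<eta>"
    unfolding admissible_def
    using smooth_eta[OF aPG prj] eta eta_cmp eta_id eta_mult eta_one Obj MG(3)
    by (auto simp: composable_def case_prod_unfold)
  have rho_act: "right_lie_action G MG (Mor \<Gamma>2) \<rho>"
    unfolding right_lie_action_def
    using lg smooth_rho[OF aPG prj] rho_one rho_rho by (simp add: case_prod_unfold)
  have func: "smooth_functor (twisted_category \<Gamma>2 ?\<G> \<eta>) \<Gamma>2 (\<lambda>(\<gamma>, k). \<rho> \<gamma> k) (\<lambda>(x, a). x)"
    unfolding smooth_functor_def
  proof (intro conjI)
    show "smooth_map (Mor (twisted_category \<Gamma>2 ?\<G> \<eta>)) (Mor \<Gamma>2) (\<lambda>(\<gamma>, k). \<rho> \<gamma> k)"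
      using smooth_rho[OF aPG prj] by (simp add: case_prod_unfold)
    show "smooth_map (Obj (twisted_category \<Gamma>2 ?\<G> \<eta>)) (Obj \<Gamma>2) (\<lambda>(x, a). x)"
      using smooth_map_fst[OF aM smooth_manifold_atlas[OF smooth_manifold_point_mfd]] Obj
      by (simp add: case_prod_unfold)
    show "\<forall>z\<in>pts (Mor (twisted_category \<Gamma>2 ?\<G> \<eta>)).
        src \<Gamma>2 ((\<lambda>(\<gamma>, k). \<rho> \<gamma> k) z) = (\<lambda>(x, a). x) (src (twisted_category \<Gamma>2 ?\<G> \<eta>) z) \<and>
        tgt \<Gamma>2 ((\<lambda>(\<gamma>, k). \<rho> \<gamma> k) z) = (\<lambda>(x, a). x) (tgt (twisted_category \<Gamma>2 ?\<G> \<eta>) z)"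
      using rho MG(3) by auto
    show "\<forall>x\<in>pts (Obj (twisted_category \<Gamma>2 ?\<G> \<eta>)).
        (\<lambda>(\<gamma>, k). \<rho> \<gamma> k) (idm (twisted_category \<Gamma>2 ?\<G> \<eta>) x) = idm \<Gamma>2 ((\<lambda>(x, a). x) x)"
      using rho_one G2.id_in by auto
    show "\<forall>(z2, z1)\<in>composable (twisted_category \<Gamma>2 ?\<G> \<eta>).
        (\<lambda>(\<gamma>, k). \<rho> \<gamma> k) (cmp (twisted_category \<Gamma>2 ?\<G> \<eta>) z2 z1) =
        cmp \<Gamma>2 ((\<lambda>(\<gamma>, k). \<rho> \<gamma> k) z2) ((\<lambda>(\<gamma>, k). \<rho> \<gamma> k) z1)"
      using rho_functor MG(3) by (auto simp: composable_def)
  qed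
  have "\<exists>U \<Phi>. openin (mtop (Mor \<Gamma>1)) U \<and> b \<in> U \<and>
      diffeomorphism (prod_mfd (open_submfd (Mor \<Gamma>1) U) MG)
        (open_submfd (Mor \<Gamma>2) {p \<in> pts (Mor \<Gamma>2). \<phi> p \<in> U}) \<Phi> \<and>
      (\<forall>u\<in>U. \<forall>g\<in>carrier G. \<phi> (\<Phi> (u, g)) = u) \<and>
      (\<forall>u\<in>U. \<forall>g\<in>carrier G. \<forall>h\<in>carrier G. \<Phi> (u, g \<otimes>\<^bsub>G\<^esub> h) = \<rho> (\<Phi> (u, g)) h)"
    if b: "b \<in> pts (Mor \<Gamma>1)" for b
  proof -
    have "b \<in> \<phi> ` pts (Mor \<Gamma>2)" using b surj by simp
    then obtain p where p: "p \<in> pts (Mor \<Gamma>2)" "\<phi> p = b" by blast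
    obtain U s where U: "openin (mtop (Mor \<Gamma>1)) U" "b \<in> U"
      and s: "smooth_map (open_submfd (Mor \<Gamma>1) U) (Mor \<Gamma>2) s" "\<forall>q\<in>U. \<phi> (s q) = q"
      using submersion_local_section[OF G2.atlas_Mor G1.atlas_Mor sub p(1)] p(2) by blast
    have UM: "U \<subseteq> pts (Mor \<Gamma>1)" using U(1) openin_subset by blast
    have s_in: "s u \<in> pts (Mor \<Gamma>2)" if "u \<in> U" for u using smooth_map_in_pts[OF s(1), of u] that UM by auto
    let ?V = "{p \<in> pts (Mor \<Gamma>2). \<phi> p \<in> U}"
    have V: "openin (mtop (Mor \<Gamma>2)) ?V" by (rule smooth_map_openin_vimage[OF sm_phi U(1)])
    have aU: "smooth_atlas (open_submfd (Mor \<Gamma>1) U)" by (rule smooth_atlas_open_submfd[OF G1.atlas_Mor U(1)])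
    have aV: "smooth_atlas (open_submfd (Mor \<Gamma>2) ?V)" by (rule smooth_atlas_open_submfd[OF G2.atlas_Mor V])
    have aUG: "smooth_atlas (prod_mfd (open_submfd (Mor \<Gamma>1) U) MG)" by (rule smooth_atlas_prod_mfd[OF aU MG(2)])
    \<comment> \<open>Translating a local section of the submersion \<open>\<phi>\<close> gives the trivialization.\<close>
    let ?\<Phi> = "\<lambda>z. \<rho> (s (fst z)) (snd z)"
    have Phi: "smooth_map (prod_mfd (open_submfd (Mor \<Gamma>1) U) MG) (open_submfd (Mor \<Gamma>2) ?V) ?\<Phi>"
    proof (rule smooth_map_into_open_submfd)
      show "smooth_map (prod_mfd (open_submfd (Mor \<Gamma>1) U) MG) (Mor \<Gamma>2) ?\<Phi>"
        by (rule smooth_rho[OF aUG smooth_map_compose[OF aUG aU G2.atlas_Mor smooth_map_fst[OF aU MG(2)] s(1)]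
              smooth_map_snd[OF aU MG(2)]])
      show "?\<Phi> ` pts (prod_mfd (open_submfd (Mor \<Gamma>1) U) MG) \<subseteq> ?V"
        using rho(1) phi_rho s_in s(2) MG(3) by auto
    qed
    \<comment> \<open>The arrow \<open>e\<close> differs from the section by an element of the kernel, and reading that
      element through the inverse of the embedding \<open>i\<close> yields the group coordinate.\<close>
    let ?\<delta> = "\<lambda>e. cmp \<Gamma>2 (G2.inverse_mor (s (\<phi> e))) e"
    have phiV: "smooth_map (open_submfd (Mor \<Gamma>2) ?V) (open_submfd (Mor \<Gamma>1) U) \<phi>"
      by (rule smooth_map_into_open_submfd[OF smooth_map_restrict[OF G2.atlas_Mor sm_phi]]) auto
    have se: "s (\<phi> e) \<in> pts (Mor \<Gamma>2)" "\<phi> (s (\<phi> e)) = \<phi> e" "src \<Gamma>2 (s (\<phi> e)) = src \<Gamma>2 e"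
      "tgt \<Gamma>2 (s (\<phi> e)) = tgt \<Gamma>2 e" if "e \<in> ?V" for e
    proof -
      show *: "s (\<phi> e) \<in> pts (Mor \<Gamma>2)" "\<phi> (s (\<phi> e)) = \<phi> e" using that s_in s(2) by auto
      show "src \<Gamma>2 (s (\<phi> e)) = src \<Gamma>2 e" "tgt \<Gamma>2 (s (\<phi> e)) = tgt \<Gamma>2 e"
        using phi_src[OF *(1)] phi_tgt[OF *(1)] phi_src[of e] phi_tgt[of e] that *(2) by auto
    qed
    have sm_delta: "smooth_map (open_submfd (Mor \<Gamma>2) ?V) (Mor \<Gamma>2) ?\<delta>"
    proof (rule G2.smooth_cmp[OF aV])
      have "smooth_map (open_submfd (Mor \<Gamma>2) ?V) (Mor \<Gamma>2) (\<lambda>e. s (\<phi> e))"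
        by (rule smooth_map_compose[OF aV aU G2.atlas_Mor phiV s(1)])
      then show "smooth_map (open_submfd (Mor \<Gamma>2) ?V) (Mor \<Gamma>2) (\<lambda>e. G2.inverse_mor (s (\<phi> e)))"
        by (rule smooth_map_compose[OF aV G2.atlas_Mor G2.atlas_Mor _ G2.smooth_inverse])
      show "smooth_map (open_submfd (Mor \<Gamma>2) ?V) (Mor \<Gamma>2) (\<lambda>e. e)"
        by (rule smooth_map_restrict[OF G2.atlas_Mor smooth_map_id[OF G2.atlas_Mor]])
      show "src \<Gamma>2 (G2.inverse_mor (s (\<phi> e))) = tgt \<Gamma>2 e" if "e \<in> pts (open_submfd (Mor \<Gamma>2) ?V)" for e
        using that se G2.inverse_mor(2) by simp
    qed
    have delta: "\<exists>g\<in>carrier G. ?\<delta> e = i (src \<Gamma>2 e, g)" if e: "e \<in> ?V" for e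
    proof -
      let ?\<sigma> = "s (\<phi> e)"
      note sig = se[OF e] G2.inverse_mor[OF se(1)[OF e]]
      have e_in: "e \<in> pts (Mor \<Gamma>2)" using e by blast
      have d_in: "?\<delta> e \<in> pts (Mor \<Gamma>2)" and d_src: "src \<Gamma>2 (?\<delta> e) = src \<Gamma>2 e"
        using sig e_in by (simp_all add: alg)
      have "\<phi> (?\<delta> e) = cmp \<Gamma>1 (\<phi> (G2.inverse_mor ?\<sigma>)) (\<phi> ?\<sigma>)"
        using phi_cmp[of "G2.inverse_mor ?\<sigma>" e] sig e_in by simp
      also have "\<dots> = \<phi> (cmp \<Gamma>2 (G2.inverse_mor ?\<sigma>) ?\<sigma>)"
        using phi_cmp[of "G2.inverse_mor ?\<sigma>" ?\<sigma>] sig by simp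
      also have "\<dots> = idm \<Gamma>1 (src \<Gamma>2 e)"
        using sig phi_id ends(1)[OF e_in] by simp
      finally have "?\<delta> e \<in> i ` (pts M \<times> carrier G)"
        unfolding ker using d_in ends(1)[OF e_in] by blast
      then obtain x g where xg: "x \<in> pts M" "g \<in> carrier G" "?\<delta> e = i (x, g)" by auto
      then show ?thesis using d_src i_src[OF xg(1,2)] by auto
    qed
    let ?j = "inv_into (pts (prod_mfd M MG)) i"
    have j: "?j (i (x, g)) = (x, g)" if "x \<in> pts M" "g \<in> carrier G" for x g
      using inj that MG(3) by (simp add: inv_into_f_f)
    let ?\<Psi> = "\<lambda>e. (\<phi> e, snd (?j (?\<delta> e)))"
    have Psi: "smooth_map (open_submfd (Mor \<Gamma>2) ?V) (prod_mfd (open_submfd (Mor \<Gamma>1) U) MG) ?\<Psi>"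
    proof (rule smooth_map_Pair[OF phiV])
      have "?\<delta> ` pts (open_submfd (Mor \<Gamma>2) ?V) \<subseteq> i ` pts (prod_mfd M MG)"
        using delta ends(1) MG(3) by fastforce
      then have "smooth_map (open_submfd (Mor \<Gamma>2) ?V) (prod_mfd M MG) (\<lambda>e. ?j (?\<delta> e))"
        by (rule smooth_map_compose_smooth_on_subset[OF aV G2.atlas_Mor aP sm_delta _
              smooth_embedding_inverse[OF aP G2.atlas_Mor emb]])
      then show "smooth_map (open_submfd (Mor \<Gamma>2) ?V) MG (\<lambda>e. snd (?j (?\<delta> e)))"
        by (rule smooth_map_snd_comp[OF aV aM MG(2)])
    qed
    have PsiPhi: "?\<Psi> (?\<Phi> z) = z" if z: "z \<in> pts (prod_mfd (open_submfd (Mor \<Gamma>1) U) MG)" for z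
    proof -
      obtain u g where ug: "z = (u, g)" "u \<in> U" "g \<in> carrier G" using z MG(3) by auto
      have e: "\<phi> (\<rho> (s u) g) = u" using phi_rho s_in s(2) ug by simp
      note su = s_in[OF ug(2)] G2.inverse_mor[OF s_in[OF ug(2)]]
      have "?\<delta> (\<rho> (s u) g) = cmp \<Gamma>2 (cmp \<Gamma>2 (G2.inverse_mor (s u)) (s u)) (i (src \<Gamma>2 (s u), g))"
        unfolding e unfolding \<rho>_def using su ug(3) by (subst G2.assoc) (simp_all add: alg)
      also have "\<dots> = i (src \<Gamma>2 (s u), g)"
        using su ug(3) G2.id_left[of "i (src \<Gamma>2 (s u), g)"] by (simp add: alg)
      finally show ?thesis using j ug e ends(1)[OF su(1)] by simp
    qed
    have PhiPsi: "?\<Phi> (?\<Psi> e) = e" if e: "e \<in> pts (open_submfd (Mor \<Gamma>2) ?V)" for e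
    proof -
      have e': "e \<in> ?V" "e \<in> pts (Mor \<Gamma>2)" using e by auto
      obtain g where g: "g \<in> carrier G" "?\<delta> e = i (src \<Gamma>2 e, g)" using delta[OF e'(1)] by blast
      note sig = se[OF e'(1)] G2.inverse_mor[OF se(1)[OF e'(1)]]
      have "\<rho> (s (\<phi> e)) g = cmp \<Gamma>2 (s (\<phi> e)) (?\<delta> e)" using g(2) sig by (simp add: \<rho>_def)
      also have "\<dots> = cmp \<Gamma>2 (cmp \<Gamma>2 (s (\<phi> e)) (G2.inverse_mor (s (\<phi> e)))) e"
        using sig e'(2) by (subst G2.assoc) simp_all
      also have "\<dots> = e" using sig G2.id_left[OF e'(2)] by simp
      finally show ?thesis using g j ends(1)[OF e'(2)] by simp
    qed
    have "diffeomorphism (prod_mfd (open_submfd (Mor \<Gamma>1) U) MG) (open_submfd (Mor \<Gamma>2) ?V) ?\<Phi>"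
      unfolding diffeomorphism_def using Phi Psi PsiPhi PhiPsi by blast
    moreover have "\<forall>u\<in>U. \<forall>g\<in>carrier G. \<phi> (?\<Phi> (u, g)) = u" using phi_rho s_in s(2) by simp
    moreover have "\<forall>u\<in>U. \<forall>g\<in>carrier G. \<forall>h\<in>carrier G. ?\<Phi> (u, g \<otimes>\<^bsub>G\<^esub> h) = \<rho> (?\<Phi> (u, g)) h"
      using rho_rho s_in by simp
    ultimately show ?thesis using U by blast
  qed
  then have pb: "principal_bundle G MG (Mor \<Gamma>2) (Mor \<Gamma>1) \<phi> \<rho>"
    unfolding principal_bundle_def
    using G2.manifold_Mor G1.manifold_Mor sm_phi rho_act by blast
  have "twisted_action ?\<G> \<Gamma>2 \<eta> \<rho> (\<lambda>x _. x)"
    unfolding twisted_action_def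
    using adm func rho_act right_lie_action_point[OF aM] Obj by simp
  then have "twisted_principal_bundle ?\<G> \<Gamma>1 \<Gamma>2 \<phi> (\<lambda>x. x) \<eta> \<rho> (\<lambda>x _. x)"
    unfolding twisted_principal_bundle_def
    using lie_2_group_one_object[OF lg comm] Gam fphi pb principal_bundle_point[OF G2.manifold_Obj] Obj
    by simp
  then show ?thesis unfolding \<rho>_def \<eta>_def .
qed

section \<open>The correspondence\<close>

theorem proposition4p63:
  fixes G :: "'g monoid" and MG :: "('g, 'eg::euclidean_space) mfd"
  assumes "lie_group G MG" and "comm_group G"
  shows
    "(\<forall>(X :: ('n, 'en::euclidean_space, 'p, 'ep::euclidean_space) smcat)
       (E :: ('m, 'em::euclidean_space, 'o, 'eo::euclidean_space) smcat) \<pi>1 \<pi>0 \<eta> \<rho>1 \<rho>0.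
        twisted_principal_bundle (one_object_2_group G MG) X E \<pi>1 \<pi>0 \<eta> \<rho>1 \<rho>0 \<longrightarrow>
        diffeomorphism (Obj E) (Obj X) \<pi>0 \<and>
        (let E' = identify_objects \<pi>0 (Obj X) E in
           lie_groupoid_extension G MG (Obj X) E' X (\<lambda>(x, g). \<rho>1 (idm E' x) g) \<pi>1))
     \<and>
     (\<forall>(M :: ('x, 'ex::euclidean_space) mfd)
       (\<Gamma>2 :: ('m2, 'e2::euclidean_space, 'x, 'ex) smcat)
       (\<Gamma>1 :: ('m1, 'e1::euclidean_space, 'x, 'ex) smcat) i \<phi>.
        lie_groupoid_extension G MG M \<Gamma>2 \<Gamma>1 i \<phi> \<longrightarrow>
        twisted_principal_bundle (one_object_2_group G MG) \<Gamma>1 \<Gamma>2 \<phi> (\<lambda>x. x)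
          (\<lambda>\<gamma> g. cmp \<Gamma>2 (cmp \<Gamma>2 (i (tgt \<Gamma>2 \<gamma>, g)) \<gamma>) (i (src \<Gamma>2 \<gamma>, inv\<^bsub>G\<^esub> g)))
          (\<lambda>\<gamma> g. cmp \<Gamma>2 \<gamma> (i (src \<Gamma>2 \<gamma>, g)))
          (\<lambda>x _. x))"
  using twisted_principal_bundle_extension lie_groupoid_extension_twisted_principal_bundle[OF assms(2)]
  by (auto simp: Let_def)

end
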